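(* Let $M$ be a Veech surface and let $S_M\subset\mathbf{R}^2$ be the set of holonomy vectors of its saddle connections. There are constants $C_M$ and $c$, depending only on $M$, such that for any $D>0$ $$\limsup_{R\to\infty}\frac{|\{(\mathbf{x},\mathbf{y})\in S_M\times S_M:\ \mathbf{x}\in B_R,\ \mathbf{y}\in\mathcal{D}_{D,1}(\mathbf{x})\}|}{R^2}\le C_M(D+c).$$
   Context: A translation surface is a closed Riemann surface with a nonzero holomorphic 1-form $\omega$; its singularities are the zeros of $\omega$ (or marked points). A saddle connection is a geodesic segment for the flat metric joining two singularities with no singularity in its interior; its holonomy vector is the integral of $\omega$ along it, viewed in $\mathbf{R}^2\cong\mathbf{C}$ (both orientations are taken). $S_M$ is the set of all these vectors. The Veech group of $M$ is its stabilizer under the action of $\mathrm{SL}_2(\mathbf{R})$ on the moduli space of translation surfaces; $M$ is a Veech surface if its Veech group is a lattice in $\mathrm{SL}_2(\mathbf{R})$. $B_R$ is the disk of radius $R$ centered at the origin. For $\mathbf{x}\in\mathbf{R}^2$ and $D>0$, $$\mathcal{D}_{D,1}(\mathbf{x})=\{\mathbf{y}\in\mathbf{R}^2: |\mathbf{y}|\le|\mathbf{x}|\ \text{and}\ |\mathbf{x}\wedge\mathbf{y}|\le D\},$$ where $|\mathbf{x}|$ is the Euclidean norm of a vector and $|\mathbf{x}\wedge\mathbf{y}|=|\det(\mathbf{x}\,|\,\mathbf{y})|$. *)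

theory Defs
  imports "HOL-Analysis.Analysis" "HOL-Algebra.Group"
begin

section \<open>Closed Riemann surfaces with a holomorphic 1-form\<close>

type_synonym 'a chart = "'a set \<times> ('a \<Rightarrow> complex)"

text \<open>The field \<open>oneform\<close> gives the local expressions of the 1-form: in the chart
  \<open>(U, \<phi>)\<close> the form is \<open>f(z) dz\<close> with \<open>f = oneform M (U, \<phi>)\<close>. The field
  \<open>marked\<close> is a set of marked points; it may be empty and may contain zeros of the form.\<close>

record 'a surface =
  surf :: "'a topology"
  atlas :: "'a chart set"
  oneform :: "'a chart \<Rightarrow> complex \<Rightarrow> complex"
  marked :: "'a set"

definition is_chart :: "'a topology \<Rightarrow> 'a chart \<Rightarrow> bool" where
  "is_chart X = (\<lambda>(U, \<phi>). openin X U \<and> open (\<phi> ` U) \<and>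
     homeomorphic_map (subtopology X U) (top_of_set (\<phi> ` U)) \<phi>)"

definition closed_riemann_surface :: "'a topology \<Rightarrow> 'a chart set \<Rightarrow> bool" where
  "closed_riemann_surface X \<A> \<longleftrightarrow>
     compact_space X \<and> connected_space X \<and> Hausdorff_space X \<and> topspace X \<noteq> {} \<and>
     (\<forall>c\<in>\<A>. is_chart X c) \<and> (\<Union>(fst ` \<A>)) = topspace X \<and>
     (\<forall>(U, \<phi>)\<in>\<A>. \<forall>(V, \<psi>)\<in>\<A>. (\<psi> \<circ> inv_into U \<phi>) holomorphic_on \<phi> ` (U \<inter> V))"

text \<open>The second condition is the transformation rule \<open>f(z) dz = g(w) dw\<close> on overlaps.\<close>

definition holomorphic_oneform ::
    "'a chart set \<Rightarrow> ('a chart \<Rightarrow> complex \<Rightarrow> complex) \<Rightarrow> bool" where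
  "holomorphic_oneform \<A> \<omega> \<longleftrightarrow>
     (\<forall>(U, \<phi>)\<in>\<A>. \<omega> (U, \<phi>) holomorphic_on \<phi> ` U) \<and>
     (\<forall>(U, \<phi>)\<in>\<A>. \<forall>(V, \<psi>)\<in>\<A>. \<forall>p\<in>U \<inter> V.
        \<omega> (U, \<phi>) (\<phi> p) = \<omega> (V, \<psi>) (\<psi> p) * deriv (\<psi> \<circ> inv_into U \<phi>) (\<phi> p))"

definition oneform_zeros :: "'a surface \<Rightarrow> 'a set" where
  "oneform_zeros M = {p. \<exists>(U, \<phi>)\<in>atlas M. p \<in> U \<and> oneform M (U, \<phi>) (\<phi> p) = 0}"

definition translation_surface :: "'a surface \<Rightarrow> bool" where
  "translation_surface M \<longleftrightarrow>
     closed_riemann_surface (surf M) (atlas M) \<and>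
     holomorphic_oneform (atlas M) (oneform M) \<and>
     oneform_zeros M \<noteq> topspace (surf M) \<and>
     finite (marked M) \<and> marked M \<subseteq> topspace (surf M)"

definition singularities :: "'a surface \<Rightarrow> 'a set" where
  "singularities M = oneform_zeros M \<union> marked M"

text \<open>A flat coordinate is a local coordinate \<open>\<zeta>\<close> away from the singularities with
  \<open>\<omega> = d\<zeta>\<close>; the flat metric \<open>\<bar>\<omega>\<bar>\<close> is then the Euclidean metric in the coordinate \<open>\<zeta>\<close>.\<close>

definition flat_coordinate :: "'a surface \<Rightarrow> 'a chart \<Rightarrow> bool" where
  "flat_coordinate M = (\<lambda>(U, \<zeta>). is_chart (surf M) (U, \<zeta>) \<and> U \<inter> singularities M = {} \<and>
     (\<forall>(V, \<phi>)\<in>atlas M. \<forall>p\<in>U \<inter> V.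
        ((\<zeta> \<circ> inv_into V \<phi>) has_field_derivative oneform M (V, \<phi>) (\<phi> p)) (at (\<phi> p))))"

section \<open>Saddle connections and their holonomy\<close>

text \<open>Saddle connections are oriented and parametrised by \<open>[0, 1]\<close> at constant speed: on the
  interior the path is locally affine and nonconstant in flat coordinates, which is the
  geodesic equation of the flat metric.\<close>

definition saddle_connection :: "'a surface \<Rightarrow> (real \<Rightarrow> 'a) \<Rightarrow> bool" where
  "saddle_connection M \<gamma> \<longleftrightarrow>
     pathin (surf M) \<gamma> \<and> \<gamma> 0 \<in> singularities M \<and> \<gamma> 1 \<in> singularities M \<and>
     (\<forall>t\<in>{0<..<1}. \<gamma> t \<notin> singularities M \<and>
        (\<exists>U \<zeta> v \<epsilon>. flat_coordinate M (U, \<zeta>) \<and> v \<noteq> 0 \<and> \<epsilon> > 0 \<and>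
           (\<forall>s. \<bar>s - t\<bar> < \<epsilon> \<longrightarrow> \<gamma> s \<in> U \<and> \<zeta> (\<gamma> s) = \<zeta> (\<gamma> t) + of_real (s - t) * v)))"

text \<open>\<open>\<omega>(\<gamma>'(t))\<close>, computed in some chart around \<open>\<gamma> t\<close>. By the transformation rule it does not
  depend on the chart when \<open>\<gamma>\<close> is differentiable at \<open>t\<close>.\<close>

definition oneform_velocity :: "'a surface \<Rightarrow> (real \<Rightarrow> 'a) \<Rightarrow> real \<Rightarrow> complex" where
  "oneform_velocity M \<gamma> t =
     (let c = (SOME c. c \<in> atlas M \<and> \<gamma> t \<in> fst c)
      in oneform M c (snd c (\<gamma> t)) * vector_derivative (snd c \<circ> \<gamma>) (at t))"

definition holonomy :: "'a surface \<Rightarrow> (real \<Rightarrow> 'a) \<Rightarrow> complex" where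
  "holonomy M \<gamma> = integral {0..1} (oneform_velocity M \<gamma>)"

definition complex_to_vec :: "complex \<Rightarrow> real^2" where
  "complex_to_vec z = vector [Re z, Im z]"

definition vec_to_complex :: "real^2 \<Rightarrow> complex" where
  "vec_to_complex x = Complex (x $ 1) (x $ 2)"

definition saddle_holonomies :: "'a surface \<Rightarrow> (real^2) set" where
  "saddle_holonomies M = {complex_to_vec (holonomy M \<gamma>) |\<gamma>. saddle_connection M \<gamma>}"

section \<open>The Veech group\<close>

definition SL2_set :: "(real^2^2) set" where
  "SL2_set = {g. det g = 1}"

definition SL2 :: "(real^2^2) monoid" where
  "SL2 = \<lparr>carrier = SL2_set, mult = (**), one = mat 1\<rparr>"

text \<open>Isomorphism of translation surfaces, i.e. equality in the moduli space: a biholomorphism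
  pulling back one form to the other and matching the singularities (hence also the
  marked points, possibly permuting them).\<close>

definition translation_iso :: "'a surface \<Rightarrow> 'b surface \<Rightarrow> ('a \<Rightarrow> 'b) \<Rightarrow> bool" where
  "translation_iso M N F \<longleftrightarrow>
     homeomorphic_map (surf M) (surf N) F \<and> F ` singularities M = singularities N \<and>
     (\<forall>(U, \<phi>)\<in>atlas M. \<forall>(V, \<psi>)\<in>atlas N. \<forall>p\<in>U. F p \<in> V \<longrightarrow>
        (\<exists>D. ((\<psi> \<circ> F \<circ> inv_into U \<phi>) has_field_derivative D) (at (\<phi> p)) \<and>
             oneform M (U, \<phi>) (\<phi> p) = oneform N (V, \<psi>) (\<psi> (F p)) * D))"

text \<open>\<open>N\<close> represents \<open>g \<cdot> M\<close>: same topological surface and singularities, with the flat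
  coordinates of \<open>M\<close> postcomposed with the linear map \<open>g\<close>. This determines the complex structure
  and the 1-form of \<open>N\<close>, as both extend uniquely over the singularities.\<close>

definition SL2_action :: "real^2^2 \<Rightarrow> 'a surface \<Rightarrow> 'a surface \<Rightarrow> bool" where
  "SL2_action g M N \<longleftrightarrow>
     translation_surface N \<and> surf N = surf M \<and> singularities N = singularities M \<and>
     (\<forall>U \<zeta>. flat_coordinate M (U, \<zeta>) \<longrightarrow>
        flat_coordinate N (U, \<lambda>p. vec_to_complex (g *v complex_to_vec (\<zeta> p))))"

definition veech_group :: "'a surface \<Rightarrow> (real^2^2) set" where
  "veech_group M = {g \<in> SL2_set. \<exists>N F. SL2_action g M N \<and> translation_iso M N F}"

section \<open>Lattices and Veech surfaces\<close>

definition haar_measure_SL2 :: "(real^2^2) measure \<Rightarrow> bool" where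
  "haar_measure_SL2 \<mu> \<longleftrightarrow>
     space \<mu> = SL2_set \<and> sets \<mu> = sets (restrict_space borel SL2_set) \<and>
     emeasure \<mu> SL2_set \<noteq> 0 \<and>
     (\<forall>K. compact K \<and> K \<subseteq> SL2_set \<longrightarrow> emeasure \<mu> K < \<infinity>) \<and>
     (\<forall>g\<in>SL2_set. \<forall>A\<in>sets \<mu>. emeasure \<mu> ((**) g ` A) = emeasure \<mu> A)"

text \<open>A discrete subgroup of finite covolume: finitely much Haar measure suffices to cover
  \<open>SL2 / \<Gamma>\<close>. Haar measures exist and are unique up to scaling, so quantifying over all of them
  amounts to choosing one.\<close>

definition lattice_SL2 :: "(real^2^2) set \<Rightarrow> bool" where
  "lattice_SL2 \<Gamma> \<longleftrightarrow> subgroup \<Gamma> SL2 \<and> discrete \<Gamma> \<and>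
     (\<forall>\<mu>. haar_measure_SL2 \<mu> \<longrightarrow>
        (\<exists>F\<in>sets \<mu>. emeasure \<mu> F < \<infinity> \<and> {f ** \<gamma> |f \<gamma>. f \<in> F \<and> \<gamma> \<in> \<Gamma>} = SL2_set))"

definition veech_surface :: "'a surface \<Rightarrow> bool" where
  "veech_surface M \<longleftrightarrow> translation_surface M \<and> lattice_SL2 (veech_group M)"

section \<open>Counting pairs\<close>

definition wedge :: "real^2 \<Rightarrow> real^2 \<Rightarrow> real" where
  "wedge x y = det (transpose (vector [x, y] :: real^2^2))"

definition wedge_region :: "real \<Rightarrow> real^2 \<Rightarrow> (real^2) set" where
  "wedge_region D x = {y. norm y \<le> norm x \<and> \<bar>wedge x y\<bar> \<le> D}"

text \<open>Cardinality with value \<open>\<infinity>\<close> on infinite sets (unlike \<^const>\<open>card\<close>).\<close>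

definition ecardinality :: "'a set \<Rightarrow> ereal" where
  "ecardinality A = (if finite A then ereal (real (card A)) else \<infinity>)"

definition close_pairs :: "'a surface \<Rightarrow> real \<Rightarrow> real \<Rightarrow> ((real^2) \<times> (real^2)) set" where
  "close_pairs M D R =
     {(x, y). (x, y) \<in> saddle_holonomies M \<times> saddle_holonomies M \<and>
        x \<in> cball 0 R \<and> y \<in> wedge_region D x}"

end

theory Submission imports Defs "HOL-Complex_Analysis.Complex_Analysis" begin

text \<open>
  Write \<open>S\<close> for the set of holonomies and \<open>\<Gamma>\<close> for the Veech group. Suppose that non-parallel
  elements of \<open>S\<close> satisfy \<open>\<bar>x \<and> y\<bar> \<ge> \<epsilon>\<close> and that a line contains at most \<open>N\<close> elements of \<open>S\<close>. Then
  the slopes of points of \<open>S\<close> in a box are separated, and a box of area \<open>A\<close> contains \<open>O(A + 1)\<close>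
  points of \<open>S\<close>. Applied to the square around the disk and to the strip around \<open>x\<close>, this bounds the
  number of pairs by \<open>C R\<^sup>2 (D + c)\<close>.

  The constants \<open>\<epsilon>\<close> and \<open>N\<close> come from three facts about \<open>S\<close>: it is \<open>\<Gamma>\<close>-invariant, its elements have
  length bounded below, and it meets each line in a finite set. By finite covolume, contracting
  \<open>x \<in> S\<close> produces elements of \<open>\<Gamma>\<close> conjugate to matrices close to the identity; by Zassenhaus'
  commutator estimate they commute, and in the limit they fix the line of \<open>x\<close>. So every \<open>x \<in> S\<close> is
  fixed by a parabolic element of \<open>\<Gamma>\<close>. Shimizu's lemma makes the corresponding cusp neighbourhoods
  disjoint, so finite covolume leaves finitely many cusps, and Shimizu's lemma together with the
  lower bound on lengths gives \<open>\<epsilon>\<close>.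
\<close>

text \<open>The obstacle is the lower bound \<epsilon> for nonzero wedges: local geometry of the
  surface directly bounds only lengths from below, not areas. Shimizu's lemma turns the one into the
  other, but it speaks about transvections in the group, so each holonomy must first be tied to one,
  by a scalar that is bounded below. The existence of the transvection comes from a limit argument
  along the contraction of a single vector and is not uniform; uniformity returns only with the
  finiteness of the cusps, since finitely many representatives allow a minimum. Finite covolume is
  used twice in one combinatorial form: only boundedly many translates of a fixed neighbourhood of 1
  embed disjointly in the quotient. The first time the translates are centred along one contracting
  ray, which escapes to infinity; the second time they are centred in inequivalent cusps. The
  additive constant c reflects the additive 1 in the count O(A + 1): a thin strip may still contain
  a line of holonomies.\<close>

no_notation fps_nth (infixl "$" 75)

section \<open>Counting points with separated directions\<close>

lemma wedge_eq: "wedge x y = x$1 * y$2 - x$2 * y$1"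
  by (simp add: wedge_def det_2 transpose_def)

text \<open>The shift by 1/2 fits floors: |q| \<le> K puts the floor of q in [-K - 1, K], an
  interval symmetric about -1/2 with at most 2K + 2 integers.\<close>

lemma card_fibres_le:
  fixes f :: "'a \<Rightarrow> int" and N :: nat
  assumes range: "\<And>y. y \<in> T \<Longrightarrow> \<bar>of_int (f y) + (1/2::real)\<bar> \<le> K + 1/2"
    and fib: "\<And>y. y \<in> T \<Longrightarrow> finite {z\<in>T. f z = f y} \<and> card {z\<in>T. f z = f y} \<le> N"
    and "K \<ge> 0"
  shows "finite T \<and> real (card T) \<le> real N * (2 * K + 2)"
proof -
  define J where "J = {- (\<lfloor>K\<rfloor> + 1) .. \<lfloor>K\<rfloor>}"
  have J: "f y \<in> J" if "y \<in> T" for y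
  proof -
    have "of_int (f y) \<le> K" "- K - 1 \<le> of_int (f y)" using range[OF that] by linarith+
    then have "f y \<le> \<lfloor>K\<rfloor>" "-(\<lfloor>K\<rfloor> + 1) \<le> f y" by linarith+
    then show ?thesis by (auto simp: J_def)
  qed
  have T: "T = (\<Union>j\<in>f ` T. {z\<in>T. f z = j})" by auto
  have finJ: "finite (f ` T)" by (rule finite_subset[of _ J]) (use J in \<open>auto simp: J_def\<close>)
  have "finite (\<Union>j\<in>f ` T. {z\<in>T. f z = j})"
    using finJ by (rule finite_UN_I) (use fib in auto)
  then have fin: "finite T" using T by simp
  have "card T \<le> (\<Sum>j\<in>f ` T. card {z\<in>T. f z = j})"
    using card_UN_le[OF finJ, of "\<lambda>j. {z\<in>T. f z = j}"] T by simp
  also have "\<dots> \<le> (\<Sum>j\<in>f ` T. N)" by (rule sum_mono) (use fib in auto)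
  also have "\<dots> = card (f ` T) * N" by simp
  also have "\<dots> \<le> card J * N" by (intro mult_right_mono card_mono) (use J in \<open>auto simp: J_def\<close>)
  finally have "real (card T) \<le> real (card J * N)" by (rule of_nat_mono)
  also have "real (card J) = 2 * of_int \<lfloor>K\<rfloor> + 2"
    using \<open>K \<ge> 0\<close> by (simp add: J_def)
  then have "real (card J * N) \<le> real N * (2 * K + 2)"
    by (simp add: mult.commute mult_left_mono)
  finally show ?thesis using fin by blast
qed

text \<open>In the cone the slope b/a is at most B/A in absolute value, and slopes of non-parallel
  points differ by at least \<epsilon>/A^2, because the determinant is the slope difference times
  the two first coordinates. Hence a pigeonhole over slope cells of length \<epsilon>/A^2, each
  holding points of one line only. The coordinates \<open>a\<close>, \<open>b\<close> are arbitrary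
  functions so that they can be swapped or rotated later.\<close>

lemma count_cone:
  fixes a b :: "'v \<Rightarrow> real" and N :: nat
  assumes sep: "\<And>y z. y \<in> S \<Longrightarrow> z \<in> S \<Longrightarrow> a y * b z = a z * b y \<or> \<epsilon> \<le> \<bar>a y * b z - a z * b y\<bar>"
    and line: "\<And>y. y \<in> S \<Longrightarrow> finite {z\<in>S. a y * b z = a z * b y} \<and> card {z\<in>S. a y * b z = a z * b y} \<le> N"
    and nz: "\<And>y. y \<in> S \<Longrightarrow> a y \<noteq> 0 \<or> b y \<noteq> 0"
    and pos: "\<epsilon> > 0" "A > 0" "B > 0"
  defines "T \<equiv> {y\<in>S. \<bar>a y\<bar> \<le> A \<and> \<bar>b y\<bar> * A \<le> B * \<bar>a y\<bar>}"
  shows "finite T \<and> real (card T) \<le> real N * (2 * (A * B / \<epsilon>) + 2)"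
proof (rule card_fibres_le)
  let ?q = "\<lambda>y. b y / a y * (A\<^sup>2 / \<epsilon>)"
  let ?f = "\<lambda>y. \<lfloor>?q y\<rfloor>"
  have a0: "a y \<noteq> 0" if "y \<in> T" for y
    using that nz[of y] pos by (auto simp: T_def mult_le_0_iff)
  fix y assume y: "y \<in> T"
  have "\<bar>b y\<bar> / \<bar>a y\<bar> \<le> B / A"
    using y a0[OF y] pos by (auto simp: T_def field_simps)
  then have "\<bar>b y\<bar> / \<bar>a y\<bar> * (A\<^sup>2 / \<epsilon>) \<le> B / A * (A\<^sup>2 / \<epsilon>)"
    by (rule mult_right_mono) (use pos in auto)
  also have "\<dots> = A * B / \<epsilon>" using pos by (simp add: power2_eq_square)
  finally have "\<bar>?q y\<bar> \<le> A * B / \<epsilon>" using pos by (simp add: abs_mult)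
  then show "\<bar>of_int (?f y) + (1/2::real)\<bar> \<le> A * B / \<epsilon> + 1/2" by linarith
  have sub: "{z\<in>T. ?f z = ?f y} \<subseteq> {z\<in>S. a y * b z = a z * b y}"
  proof safe
    fix z assume z: "z \<in> T" "?f z = ?f y"
    then show "z \<in> S" by (simp add: T_def)
    have "\<bar>?q z - ?q y\<bar> < 1" using z(2) by linarith
    then have "\<bar>(b z / a z - b y / a y) * (A\<^sup>2 / \<epsilon>)\<bar> < 1" by (simp only: left_diff_distrib)
    then have "\<bar>b z / a z - b y / a y\<bar> * (A\<^sup>2 / \<epsilon>) < 1"
      using pos by (simp add: abs_mult)
    then have lt: "\<bar>b z / a z - b y / a y\<bar> * A\<^sup>2 < \<epsilon>"
      using pos by (simp only: times_divide_eq_right divide_less_eq_1_pos)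
    have "\<bar>a y * b z - a z * b y\<bar> = \<bar>b z / a z - b y / a y\<bar> * (\<bar>a y\<bar> * \<bar>a z\<bar>)"
      using a0[OF y] a0[OF z(1)] by (simp add: abs_mult[symmetric] field_simps)
    also have "\<dots> \<le> \<bar>b z / a z - b y / a y\<bar> * A\<^sup>2"
      unfolding power2_eq_square by (intro mult_left_mono mult_mono) (use y z pos in \<open>auto simp: T_def\<close>)
    finally show "a y * b z = a z * b y" using lt sep[of y z] y z by (auto simp: T_def)
  qed
  have "y \<in> S" using y by (simp add: T_def)
  then show "finite {z\<in>T. ?f z = ?f y} \<and> card {z\<in>T. ?f z = ?f y} \<le> N"
    using sub line[of y] card_mono[OF _ sub] by (meson finite_subset le_trans)
next
  show "0 \<le> A * B / \<epsilon>" using pos by simp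
qed

text \<open>The diagonals cut the box into two cones; the steep one becomes a flat one after
  exchanging \<open>a\<close> and \<open>b\<close>.\<close>

lemma count_box:
  fixes a b :: "'v \<Rightarrow> real" and N :: nat
  assumes sep: "\<And>y z. y \<in> S \<Longrightarrow> z \<in> S \<Longrightarrow> a y * b z = a z * b y \<or> \<epsilon> \<le> \<bar>a y * b z - a z * b y\<bar>"
    and line: "\<And>y. y \<in> S \<Longrightarrow> finite {z\<in>S. a y * b z = a z * b y} \<and> card {z\<in>S. a y * b z = a z * b y} \<le> N"
    and nz: "\<And>y. y \<in> S \<Longrightarrow> a y \<noteq> 0 \<or> b y \<noteq> 0"
    and pos: "\<epsilon> > 0" "A > 0" "B > 0"
  defines "T \<equiv> {y\<in>S. \<bar>a y\<bar> \<le> A \<and> \<bar>b y\<bar> \<le> B}"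
  shows "finite T \<and> real (card T) \<le> real N * (4 * (A * B / \<epsilon>) + 4)"
proof -
  let ?T1 = "{y\<in>S. \<bar>a y\<bar> \<le> A \<and> \<bar>b y\<bar> * A \<le> B * \<bar>a y\<bar>}"
  let ?T2 = "{y\<in>S. \<bar>b y\<bar> \<le> B \<and> \<bar>a y\<bar> * B \<le> A * \<bar>b y\<bar>}"
  have 1: "finite ?T1 \<and> real (card ?T1) \<le> real N * (2 * (A * B / \<epsilon>) + 2)"
    by (rule count_cone[OF sep line nz pos])
  have 2: "finite ?T2 \<and> real (card ?T2) \<le> real N * (2 * (B * A / \<epsilon>) + 2)"
  proof (rule count_cone)
    fix y z assume "y \<in> S" "z \<in> S"
    then show "b y * a z = b z * a y \<or> \<epsilon> \<le> \<bar>b y * a z - b z * a y\<bar>"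
      using sep[of y z] by (auto simp: mult.commute abs_minus_commute)
  next
    fix y assume "y \<in> S"
    moreover have "{z\<in>S. b y * a z = b z * a y} = {z\<in>S. a y * b z = a z * b y}"
      by (auto simp: mult.commute)
    ultimately show "finite {z\<in>S. b y * a z = b z * a y} \<and> card {z\<in>S. b y * a z = b z * a y} \<le> N"
      using line by simp
  qed (use nz pos in auto)
  have T: "T \<subseteq> ?T1 \<union> ?T2" by (auto simp: T_def mult.commute)
  have fin: "finite (?T1 \<union> ?T2)" using 1 2 by blast
  have "card T \<le> card ?T1 + card ?T2"
    using card_mono[OF fin T] card_Un_le[of ?T1 ?T2] by linarith
  then have "real (card T) \<le> real (card ?T1) + real (card ?T2)"
    by linarith
  also have "\<dots> \<le> real N * (2 * (A * B / \<epsilon>) + 2) + real N * (2 * (B * A / \<epsilon>) + 2)"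
    using 1 2 by (intro add_mono) blast+
  finally have "real (card T) \<le> real N * (4 * (A * B / \<epsilon>) + 4)"
    by (simp add: algebra_simps)
  then show ?thesis using finite_subset[OF T fin] by blast
qed

lemma ecardinality_SIGMA_le:
  assumes "finite X" "real (card X) \<le> p" "\<And>x. x \<in> X \<Longrightarrow> finite (Y x) \<and> real (card (Y x)) \<le> q" "q \<ge> 0"
  shows "ecardinality (SIGMA x:X. Y x) \<le> ereal (p * q)"
proof -
  have "real (card (SIGMA x:X. Y x)) = (\<Sum>x\<in>X. real (card (Y x)))"
    using assms by simp
  also have "\<dots> \<le> (\<Sum>x\<in>X. q)" by (rule sum_mono) (use assms in auto)
  also have "\<dots> \<le> p * q" using assms by (simp add: mult_right_mono)
  finally show ?thesis using assms by (simp add: ecardinality_def finite_SigmaI)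
qed

text \<open>The two boxes are the square around the disk of radius \<open>R\<close> and, in coordinates adapted to
  \<open>x\<close>, the strip of area \<open>4 D\<close> containing \<open>wedge_region D x\<close>.\<close>

lemma close_pairs_bound:
  fixes M :: "'a surface" and N :: nat
  defines "S \<equiv> saddle_holonomies M"
  assumes sep: "\<And>x y. x \<in> S \<Longrightarrow> y \<in> S \<Longrightarrow> wedge x y = 0 \<or> \<epsilon> \<le> \<bar>wedge x y\<bar>"
    and line: "\<And>x. x \<in> S \<Longrightarrow> finite {y\<in>S. wedge x y = 0} \<and> card {y\<in>S. wedge x y = 0} \<le> N"
    and nz: "0 \<notin> S" and pos: "\<epsilon> > 0" "D > 0" "R > 0"
  shows "ecardinality (close_pairs M D R) \<le>
    ereal ((real N * (4 * (R * R / \<epsilon>) + 4)) * (real N * (4 * (D / \<epsilon>) + 4)))"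
proof -
  define X where "X = {x\<in>S. \<bar>x$1\<bar> \<le> R \<and> \<bar>x$2\<bar> \<le> R}"
  define Y where "Y x = {y\<in>S. \<bar>inner x y\<bar> / norm x \<le> norm x \<and> \<bar>wedge x y\<bar> / norm x \<le> D / norm x}" for x
  have X: "finite X \<and> real (card X) \<le> real N * (4 * (R * R / \<epsilon>) + 4)"
    unfolding X_def
  proof (rule count_box)
    show "x$1 \<noteq> 0 \<or> x$2 \<noteq> 0" if "x \<in> S" for x :: "real^2"
    proof (rule ccontr)
      assume "\<not> ?thesis" then have "x = 0" by (simp add: vec_eq_iff forall_2)
      then show False using nz that by simp
    qed
  qed (use sep line pos in \<open>auto simp: wedge_eq mult.commute\<close>)
  have Y: "finite (Y x) \<and> real (card (Y x)) \<le> real N * (4 * (D / \<epsilon>) + 4)" if x: "x \<in> X" for x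
  proof -
    have "x \<noteq> 0" using x nz by (auto simp: X_def)
    then have n: "norm x > 0" by simp
    have nn: "norm x * norm x = x$1*x$1 + x$2*x$2"
      by (simp add: norm_eq_sqrt_inner inner_vec_def sum_2)
    \<comment> \<open>The new coordinates come from the rotation taking x to the positive first
      axis, so they preserve the wedge and the separation hypothesis carries over unchanged.\<close>
    have id: "(inner x y / norm x) * (wedge x z / norm x) - (inner x z / norm x) * (wedge x y / norm x) = wedge y z" for y z
    proof -
      have "(inner x y) * (wedge x z) - (inner x z) * (wedge x y) = (norm x * norm x) * wedge y z"
        unfolding nn by (simp add: inner_vec_def sum_2 wedge_eq algebra_simps)
      then show ?thesis using n by (simp add: field_simps)
    qed
    have id0: "(inner x y / norm x) * (wedge x z / norm x) = (inner x z / norm x) * (wedge x y / norm x) \<longleftrightarrow> wedge y z = 0" for y z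
      using id[of y z] by linarith
    have "finite {y\<in>S. \<bar>inner x y / norm x\<bar> \<le> norm x \<and> \<bar>wedge x y / norm x\<bar> \<le> D / norm x} \<and>
      real (card {y\<in>S. \<bar>inner x y / norm x\<bar> \<le> norm x \<and> \<bar>wedge x y / norm x\<bar> \<le> D / norm x})
        \<le> real N * (4 * (norm x * (D / norm x) / \<epsilon>) + 4)"
    proof (rule count_box)
      fix y assume y: "y \<in> S"
      show "inner x y / norm x \<noteq> 0 \<or> wedge x y / norm x \<noteq> 0"
      proof (rule ccontr)
        assume "\<not> ?thesis"
        then have 0: "inner x y = 0" "wedge x y = 0" using n by auto
        then have "(inner x y)\<^sup>2 + (wedge x y)\<^sup>2 = 0" by simp
        moreover have "(inner x y)\<^sup>2 + (wedge x y)\<^sup>2 = (norm x * norm x) * (y$1*y$1 + y$2*y$2)"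
          unfolding nn by (simp add: inner_vec_def sum_2 wedge_eq algebra_simps power2_eq_square)
        ultimately have "y$1*y$1 + y$2*y$2 = 0" using n by simp
        then have "y = 0" by (simp add: vec_eq_iff forall_2)
        then show False using nz y by simp
      qed
    qed (use sep line pos n in \<open>auto simp only: id id0 divide_pos_pos\<close>)
    then show ?thesis using n by (simp add: Y_def)
  qed
  have "close_pairs M D R \<subseteq> (SIGMA x:X. Y x)"
  proof clarify
    fix x y assume xy: "(x, y) \<in> close_pairs M D R"
    then have *: "x \<in> S" "y \<in> S" "norm x \<le> R" "norm y \<le> norm x" "\<bar>wedge x y\<bar> \<le> D"
      by (auto simp: close_pairs_def S_def wedge_region_def)
    have "x \<noteq> 0" using * nz by auto
    have "x \<in> X" using * component_le_norm_cart[of x 1] component_le_norm_cart[of x 2]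
      by (auto simp: X_def)
    moreover have "\<bar>inner x y\<bar> \<le> norm x * norm x"
      using Cauchy_Schwarz_ineq2[of x y] * mult_left_mono[of "norm y" "norm x" "norm x"] by simp
    then have "y \<in> Y x" using * \<open>x \<noteq> 0\<close> by (simp add: Y_def field_simps)
    ultimately show "x \<in> X \<and> y \<in> Y x" by simp
  qed
  moreover have "finite (SIGMA x:X. Y x)" using X Y by auto
  ultimately have "ecardinality (close_pairs M D R) \<le> ecardinality (SIGMA x:X. Y x)"
    by (simp add: ecardinality_def finite_subset card_mono del: card_SigmaI)
  also have "\<dots> \<le> ereal ((real N * (4 * (R * R / \<epsilon>) + 4)) * (real N * (4 * (D / \<epsilon>) + 4)))"
    by (rule ecardinality_SIGMA_le) (use X Y pos in auto)
  finally show ?thesis .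
qed

text \<open>Here c is \<epsilon>: the factor 4D/\<epsilon> + 4 of the strip count equals
  (4/\<epsilon>)(D + \<epsilon>). The additive 4 of the disk count is absorbed into R^2 as soon as R
  \<ge> 1.\<close>

lemma close_pairs_limsup:
  fixes M :: "'a surface" and N :: nat
  defines "S \<equiv> saddle_holonomies M"
  assumes sep: "\<And>x y. x \<in> S \<Longrightarrow> y \<in> S \<Longrightarrow> wedge x y = 0 \<or> \<epsilon> \<le> \<bar>wedge x y\<bar>"
    and line: "\<And>x. x \<in> S \<Longrightarrow> finite {y\<in>S. wedge x y = 0} \<and> card {y\<in>S. wedge x y = 0} \<le> N"
    and nz: "0 \<notin> S" and pos: "\<epsilon> > 0"
  shows "\<exists>C c :: real. \<forall>D > 0.
    Limsup at_top (\<lambda>R :: real. ecardinality (close_pairs M D R) / ereal (R\<^sup>2)) \<le> ereal (C * (D + c))"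
proof (intro exI allI impI)
  let ?C = "(real N * (4 / \<epsilon> + 4)) * (real N * (4 / \<epsilon>))"
  fix D :: real assume D: "D > 0"
  show "Limsup at_top (\<lambda>R :: real. ecardinality (close_pairs M D R) / ereal (R\<^sup>2)) \<le> ereal (?C * (D + \<epsilon>))"
  proof (rule Limsup_bounded)
    show "\<forall>\<^sub>F R in at_top. ecardinality (close_pairs M D R) / ereal (R\<^sup>2) \<le> ereal (?C * (D + \<epsilon>))"
      using eventually_ge_at_top[of "1::real"]
    proof eventually_elim
      case (elim R)
      have R1: "1 \<le> R\<^sup>2" using elim by simp
      have card: "ecardinality (close_pairs M D R) \<le>
          ereal ((real N * (4 * (R * R / \<epsilon>) + 4)) * (real N * (4 * (D / \<epsilon>) + 4)))"
        using close_pairs_bound[of M \<epsilon> N D R] sep line nz pos D elim unfolding S_def by simp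
      have "4 * (R * R / \<epsilon>) + 4 \<le> R\<^sup>2 * (4 / \<epsilon> + 4)"
        using R1 by (simp add: power2_eq_square distrib_left mult.commute)
      then have "(real N * (4 * (R * R / \<epsilon>) + 4)) * (real N * (4 * (D / \<epsilon>) + 4)) \<le>
          (real N * (R\<^sup>2 * (4 / \<epsilon> + 4))) * (real N * (4 * (D / \<epsilon>) + 4))"
        by (intro mult_left_mono mult_right_mono) (use D pos in auto)
      also have "\<dots> = ?C * (D + \<epsilon>) * R\<^sup>2" using pos by (simp add: field_simps)
      finally have "ecardinality (close_pairs M D R) \<le> ereal (?C * (D + \<epsilon>) * R\<^sup>2)"
        using card order_trans ereal_less_eq(3) by blast
      then have "ecardinality (close_pairs M D R) \<le> ereal (R\<^sup>2) * ereal (?C * (D + \<epsilon>))" by (simp add: mult.commute)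
      then show ?case using elim by (subst ereal_divide_le_pos) auto
    qed
  qed
qed

section \<open>Real 2 by 2 matrices\<close>

definition mat2 :: "real \<Rightarrow> real \<Rightarrow> real \<Rightarrow> real \<Rightarrow> real^2^2" where
  "mat2 a b c d = vector [vector [a, b], vector [c, d]]"

lemma mat2_nth [simp]:
  "mat2 a b c d $ 1 $ 1 = a" "mat2 a b c d $ 1 $ 2 = b"
  "mat2 a b c d $ 2 $ 1 = c" "mat2 a b c d $ 2 $ 2 = d"
  by (simp_all add: mat2_def)

lemma matrix_eq_2: "A = B \<longleftrightarrow> A$1$1 = B$1$1 \<and> A$1$2 = B$1$2 \<and> A$2$1 = B$2$1 \<and> A$2$2 = B$2$2"
  for A B :: "real^2^2"
  by (auto simp: vec_eq_iff forall_2)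

lemma vec_eq_2: "x = y \<longleftrightarrow> x$1 = y$1 \<and> x$2 = y$2" for x y :: "real^2"
  by (auto simp: vec_eq_iff forall_2)

lemma matrix_mult_2: "(A ** B) $ i $ j = A$i$1 * B$1$j + A$i$2 * B$2$j" for A B :: "real^2^2"
  by (simp add: matrix_matrix_mult_def sum_2)

lemma matrix_vector_mult_2: "(A *v x) $ i = A$i$1 * x$1 + A$i$2 * x$2" for A :: "real^2^2"
  by (simp add: matrix_vector_mult_def sum_2)

lemma mat_1_nth: "(mat 1 :: real^2^2) $ i $ j = (if i = j then 1 else 0)"
  by (simp add: mat_def)

lemmas mat2_simps = matrix_mult_2 matrix_vector_mult_2 mat_1_nth det_2 wedge_eq

lemma norm_vec_2: "(norm x)\<^sup>2 = (x$1)\<^sup>2 + (x$2)\<^sup>2" for x :: "real^2"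
  by (simp add: norm_eq_sqrt_inner inner_vec_def sum_2 power2_eq_square)

lemma norm_mat_2: "(norm A)\<^sup>2 = (A$1$1)\<^sup>2 + (A$1$2)\<^sup>2 + (A$2$1)\<^sup>2 + (A$2$2)\<^sup>2" for A :: "real^2^2"
  by (simp add: norm_eq_sqrt_inner inner_vec_def sum_2 power2_eq_square)

lemma Cauchy_Schwarz_2: "(a * c + b * d)\<^sup>2 \<le> (a\<^sup>2 + b\<^sup>2) * (c\<^sup>2 + d\<^sup>2)" for a b c d :: real
proof -
  have "(a\<^sup>2 + b\<^sup>2) * (c\<^sup>2 + d\<^sup>2) - (a * c + b * d)\<^sup>2 = (a * d - b * c)\<^sup>2"
    by (simp add: power2_eq_square algebra_simps)
  then show ?thesis using zero_le_power2[of "a * d - b * c"] by linarith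
qed

lemma norm_matrix_mult_le: "norm (A ** B) \<le> norm A * norm B" for A B :: "real^2^2"
proof (rule power2_le_imp_le)
  have "(norm (A ** B))\<^sup>2 \<le> ((A$1$1)\<^sup>2 + (A$1$2)\<^sup>2) * ((B$1$1)\<^sup>2 + (B$2$1)\<^sup>2) +
     ((A$1$1)\<^sup>2 + (A$1$2)\<^sup>2) * ((B$1$2)\<^sup>2 + (B$2$2)\<^sup>2) +
     ((A$2$1)\<^sup>2 + (A$2$2)\<^sup>2) * ((B$1$1)\<^sup>2 + (B$2$1)\<^sup>2) +
     ((A$2$1)\<^sup>2 + (A$2$2)\<^sup>2) * ((B$1$2)\<^sup>2 + (B$2$2)\<^sup>2)"
    unfolding norm_mat_2 matrix_mult_2 by (intro add_mono Cauchy_Schwarz_2)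
  also have "\<dots> = (norm A * norm B)\<^sup>2"
    unfolding power_mult_distrib norm_mat_2 by (simp add: algebra_simps)
  finally show "(norm (A ** B))\<^sup>2 \<le> (norm A * norm B)\<^sup>2" .
qed simp

lemma norm_matrix_vector_mult_le: "norm (A *v x) \<le> norm A * norm x" for A :: "real^2^2"
proof (rule power2_le_imp_le)
  have "(norm (A *v x))\<^sup>2 \<le> ((A$1$1)\<^sup>2 + (A$1$2)\<^sup>2) * ((x$1)\<^sup>2 + (x$2)\<^sup>2) +
     ((A$2$1)\<^sup>2 + (A$2$2)\<^sup>2) * ((x$1)\<^sup>2 + (x$2)\<^sup>2)"
    unfolding norm_vec_2 matrix_vector_mult_2 by (intro add_mono Cauchy_Schwarz_2)
  also have "\<dots> = (norm A * norm x)\<^sup>2"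
    unfolding power_mult_distrib norm_mat_2 norm_vec_2[of x] by (simp add: algebra_simps)
  finally show "(norm (A *v x))\<^sup>2 \<le> (norm A * norm x)\<^sup>2" .
qed simp

lemma abs_wedge_le: "\<bar>wedge x y\<bar> \<le> norm x * norm y"
proof (rule power2_le_imp_le)
  show "\<bar>wedge x y\<bar>\<^sup>2 \<le> (norm x * norm y)\<^sup>2"
    using Cauchy_Schwarz_2[of "x$1" "y$2" "x$2" "- y$1"]
    by (simp add: wedge_eq power_mult_distrib norm_vec_2 add.commute)
qed simp

lemma wedge_matrix: "wedge (A *v x) (A *v y) = det A * wedge x y"
  by (simp add: mat2_simps algebra_simps)

lemma wedge_simps [simp]: "wedge x x = 0" "wedge (c *\<^sub>R x) y = c * wedge x y" "wedge x (c *\<^sub>R y) = c * wedge x y"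
  "wedge (x + x') y = wedge x y + wedge x' y" "wedge x (y + y') = wedge x y + wedge x y'"
  "wedge 0 y = 0" "wedge x 0 = 0" "wedge (x - x') y = wedge x y - wedge x' y" "wedge x (y - y') = wedge x y - wedge x y'"
  by (simp_all add: wedge_eq algebra_simps)

lemma wedge_eq_0_iff:
  assumes "x \<noteq> 0" shows "wedge x y = 0 \<longleftrightarrow> (\<exists>c. y = c *\<^sub>R x)"
proof
  assume w: "wedge x y = 0"
  have n: "(x$1)\<^sup>2 + (x$2)\<^sup>2 \<noteq> 0" using assms by (simp add: vec_eq_2 sum_power2_eq_zero_iff)
  have "((x$1)\<^sup>2 + (x$2)\<^sup>2) *\<^sub>R y = (x$1 * y$1 + x$2 * y$2) *\<^sub>R x"
  proof -
    have w': "x$1 * y$2 = x$2 * y$1" using w by (simp add: wedge_eq)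
    have "((x$1)\<^sup>2 + (x$2)\<^sup>2) * y$1 = (x$1 * y$1 + x$2 * y$2) * x$1"
      "((x$1)\<^sup>2 + (x$2)\<^sup>2) * y$2 = (x$1 * y$1 + x$2 * y$2) * x$2" using w' by algebra+
    then show ?thesis by (simp add: vec_eq_2)
  qed
  then have "y = ((x$1 * y$1 + x$2 * y$2) / ((x$1)\<^sup>2 + (x$2)\<^sup>2)) *\<^sub>R x"
    using n by (metis (no_types, opaque_lifting) divide_inverse_commute scaleR_one scaleR_scaleR left_inverse)
  then show "\<exists>c. y = c *\<^sub>R x" by blast
qed auto

text \<open>The adjugate: it is the inverse on \<open>SL2_set\<close>, while its rules for products,
  determinants and norms hold for all matrices without side conditions.\<close>

definition inv2 :: "real^2^2 \<Rightarrow> real^2^2" where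
  "inv2 A = mat2 (A$2$2) (- A$1$2) (- A$2$1) (A$1$1)"

lemma SL2_iff: "A \<in> SL2_set \<longleftrightarrow> det A = 1" by (simp add: SL2_set_def)

lemma SL2_one [simp]: "mat 1 \<in> SL2_set" by (simp add: SL2_iff)
lemma SL2_mult [simp]: "A \<in> SL2_set \<Longrightarrow> B \<in> SL2_set \<Longrightarrow> A ** B \<in> SL2_set"
  by (simp add: SL2_iff det_mul)

lemma det_inv2 [simp]: "det (inv2 A) = det A" by (simp add: inv2_def det_2)
lemma SL2_inv2 [simp]: "A \<in> SL2_set \<Longrightarrow> inv2 A \<in> SL2_set" by (simp add: SL2_iff)

lemma inv2_left: "A \<in> SL2_set \<Longrightarrow> inv2 A ** A = mat 1"
  and inv2_right: "A \<in> SL2_set \<Longrightarrow> A ** inv2 A = mat 1"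
  by (auto simp: SL2_iff matrix_eq_2 mat2_simps inv2_def algebra_simps)

lemma inv2_cancel [simp]:
  assumes "A \<in> SL2_set"
  shows "inv2 A ** (A ** B) = B" "A ** (inv2 A ** B) = B" "inv2 A *v (A *v x) = x" "A *v (inv2 A *v x) = x"
    "(B ** A) ** inv2 A = B" "(B ** inv2 A) ** A = B"
  by (simp_all add: matrix_mul_assoc matrix_vector_mul_assoc inv2_left inv2_right assms
        flip: matrix_mul_assoc[of B])

lemma inv2_inv2 [simp]: "inv2 (inv2 A) = A" by (simp add: inv2_def matrix_eq_2)
lemma inv2_mult: "inv2 (A ** B) = inv2 B ** inv2 A" by (simp add: inv2_def matrix_eq_2 mat2_simps algebra_simps)
lemma inv2_one [simp]: "inv2 (mat 1) = mat 1" by (simp add: inv2_def matrix_eq_2 mat_1_nth)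
lemma norm_inv2 [simp]: "norm (inv2 A) = norm A"
proof -
  have "(norm (inv2 A))\<^sup>2 = (norm A)\<^sup>2" by (simp add: norm_mat_2 inv2_def)
  then show ?thesis by (simp add: power2_eq_iff_nonneg)
qed

lemma inv2_unique:
  assumes "A \<in> SL2_set" "A ** B = mat 1" shows "B = inv2 A"
  by (metis assms inv2_cancel(1) matrix_mul_rid)

lemma norm_mat1_2: "norm (mat 1 :: real^2^2) \<le> 2"
proof (rule power2_le_imp_le)
  show "(norm (mat 1 :: real^2^2))\<^sup>2 \<le> 2\<^sup>2" unfolding norm_mat_2 by (simp add: mat_1_nth)
qed simp

text \<open>\<open>shear v s\<close> is the transvection \<open>y \<mapsto> y + s (v \<and> y) v\<close>.\<close>

definition shear :: "real^2 \<Rightarrow> real \<Rightarrow> real^2^2" where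
  "shear v s = mat2 (1 - s * v$1 * v$2) (s * v$1 * v$1) (- s * v$2 * v$2) (1 + s * v$1 * v$2)"

lemma shear_mult_vec: "shear v s *v y = y + (s * wedge v y) *\<^sub>R v"
  by (simp add: shear_def vec_eq_2 mat2_simps algebra_simps)

lemma shear_SL2 [simp]: "shear v s \<in> SL2_set"
  by (simp add: shear_def SL2_iff det_2 algebra_simps)

lemma inv2_shear: "inv2 (shear v s) = shear v (- s)"
  by (simp add: shear_def inv2_def)

lemma shear_scaleR: "shear (c *\<^sub>R v) s = shear v (s * c\<^sup>2)"
  by (simp add: shear_def power2_eq_square algebra_simps)

lemma shear_eq_1_iff: "shear v s = mat 1 \<longleftrightarrow> s = 0 \<or> v = 0"
  by (auto simp: shear_def matrix_eq_2 mat_1_nth vec_eq_2)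

lemma shear_conj:
  assumes "A \<in> SL2_set" shows "A ** shear v s ** inv2 A = shear (A *v v) s"
proof -
  have "(A ** shear v s ** inv2 A) *v y = shear (A *v v) s *v y" for y
  proof -
    have w: "wedge v (inv2 A *v y) = wedge (A *v v) y"
      using wedge_matrix[of A v "inv2 A *v y"] assms by (simp add: SL2_iff)
    have "(A ** shear v s ** inv2 A) *v y = A *v (shear v s *v (inv2 A *v y))"
      by (simp add: matrix_vector_mul_assoc matrix_mul_assoc)
    also have "\<dots> = y + (s * wedge (A *v v) y) *\<^sub>R (A *v v)"
      unfolding shear_mult_vec w using assms
      by (simp add: matrix_vector_right_distrib matrix_vector_mult_scaleR)
    finally show ?thesis by (simp add: shear_mult_vec)
  qed
  then show ?thesis by (simp add: matrix_eq)
qed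

lemma norm_shear_minus_1: "norm (shear v s - mat 1) = \<bar>s\<bar> * (norm v)\<^sup>2"
proof -
  have "(norm (shear v s - mat 1))\<^sup>2 = s\<^sup>2 * ((norm v)\<^sup>2)\<^sup>2"
    unfolding norm_vec_2 norm_mat_2 by (simp add: shear_def mat_1_nth power2_eq_square algebra_simps)
  also have "\<dots> = (\<bar>s\<bar> * (norm v)\<^sup>2)\<^sup>2" by (simp add: power_mult_distrib)
  finally show ?thesis by (simp add: power2_eq_iff_nonneg)
qed

text \<open>A - 1 is singular because it kills x, and then det A = 1 forces its trace to vanish. A
  trace-free matrix killing x is a multiple of the map sending y to (x \<and> y) x.\<close>

lemma fixing_vector_is_shear:
  assumes A: "A \<in> SL2_set" and x: "A *v x = x" "x \<noteq> 0"
  shows "\<exists>s. A = shear x s"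
proof -
  define p q r t where pq: "p = A$1$1 - 1" "q = A$1$2" "r = A$2$1" "t = A$2$2 - 1"
  have e: "p * x$1 + q * x$2 = 0" "r * x$1 + t * x$2 = 0"
    using x by (simp_all add: pq vec_eq_2 mat2_simps algebra_simps)
  have d: "p + t + p * t - q * r = 0" using A by (simp add: SL2_iff det_2 pq algebra_simps)
  have "(p * t - q * r) * x$1 = 0" "(p * t - q * r) * x$2 = 0" using e by algebra+
  then have pt: "t = - p" using d x by (auto simp: vec_eq_2)
  have "\<exists>s. p = - s * x$1 * x$2 \<and> q = s * x$1 * x$1 \<and> r = - s * x$2 * x$2"
  proof (cases "x$1 = 0")
    case False
    have "r * x$1 = p * x$2" using e pt by simp
    have "p * x$1 = - q * x$2" using e by linarith
    show ?thesis
    proof (intro exI[of _ "q / (x$1 * x$1)"] conjI)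
      show "p = - (q / (x$1 * x$1)) * x$1 * x$2" using False \<open>p * x$1 = - q * x$2\<close> by (simp add: field_simps)
      have "r * (x$1 * x$1) = - q * (x$2 * x$2)"
        using \<open>r * x$1 = p * x$2\<close> \<open>p * x$1 = - q * x$2\<close> by algebra
      then show "r = - (q / (x$1 * x$1)) * x$2 * x$2" using False by (simp add: field_simps)
    qed (use False in simp)
  next
    case True
    then have "x$2 \<noteq> 0" using x by (simp add: vec_eq_2)
    then have "q = 0" "p = 0" using e pt True by auto
    then show ?thesis using True \<open>x$2 \<noteq> 0\<close> by (intro exI[of _ "- r / (x$2 * x$2)"]) simp
  qed
  then obtain s where "p = - s * x$1 * x$2" "q = s * x$1 * x$1" "r = - s * x$2 * x$2" by blast
  then have "A = shear x s" using pt by (simp add: matrix_eq_2 shear_def pq algebra_simps)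
  then show ?thesis ..
qed

text \<open>A and B commute when their triples (entry 12, entry 21, difference of the diagonal
  entries) have vanishing cross product. The triple of A is nonzero since A is not scalar, so that
  of B is a multiple of it, and the factor is \<beta>.\<close>

lemma commuting_2:
  fixes A B :: "real^2^2"
  assumes "A ** B = B ** A" and ns: "\<nexists>c. A = c *\<^sub>R mat 1"
  shows "\<exists>\<alpha> \<beta>. B = \<alpha> *\<^sub>R mat 1 + \<beta> *\<^sub>R A"
proof -
  have e: "A$1$2 * B$2$1 = B$1$2 * A$2$1"
    "A$1$1 * B$1$2 + A$1$2 * B$2$2 = B$1$1 * A$1$2 + B$1$2 * A$2$2"
    "A$2$1 * B$1$1 + A$2$2 * B$2$1 = B$2$1 * A$1$1 + B$2$2 * A$2$1"
    using assms(1) unfolding matrix_eq_2 matrix_mult_2 by (simp_all only: mult.commute) linarith+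
  have "A$1$2 \<noteq> 0 \<or> A$2$1 \<noteq> 0 \<or> A$1$1 \<noteq> A$2$2"
  proof (rule ccontr)
    assume "\<not> ?thesis"
    then have "A = (A$1$1) *\<^sub>R mat 1" by (simp add: matrix_eq_2 mat_1_nth)
    then show False using ns by blast
  qed
  then obtain \<beta> where b: "B$1$2 = \<beta> * A$1$2" "B$2$1 = \<beta> * A$2$1" "B$1$1 - B$2$2 = \<beta> * (A$1$1 - A$2$2)"
  proof (elim disjE)
    assume n: "A$1$2 \<noteq> 0"
    have "(B$1$1 - B$2$2) * A$1$2 = B$1$2 * (A$1$1 - A$2$2)" using e(2) by (simp add: algebra_simps)
    then show ?thesis using n e by (intro that[of "B$1$2 / A$1$2"]) (auto simp: field_simps)
  next
    assume n: "A$2$1 \<noteq> 0"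
    have "(B$1$1 - B$2$2) * A$2$1 = B$2$1 * (A$1$1 - A$2$2)" using e(3) by (simp add: algebra_simps)
    then show ?thesis using n e by (intro that[of "B$2$1 / A$2$1"]) (auto simp: field_simps)
  next
    assume "A$1$1 \<noteq> A$2$2"
    then have n: "A$1$1 - A$2$2 \<noteq> 0" by simp
    have "(B$1$1 - B$2$2) * A$1$2 = B$1$2 * (A$1$1 - A$2$2)" 
      "(B$1$1 - B$2$2) * A$2$1 = B$2$1 * (A$1$1 - A$2$2)" using e(2,3) by (simp_all add: algebra_simps)
    then show ?thesis using n by (intro that[of "(B$1$1 - B$2$2) / (A$1$1 - A$2$2)"]) (auto simp: nonzero_eq_divide_eq)
  qed
  have "B = (B$1$1 - \<beta> * A$1$1) *\<^sub>R mat 1 + \<beta> *\<^sub>R A"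
    using b by (simp add: matrix_eq_2 mat_1_nth algebra_simps)
  then show ?thesis by blast
qed

section \<open>Discrete groups acting on the plane\<close>

definition conjm :: "real^2^2 \<Rightarrow> real^2^2 \<Rightarrow> real^2^2" where
  "conjm a g = a ** g ** inv2 a"

lemma conjm_SL2: "a \<in> SL2_set \<Longrightarrow> g \<in> SL2_set \<Longrightarrow> conjm a g \<in> SL2_set"
  by (simp add: conjm_def)

lemma conjm_mult: "a \<in> SL2_set \<Longrightarrow> conjm a (g ** h) = conjm a g ** conjm a h"
  by (simp add: conjm_def matrix_mul_assoc)

lemma conjm_inv2: "conjm a (inv2 g) = inv2 (conjm a g)"
  by (simp add: conjm_def inv2_mult matrix_mul_assoc)

lemma conjm_conjm: "conjm a (conjm b g) = conjm (a ** b) g"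
  by (simp add: conjm_def inv2_mult matrix_mul_assoc)

lemma conjm_vec: "a \<in> SL2_set \<Longrightarrow> conjm a g *v (a *v x) = a *v (g *v x)"
  by (simp add: conjm_def flip: matrix_vector_mul_assoc)

lemma conjm_inv_cancel: "a \<in> SL2_set \<Longrightarrow> conjm (inv2 a) (conjm a g) = g"
  by (simp add: conjm_conjm inv2_left) (simp add: conjm_def)

section \<open>Estimates for conjugates and commutators near the identity\<close>

lemma matrix_mult_diff_left: "(A - B) ** C = A ** C - B ** C" for A B C :: "real^2^2"
  by (simp add: matrix_eq_2 mat2_simps algebra_simps)

lemma matrix_mult_diff_right: "C ** (A - B) = C ** A - C ** B" for A B C :: "real^2^2"
  by (simp add: matrix_eq_2 mat2_simps algebra_simps)

lemma norm_conjm_minus_1: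
  assumes "a \<in> SL2_set" shows "norm (conjm a g - mat 1) \<le> (norm a)\<^sup>2 * norm (g - mat 1)"
proof -
  have "conjm a g - mat 1 = a ** (g - mat 1) ** inv2 a"
    using assms by (simp add: conjm_def matrix_mult_diff_left matrix_mult_diff_right inv2_right)
  also have "norm \<dots> \<le> norm (a ** (g - mat 1)) * norm (inv2 a)" by (rule norm_matrix_mult_le)
  also have "\<dots> \<le> (norm a * norm (g - mat 1)) * norm a"
    by (simp add: mult_right_mono norm_matrix_mult_le)
  finally show ?thesis by (simp add: power2_eq_square mult_ac)
qed

lemma norm_le_3: "norm (u - mat 1) \<le> 1 \<Longrightarrow> norm u \<le> 3" for u :: "real^2^2"
  using norm_triangle_ineq[of "u - mat 1" "mat 1 :: real^2^2"] norm_mat1_2 by simp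

text \<open>When two translates of an \<epsilon>-neighbourhood of 1 overlap, the element relating
  them is conjugate to such a quotient. The 6 is 3 * 2: the norm of u is at most 3, and u, u' are
  within 2\<epsilon> of each other.\<close>

lemma norm_inv2_mult_minus_1:
  assumes "u \<in> SL2_set" "norm (u - mat 1) \<le> \<epsilon>" "norm (u' - mat 1) \<le> \<epsilon>" "\<epsilon> \<le> 1"
  shows "norm (inv2 u ** u' - mat 1) \<le> 6 * \<epsilon>"
proof -
  have "inv2 u ** u' - mat 1 = inv2 u ** (u' - u)"
    using assms by (simp add: matrix_mult_diff_right inv2_left)
  also have "norm \<dots> \<le> norm u * norm (u' - u)" using norm_matrix_mult_le[of "inv2 u"] by simp
  also have "\<dots> \<le> 3 * (2 * \<epsilon>)"
  proof (rule mult_mono)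
    show "norm u \<le> 3" using assms norm_le_3 by simp
    show "norm (u' - u) \<le> 2 * \<epsilon>"
      using assms norm_triangle_ineq4[of "u' - mat 1" "u - mat 1"] by simp
  qed auto
  finally show ?thesis by simp
qed

text \<open>Zassenhaus' estimate: with X = A - 1 and Y = B - 1 one has AB - BA = XY - YX, which is
  quadratic in the deviations. The 18 is 2 * 3 * 3, two products and two inverses of norm at most
  3.\<close>

lemma norm_commutator_minus_1:
  assumes "A \<in> SL2_set" "B \<in> SL2_set" "norm (A - mat 1) \<le> 1" "norm (B - mat 1) \<le> 1"
  shows "norm (A ** B ** inv2 A ** inv2 B - mat 1) \<le> 18 * norm (A - mat 1) * norm (B - mat 1)"
proof -
  let ?X = "A - mat 1" and ?Y = "B - mat 1"
  have "A ** B ** inv2 A ** inv2 B - mat 1 = (A ** B - B ** A) ** (inv2 A ** inv2 B)"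
    using assms by (simp add: matrix_mult_diff_left matrix_mul_assoc inv2_right)
  also have "A ** B - B ** A = ?X ** ?Y - ?Y ** ?X"
    by (simp add: matrix_mult_diff_left matrix_mult_diff_right)
  finally have "norm (A ** B ** inv2 A ** inv2 B - mat 1) \<le> norm (?X ** ?Y - ?Y ** ?X) * norm (inv2 A ** inv2 B)"
    using norm_matrix_mult_le by metis
  also have "\<dots> \<le> (2 * norm ?X * norm ?Y) * (3 * 3)"
  proof (rule mult_mono)
    show "norm (?X ** ?Y - ?Y ** ?X) \<le> 2 * norm ?X * norm ?Y"
      using norm_triangle_ineq4[of "?X ** ?Y" "?Y ** ?X"] norm_matrix_mult_le[of ?X ?Y]
        norm_matrix_mult_le[of ?Y ?X] mult.commute[of "norm ?X" "norm ?Y"] by linarith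
    have "norm (inv2 A ** inv2 B) \<le> norm A * norm B" using norm_matrix_mult_le[of "inv2 A" "inv2 B"] by simp
    also have "\<dots> \<le> 3 * 3" using assms norm_le_3 by (intro mult_mono) auto
    finally show "norm (inv2 A ** inv2 B) \<le> 3 * 3" .
  qed auto
  finally show ?thesis by simp
qed

text \<open>The rotation taking v to the positive first axis, followed by diag(c/|v|, |v|/c).
  Lowering c contracts v, and halving c is a left multiplication by a fixed matrix
  (\<open>flow_half\<close>).\<close>

definition flow :: "real^2 \<Rightarrow> real \<Rightarrow> real^2^2" where
  "flow v c = mat2 (c * v$1 / (norm v)\<^sup>2) (c * v$2 / (norm v)\<^sup>2) (- v$2 / c) (v$1 / c)"

lemma flow_SL2:
  assumes "v \<noteq> 0" "c \<noteq> 0" shows "flow v c \<in> SL2_set"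
proof -
  have "c * v$1 / (norm v)\<^sup>2 * (v$1 / c) - c * v$2 / (norm v)\<^sup>2 * (- v$2 / c) = ((v$1)\<^sup>2 + (v$2)\<^sup>2) / (norm v)\<^sup>2"
    using assms by (simp add: power2_eq_square add_divide_distrib)
  also have "\<dots> = 1" using assms by (simp flip: norm_vec_2)
  finally show ?thesis by (simp add: SL2_iff det_2 flow_def)
qed

lemma flow_vec:
  assumes "v \<noteq> 0" shows "flow v c *v v = vector [c, 0]"
proof -
  have "c * v$1 / (norm v)\<^sup>2 * v$1 + c * v$2 / (norm v)\<^sup>2 * v$2 = c * (((v$1)\<^sup>2 + (v$2)\<^sup>2) / (norm v)\<^sup>2)"
    by (simp add: power2_eq_square add_divide_distrib distrib_left)
  also have "\<dots> = c" using assms by (simp flip: norm_vec_2)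
  finally show ?thesis by (simp add: flow_def vec_eq_2 mat2_simps)
qed

lemma flow_half: "flow v (c / 2) = mat2 (1/2) 0 0 2 ** flow v c"
  by (simp add: flow_def matrix_eq_2 mat2_simps)

lemma norm_vector_axis [simp]: "norm (vector [c, 0] :: real^2) = \<bar>c\<bar>"
  by (rule power2_eq_imp_eq) (simp_all add: norm_vec_2)

lemma trace_conjm:
  assumes "a \<in> SL2_set"
  shows "conjm a g $ 1 $ 1 + conjm a g $ 2 $ 2 = g$1$1 + g$2$2"
proof -
  have "a$1$1 * a$2$2 - a$1$2 * a$2$1 = 1" using assms by (simp add: SL2_iff det_2)
  moreover have "conjm a g $ 1 $ 1 + conjm a g $ 2 $ 2 = (a$1$1 * a$2$2 - a$1$2 * a$2$1) * (g$1$1 + g$2$2)"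
    by (simp add: conjm_def matrix_mult_2 inv2_def algebra_simps)
  ultimately show ?thesis by simp
qed

lemma abs_entry_le_norm: "\<bar>A $ i $ j\<bar> \<le> norm A" for A :: "real^2^2"
  using component_le_norm_cart[of "A $ i" j] Finite_Cartesian_Product.norm_nth_le[of A i] by linarith

text \<open>With U the \<epsilon>-neighbourhood of 1 in SL2, each set U g i injects into the
  quotient by \<Gamma> (case i = j), and the images for different indices are disjoint.\<close>

definition packed :: "(real^2^2) set \<Rightarrow> real \<Rightarrow> 'i set \<Rightarrow> ('i \<Rightarrow> real^2^2) \<Rightarrow> bool" where
  "packed \<Gamma> \<epsilon> I g \<longleftrightarrow> g ` I \<subseteq> SL2_set \<and>
    (\<forall>i\<in>I. \<forall>j\<in>I. \<forall>u\<in>SL2_set. \<forall>u'\<in>SL2_set. \<forall>\<gamma>\<in>\<Gamma>.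
       norm (u - mat 1) < \<epsilon> \<longrightarrow> norm (u' - mat 1) < \<epsilon> \<longrightarrow> u ** g i ** \<gamma> = u' ** g j \<longrightarrow> i = j \<and> \<gamma> = mat 1)"

lemma packedD:
  assumes "packed \<Gamma> \<epsilon> I g" "i \<in> I" "j \<in> I" "u \<in> SL2_set" "u' \<in> SL2_set" "\<gamma> \<in> \<Gamma>"
    "norm (u - mat 1) < \<epsilon>" "norm (u' - mat 1) < \<epsilon>" "u ** g i ** \<gamma> = u' ** g j"
  shows "i = j" "\<gamma> = mat 1"
  using assms unfolding packed_def by blast+

lemma packedI:
  assumes "\<And>i. i \<in> I \<Longrightarrow> g i \<in> SL2_set"
    "\<And>i j u u' \<gamma>. \<lbrakk>i \<in> I; j \<in> I; u \<in> SL2_set; u' \<in> SL2_set; \<gamma> \<in> \<Gamma>;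
      norm (u - mat 1) < \<epsilon>; norm (u' - mat 1) < \<epsilon>; u ** g i ** \<gamma> = u' ** g j\<rbrakk> \<Longrightarrow> i = j \<and> \<gamma> = mat 1"
  shows "packed \<Gamma> \<epsilon> I g"
  using assms unfolding packed_def by blast

text \<open>Finite covolume appears only as \<open>packing\<close> and discreteness only as
  \<open>isolated\<close>, so the group arguments stay free of measures and of surfaces.\<close>

locale lattice_action =
  fixes \<Gamma> :: "(real^2^2) set" and S :: "(real^2) set"
  assumes sub: "\<Gamma> \<subseteq> SL2_set"
    and one: "mat 1 \<in> \<Gamma>"
    and mult: "A \<in> \<Gamma> \<Longrightarrow> B \<in> \<Gamma> \<Longrightarrow> A ** B \<in> \<Gamma>"
    and inv: "A \<in> \<Gamma> \<Longrightarrow> inv2 A \<in> \<Gamma>"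
    and isolated: "\<exists>\<epsilon>>0. \<forall>\<gamma>\<in>\<Gamma>. norm (\<gamma> - mat 1) < \<epsilon> \<longrightarrow> \<gamma> = mat 1"
    and packing: "\<And>\<epsilon>. \<epsilon> > 0 \<Longrightarrow> \<exists>m::nat. \<forall>G. finite G \<longrightarrow> packed \<Gamma> \<epsilon> G id \<longrightarrow> card G \<le> m"
    and act: "A \<in> \<Gamma> \<Longrightarrow> x \<in> S \<Longrightarrow> A *v x \<in> S"
    and short: "\<exists>r>0. \<forall>x\<in>S. r \<le> norm x"
begin

lemma SL: "A \<in> \<Gamma> \<Longrightarrow> A \<in> SL2_set" using sub by blast

lemma nonzero: "x \<in> S \<Longrightarrow> x \<noteq> 0" using short by force

text \<open>A packed family is injective, since equal matrices would overlap at u = u' = 1; so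
  families indexed by times or by vectors obey the same bound as sets.\<close>

lemma packing_indexed:
  assumes "\<epsilon> > 0"
  shows "\<exists>m::nat. \<forall>I (g :: 'i \<Rightarrow> real^2^2). finite I \<longrightarrow> packed \<Gamma> \<epsilon> I g \<longrightarrow> card I \<le> m"
proof -
  obtain m where m: "\<And>G. finite G \<Longrightarrow> packed \<Gamma> \<epsilon> G id \<Longrightarrow> card G \<le> m"
    using packing[OF assms] by metis
  show ?thesis
  proof (intro exI allI impI)
    fix I and g :: "'i \<Rightarrow> real^2^2"
    assume I: "finite I" and P: "packed \<Gamma> \<epsilon> I g"
    have "inj_on g I"
    proof (rule inj_onI)
      fix i j assume ij: "i \<in> I" "j \<in> I" "g i = g j"
      have "mat 1 ** g i ** mat 1 = mat 1 ** g j" using ij by simp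
      then show "i = j" using packedD(1)[OF P ij(1,2) SL2_one SL2_one one] assms by simp
    qed
    then have "card I = card (g ` I)" by (simp add: card_image)
    also have "packed \<Gamma> \<epsilon> (g ` I) id"
      using P unfolding packed_def by force
    then have "card (g ` I) \<le> m" using m I by simp
    finally show "card I \<le> m" .
  qed
qed

text \<open>Otherwise the images of x under the powers of A would be elements of S tending to
  0.\<close>

lemma contracting:
  assumes "A \<in> \<Gamma>" "x \<in> S" "A *v x = c *\<^sub>R x" shows "\<bar>c\<bar> \<ge> 1"
proof (rule ccontr)
  assume c: "\<not> ?thesis"
  obtain r where r: "r > 0" "\<And>x. x \<in> S \<Longrightarrow> r \<le> norm x" using short by blast
  have S: "c ^ n *\<^sub>R x \<in> S" for n
  proof (induction n)
    case (Suc n)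
    have "A *v (c ^ n *\<^sub>R x) = c ^ Suc n *\<^sub>R x"
      using assms(3) by (simp add: matrix_vector_mult_scaleR mult.commute)
    then show ?case using act[OF assms(1) Suc] by simp
  qed (use assms in simp)
  have "(\<lambda>n. \<bar>c\<bar> ^ n * norm x) \<longlonglongrightarrow> 0 * norm x"
    by (intro tendsto_mult LIMSEQ_realpow_zero tendsto_const) (use c in auto)
  then have "(\<lambda>n. \<bar>c\<bar> ^ n * norm x) \<longlonglongrightarrow> 0" by simp
  moreover have "r \<le> \<bar>c\<bar> ^ n * norm x" for n using r(2)[OF S[of n]] by (simp add: power_abs)
  ultimately have "r \<le> 0" by (intro LIMSEQ_le_const) auto
  then show False using r by simp
qed

lemma eigenvalue_abs:
  assumes "A \<in> \<Gamma>" "x \<in> S" "A *v x = c *\<^sub>R x" shows "\<bar>c\<bar> = 1"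
proof -
  have c: "\<bar>c\<bar> \<ge> 1" by (rule contracting[OF assms])
  then have "c \<noteq> 0" by auto
  have "x = inv2 A *v (c *\<^sub>R x)" using assms(3)[symmetric] SL[OF assms(1)] by simp
  then have "inv2 A *v x = (1 / c) *\<^sub>R x"
    using \<open>c \<noteq> 0\<close> by (metis matrix_vector_mult_scaleR scaleR_scaleR nonzero_divide_eq_eq scaleR_one)
  then have "\<bar>1 / c\<bar> \<ge> 1" by (rule contracting[OF inv[OF assms(1)] assms(2)])
  then show ?thesis using c by (simp add: field_simps split: if_splits)
qed

text \<open>Let k be the infimum of |a g a^-1 - 1| over nontrivial g. Choosing g within a factor 2
  of k spares the question whether k is attained. For h as in the conclusion the commutator of g and
  h has displacement below k, so it is trivial.\<close>

lemma almost_minimal: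
  assumes a: "a \<in> SL2_set" and g0: "g0 \<in> \<Gamma>" "g0 \<noteq> mat 1" "norm (conjm a g0 - mat 1) < \<eta>" and "\<eta> \<le> 1"
  shows "\<exists>g\<in>\<Gamma>. g \<noteq> mat 1 \<and> norm (conjm a g - mat 1) < \<eta> \<and>
    (\<forall>h\<in>\<Gamma>. norm (conjm a h - mat 1) \<le> 1/36 \<longrightarrow> g ** h = h ** g)"
proof -
  obtain \<epsilon> where \<epsilon>: "\<epsilon> > 0" "\<And>\<gamma>. \<gamma> \<in> \<Gamma> \<Longrightarrow> norm (\<gamma> - mat 1) < \<epsilon> \<Longrightarrow> \<gamma> = mat 1" using isolated by blast
  define K where "K = (\<lambda>g. norm (conjm a g - mat 1)) ` (\<Gamma> - {mat 1})"
  have a0: "norm a > 0" using a by (auto simp: SL2_iff det_2)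
  \<comment> \<open>Undoing the conjugation costs a factor |a|^2, so discreteness bounds all
    displacements away from 0.\<close>
  have lower: "\<epsilon> / (norm a)\<^sup>2 \<le> k" if "k \<in> K" for k
  proof -
    obtain g where g: "g \<in> \<Gamma>" "g \<noteq> mat 1" "k = norm (conjm a g - mat 1)" using \<open>k \<in> K\<close> by (auto simp: K_def)
    have "\<epsilon> \<le> norm (g - mat 1)" using \<epsilon>(2) g by force
    also have "\<dots> \<le> (norm a)\<^sup>2 * k"
      using norm_conjm_minus_1[of "inv2 a" "conjm a g"] a g by (simp add: conjm_inv_cancel)
    finally show ?thesis using a0 by (simp add: field_simps)
  qed
  have K0: "norm (conjm a g0 - mat 1) \<in> K" using g0 by (auto simp: K_def)
  define k where "k = Inf K"
  have bdd: "bdd_below K" using lower by (rule bdd_belowI)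
  have "\<epsilon> / (norm a)\<^sup>2 \<le> k" unfolding k_def using K0 lower by (intro cInf_greatest) auto
  then have k0: "k > 0" using \<epsilon>(1) a0 by (meson divide_pos_pos less_le_trans zero_less_power)
  have "k < \<eta>" unfolding k_def using cInf_lower[OF K0 bdd] g0 by linarith
  then have "Inf K < min (2 * k) \<eta>" using k0 by (simp flip: k_def)
  then obtain k' where k': "k' \<in> K" "k' < min (2 * k) \<eta>" using K0 cInf_lessD by (metis empty_iff)
  then obtain g where g: "g \<in> \<Gamma>" "g \<noteq> mat 1" "norm (conjm a g - mat 1) < 2 * k" "norm (conjm a g - mat 1) < \<eta>"
    by (auto simp: K_def)
  have "g ** h = h ** g" if h: "h \<in> \<Gamma>" "norm (conjm a h - mat 1) \<le> 1/36" for h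
  proof -
    let ?c = "g ** h ** inv2 g ** inv2 h"
    have c: "?c \<in> \<Gamma>" using g h by (intro mult inv)
    have "conjm a ?c = conjm a g ** conjm a h ** inv2 (conjm a g) ** inv2 (conjm a h)"
      using a by (simp add: conjm_mult conjm_inv2)
    then have "norm (conjm a ?c - mat 1) \<le> 18 * norm (conjm a g - mat 1) * norm (conjm a h - mat 1)"
      using norm_commutator_minus_1[of "conjm a g" "conjm a h"] a g h SL \<open>\<eta> \<le> 1\<close> by (simp add: conjm_SL2)
    \<comment> \<open>The 1/36 is chosen so that 18/36 = 1/2 cancels the factor 2 lost in the choice
      of g.\<close>
    also have "\<dots> \<le> 18 * norm (conjm a g - mat 1) * (1/36)" using h by (intro mult_left_mono) auto
    also have "\<dots> < k" using g by simp
    finally have "norm (conjm a ?c - mat 1) < Inf K" by (simp add: k_def)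
    then have "norm (conjm a ?c - mat 1) \<notin> K" using cInf_lower[OF _ bdd] by force
    then have "?c = mat 1" using c by (auto simp: K_def)
    moreover have "?c ** h = g ** h ** inv2 g" "g ** h ** inv2 g ** g = g ** h" using SL g h by simp_all
    ultimately show ?thesis by simp
  qed
  then show ?thesis using g by blast
qed

text \<open>An overlap would write \<gamma> x as the image of the contracted x, of length 2^-j,
  under matrices of norm at most 9 |a| in total; but \<gamma> x lies in S and cannot be short. So
  the contracting ray eventually avoids any given neighbourhood in the quotient.\<close>

lemma flow_overlap_bound:
  assumes x: "x \<in> S" and a: "a \<in> SL2_set"
  shows "\<exists>J. \<forall>j\<ge>J. \<forall>u\<in>SL2_set. \<forall>u'\<in>SL2_set. \<forall>\<gamma>\<in>\<Gamma>.
    norm (u - mat 1) \<le> 1 \<longrightarrow> norm (u' - mat 1) \<le> 1 \<longrightarrow> u ** a ** \<gamma> \<noteq> u' ** flow x (1 / 2 ^ j)"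
proof -
  obtain r where r: "r > 0" "\<And>x. x \<in> S \<Longrightarrow> r \<le> norm x" using short by blast
  have "(\<lambda>j. 9 * norm a * (1/2) ^ j) \<longlonglongrightarrow> 9 * norm a * 0"
    by (intro tendsto_mult tendsto_const LIMSEQ_realpow_zero) auto
  then have "\<forall>\<^sub>F j in sequentially. 9 * norm a * (1/2) ^ j < r"
    using order_tendstoD(2) r(1) by fastforce
  then obtain J where J: "\<And>j. j \<ge> J \<Longrightarrow> 9 * norm a * (1/2) ^ j < r" by (auto simp: eventually_sequentially)
  show ?thesis
  proof (intro exI allI impI ballI notI)
    fix j u u' \<gamma> assume H: "J \<le> j" "u \<in> SL2_set" "u' \<in> SL2_set" "\<gamma> \<in> \<Gamma>"
      "norm (u - mat 1) \<le> 1" "norm (u' - mat 1) \<le> 1" and e: "u ** a ** \<gamma> = u' ** flow x (1 / 2 ^ j)"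
    let ?y = "flow x (1 / 2 ^ j) *v x"
    have "u *v (a *v (\<gamma> *v x)) = u' *v ?y" by (simp add: matrix_vector_mul_assoc matrix_mul_assoc e)
    then have "inv2 a *v (inv2 u *v (u *v (a *v (\<gamma> *v x)))) = inv2 a *v (inv2 u *v (u' *v ?y))" by simp
    then have "\<gamma> *v x = inv2 a *v (inv2 u *v (u' *v ?y))" using H a by simp
    also have "norm \<dots> \<le> norm a * norm (inv2 u *v (u' *v ?y))"
      using norm_matrix_vector_mult_le[of "inv2 a"] by simp
    also have "norm (inv2 u *v (u' *v ?y)) \<le> norm u * norm (u' *v ?y)"
      using norm_matrix_vector_mult_le[of "inv2 u"] by simp
    also have "norm (u' *v ?y) \<le> norm u' * norm ?y" by (rule norm_matrix_vector_mult_le)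
    finally have "norm (\<gamma> *v x) \<le> norm a * (norm u * (norm u' * norm ?y))"
      by (simp add: mult_left_mono)
    also have "\<dots> \<le> norm a * (3 * (3 * norm ?y))"
      using H norm_le_3 by (intro mult_left_mono mult_mono) auto
    also have "\<dots> = 9 * norm a * (1/2) ^ j"
      using x nonzero by (simp add: flow_vec power_one_over)
    also have "\<dots> < r" using J H by simp
    finally show False using r(2)[OF act[OF H(4) x]] by simp
  qed
qed

text \<open>Otherwise infinitely many translates of a neighbourhood of the identity would embed
  disjointly in the quotient.\<close>

lemma small_elements:
  assumes x: "x \<in> S" and "\<eta> > 0"
  shows "\<exists>T. \<forall>n\<ge>T. \<exists>\<gamma>\<in>\<Gamma>. \<gamma> \<noteq> mat 1 \<and> norm (conjm (flow x (1 / 2 ^ n)) \<gamma> - mat 1) < \<eta>"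
proof (rule ccontr)
  assume neg: "\<not> ?thesis"
  define a where "a n = flow x (1 / 2 ^ n)" for n :: nat
  \<comment> \<open>The bad times: those at which no nontrivial group element is conjugated close to
    1, so that a neighbourhood embeds in the quotient.\<close>
  define Z where "Z = {n. \<forall>\<gamma>\<in>\<Gamma>. norm (conjm (a n) \<gamma> - mat 1) < \<eta> \<longrightarrow> \<gamma> = mat 1}"
  have Z: "\<exists>n\<ge>T. n \<in> Z" for T using neg unfolding Z_def a_def by blast
  have aSL: "a n \<in> SL2_set" for n using nonzero[OF x] by (simp add: a_def flow_SL2)
  \<comment> \<open>If a translate overlaps itself, the conjugated group element is within
    6\<epsilon> of 1; 6\<epsilon> < \<eta> makes this contradict badness.\<close>
  define \<epsilon> where "\<epsilon> = min 1 (\<eta> / 7)"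
  have \<epsilon>: "\<epsilon> > 0" "\<epsilon> \<le> 1" "6 * \<epsilon> < \<eta>" using \<open>\<eta> > 0\<close> by (auto simp: \<epsilon>_def)
  define R where "R i j \<longleftrightarrow> (\<exists>u\<in>SL2_set. \<exists>u'\<in>SL2_set. \<exists>\<gamma>\<in>\<Gamma>. norm (u - mat 1) < \<epsilon> \<and> norm (u' - mat 1) < \<epsilon> \<and>
    u ** a i ** \<gamma> = u' ** a j)" for i j
  have R_sym: "R j i" if "R i j" for i j
  proof -
    obtain u u' \<gamma> where H: "u \<in> SL2_set" "u' \<in> SL2_set" "\<gamma> \<in> \<Gamma>" "norm (u - mat 1) < \<epsilon>" "norm (u' - mat 1) < \<epsilon>"
      "u ** a i ** \<gamma> = u' ** a j" using \<open>R i j\<close> unfolding R_def by blast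
    have "u' ** a j ** inv2 \<gamma> = u ** a i" using H SL by (simp flip: H(6))
    then show ?thesis unfolding R_def using H inv by blast
  qed
  have R_J: "\<exists>J. \<forall>j\<ge>J. \<not> R i j" for i
    using flow_overlap_bound[OF x aSL[of i]] \<epsilon>(2) unfolding R_def a_def by (meson less_imp_le order_trans)
  \<comment> \<open>Greedy choice: the next bad time is taken beyond \<open>J i\<close> for all
    earlier i, which prevents overlaps, and beyond \<open>Suc i\<close>, which makes it new.\<close>
  have ex: "\<exists>I. finite I \<and> card I = k \<and> I \<subseteq> Z \<and> (\<forall>i\<in>I. \<forall>j\<in>I. i \<noteq> j \<longrightarrow> \<not> R i j)" for k :: nat
  proof (induction k)
    case (Suc k)
    then obtain I where I: "finite I" "card I = k" "I \<subseteq> Z" "\<forall>i\<in>I. \<forall>j\<in>I. i \<noteq> j \<longrightarrow> \<not> R i j" by blast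
    obtain J where J: "\<And>i j. j \<ge> J i \<Longrightarrow> \<not> R i j" using R_J by metis
    obtain n where n: "n \<in> Z" "n \<ge> Max (insert 0 (J ` I \<union> Suc ` I))" using Z by blast
    have "n \<ge> J i" "n \<noteq> i" if "i \<in> I" for i
    proof -
      have "J i \<le> n" "Suc i \<le> n"
        using n(2) I(1) that by (auto intro: order_trans[OF Max_ge])
      then show "n \<ge> J i" "n \<noteq> i" by auto
    qed
    then have "\<not> R i n" "\<not> R n i" "n \<noteq> i" if "i \<in> I" for i using J R_sym that by blast+
    then have "n \<notin> I" "\<forall>i\<in>insert n I. \<forall>j\<in>insert n I. i \<noteq> j \<longrightarrow> \<not> R i j" using I(4) by auto
    then show ?case using I n(1) by (intro exI[of _ "insert n I"]) simp
  qed (rule exI[of _ "{}"], simp)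
  obtain m where m: "\<And>I. finite I \<Longrightarrow> packed \<Gamma> \<epsilon> I a \<Longrightarrow> card I \<le> m"
    using packing_indexed[OF \<epsilon>(1), where ?'i = nat] by metis
  obtain I where I: "finite I" "card I = Suc m" "I \<subseteq> Z" "\<forall>i\<in>I. \<forall>j\<in>I. i \<noteq> j \<longrightarrow> \<not> R i j" using ex by blast
  have "card I \<le> m"
  proof (rule m)
    show "packed \<Gamma> \<epsilon> I a"
    proof (rule packedI)
      fix i j u u' \<gamma>
      assume H: "i \<in> I" "j \<in> I" "u \<in> SL2_set" "u' \<in> SL2_set" "\<gamma> \<in> \<Gamma>"
        "norm (u - mat 1) < \<epsilon>" "norm (u' - mat 1) < \<epsilon>" "u ** a i ** \<gamma> = u' ** a j"
      then have "R i j" unfolding R_def by blast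
      then have ij: "i = j" using I(4) H by blast
      have "u ** (a i ** \<gamma>) = u' ** a i" using H(8) ij by (simp add: matrix_mul_assoc)
      then have "inv2 u ** (u ** (a i ** \<gamma>)) = inv2 u ** (u' ** a i)" by simp
      then have "a i ** \<gamma> = inv2 u ** u' ** a i" using H(3) by (simp add: matrix_mul_assoc inv2_left)
      then have "conjm (a i) \<gamma> = inv2 u ** u'" using aSL by (simp add: conjm_def)
      then have "norm (conjm (a i) \<gamma> - mat 1) \<le> 6 * \<epsilon>"
        using norm_inv2_mult_minus_1[of u \<epsilon> u'] H \<epsilon> by simp
      then have "\<gamma> = mat 1" using I(3) H \<epsilon> unfolding Z_def by force
      then show "i = j \<and> \<gamma> = mat 1" using ij by simp
    qed (rule aSL)
  qed (rule I)
  then show False using I by simp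
qed

text \<open>The only nontrivial scalar in SL2 is -1, whose trace -2 survives conjugation and is far
  from that of a matrix near 1. This supplies the non-scalarity required by
  \<open>commuting_2\<close>.\<close>

lemma scalar_near_1:
  assumes "g \<in> SL2_set" "g \<noteq> mat 1" "a \<in> SL2_set" "norm (conjm a g - mat 1) < 1"
  shows "\<nexists>c. g = c *\<^sub>R mat 1"
proof
  assume "\<exists>c. g = c *\<^sub>R mat 1"
  then obtain c where c: "g = c *\<^sub>R mat 1" by blast
  then have "c * c = 1" using assms(1) by (simp add: SL2_iff det_2 mat_1_nth)
  then have "c = 1 \<or> c = -1" by algebra
  then have "c = -1" using assms(2) c by auto
  moreover have "g$1$1 + g$2$2 = 2 * c" using c by (simp add: mat_1_nth)
  moreover have "\<bar>conjm a g $ 1 $ 1 - 1\<bar> < 1" "\<bar>conjm a g $ 2 $ 2 - 1\<bar> < 1"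
    using abs_entry_le_norm[of "conjm a g - mat 1" 1 1] abs_entry_le_norm[of "conjm a g - mat 1" 2 2] assms(4)
    by (simp_all add: mat_1_nth)
  ultimately show False using trace_conjm[OF assms(3), of g] by linarith
qed

text \<open>The determinant is a quadratic form on the span of 1 and G, so determinant 1 controls
  \<alpha> once \<beta> is known.\<close>

lemma det_pencil:
  fixes G :: "real^2^2"
  assumes "det G = 1" "det (\<alpha> *\<^sub>R mat 1 + \<beta> *\<^sub>R G) = 1"
  shows "\<alpha>\<^sup>2 + \<alpha> * \<beta> * (G$1$1 + G$2$2) + \<beta>\<^sup>2 = 1"
proof -
  have "\<alpha>\<^sup>2 + \<alpha> * \<beta> * (G$1$1 + G$2$2) + \<beta>\<^sup>2 * det G = det (\<alpha> *\<^sub>R mat 1 + \<beta> *\<^sub>R G)"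
    by (simp add: det_2 mat_1_nth power2_eq_square algebra_simps)
  then show ?thesis using assms by simp
qed

text \<open>The almost minimal elements at consecutive times commute, so all of them lie in the
  algebra generated by one matrix \<open>G\<close>, and they can only be small for all times if \<open>G\<close>
  fixes the line of \<open>x\<close>.\<close>

lemma exists_shear:
  assumes x: "x \<in> S" shows "\<exists>s>0. shear x s \<in> \<Gamma>"
proof -
  define a where "a n = flow x (1 / 2 ^ n)" for n :: nat
  have x0: "x \<noteq> 0" by (rule nonzero[OF x])
  have aSL: "a n \<in> SL2_set" for n using x0 by (simp add: a_def flow_SL2)
  \<comment> \<open>One step of the flow multiplies deviations by at most |diag(1/2, 2)|^2 = 17/4,
    and 17/4 * 1/200 \<le> 1/36 is the bound under which almost minimal elements commute.\<close>
  define \<eta> :: real where "\<eta> = 1/200"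
  obtain T where T: "\<And>n. n \<ge> T \<Longrightarrow> \<exists>\<gamma>\<in>\<Gamma>. \<gamma> \<noteq> mat 1 \<and> norm (conjm (a n) \<gamma> - mat 1) < \<eta>"
    using small_elements[OF x, of \<eta>] unfolding a_def \<eta>_def by auto
  have "\<exists>g. T \<le> n \<longrightarrow> g \<in> \<Gamma> \<and> g \<noteq> mat 1 \<and> norm (conjm (a n) g - mat 1) < \<eta> \<and>
    (\<forall>h\<in>\<Gamma>. norm (conjm (a n) h - mat 1) \<le> 1/36 \<longrightarrow> g ** h = h ** g)" for n
  proof (cases "T \<le> n")
    case True
    then obtain g0 where g0: "g0 \<in> \<Gamma>" "g0 \<noteq> mat 1" "norm (conjm (a n) g0 - mat 1) < \<eta>" using T by blast
    have "\<eta> \<le> 1" by (simp add: \<eta>_def)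
    from almost_minimal[OF aSL g0 this] show ?thesis by blast
  qed simp
  then obtain g where "\<And>n. T \<le> n \<longrightarrow> g n \<in> \<Gamma> \<and> g n \<noteq> mat 1 \<and> norm (conjm (a n) (g n) - mat 1) < \<eta> \<and>
    (\<forall>h\<in>\<Gamma>. norm (conjm (a n) h - mat 1) \<le> 1/36 \<longrightarrow> g n ** h = h ** g n)" by metis
  then have g: "\<And>n. n \<ge> T \<Longrightarrow> g n \<in> \<Gamma>" "\<And>n. n \<ge> T \<Longrightarrow> g n \<noteq> mat 1"
      "\<And>n. n \<ge> T \<Longrightarrow> norm (conjm (a n) (g n) - mat 1) < \<eta>"
      "\<And>n h. n \<ge> T \<Longrightarrow> h \<in> \<Gamma> \<Longrightarrow> norm (conjm (a n) h - mat 1) \<le> 1/36 \<Longrightarrow> g n ** h = h ** g n"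
    by blast+
  have comm: "g n ** g (Suc n) = g (Suc n) ** g n" if n: "n \<ge> T" for n
  proof (rule g(4)[OF n])
    let ?d = "mat2 (1/2) 0 0 2"
    have d: "?d \<in> SL2_set" by (simp add: SL2_iff det_2)
    have "a (Suc n) = ?d ** a n" using flow_half[of x "1 / 2 ^ n"] by (simp add: a_def field_simps)
    then have "conjm (a n) (g (Suc n)) = conjm (inv2 ?d) (conjm (a (Suc n)) (g (Suc n)))"
      using d by (simp add: conjm_conjm matrix_mul_assoc inv2_left)
    then have "norm (conjm (a n) (g (Suc n)) - mat 1) \<le> (norm ?d)\<^sup>2 * norm (conjm (a (Suc n)) (g (Suc n)) - mat 1)"
      using norm_conjm_minus_1[of "inv2 ?d" "conjm (a (Suc n)) (g (Suc n))"] d by simp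
    also have "\<dots> \<le> (17/4) * \<eta>"
    proof (rule mult_mono)
      show "(norm ?d)\<^sup>2 \<le> 17/4" unfolding norm_mat_2 by (simp add: power2_eq_square)
      show "norm (conjm (a (Suc n)) (g (Suc n)) - mat 1) \<le> \<eta>" using g(3)[of "Suc n"] n by simp
    qed auto
    finally show "norm (conjm (a n) (g (Suc n)) - mat 1) \<le> 1/36" by (simp add: \<eta>_def)
    show "g (Suc n) \<in> \<Gamma>" using g n by simp
  qed
  have nonscalar: "\<nexists>c. g n = c *\<^sub>R mat 1" if "n \<ge> T" for n
    using scalar_near_1[OF SL[OF g(1)[OF that]] g(2)[OF that] aSL[of n]] g(3)[OF that] by (simp add: \<eta>_def)
  define G where "G = g T"
  have "\<exists>\<alpha> \<beta>. g (T + n) = \<alpha> *\<^sub>R mat 1 + \<beta> *\<^sub>R G" for n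
  proof (induction n)
    case 0 show ?case by (intro exI[of _ 0] exI[of _ 1]) (simp add: G_def)
  next
    case (Suc n)
    then obtain \<alpha> \<beta> where 1: "g (T + n) = \<alpha> *\<^sub>R mat 1 + \<beta> *\<^sub>R G" by blast
    obtain \<alpha>' \<beta>' where 2: "g (T + Suc n) = \<alpha>' *\<^sub>R mat 1 + \<beta>' *\<^sub>R g (T + n)"
      using commuting_2[OF comm[of "T + n"] nonscalar[of "T + n"]] by auto
    have "g (T + Suc n) = (\<alpha>' + \<beta>' * \<alpha>) *\<^sub>R mat 1 + (\<beta>' * \<beta>) *\<^sub>R G"
      unfolding 2 1 by (simp add: algebra_simps)
    then show ?case by blast
  qed
  then obtain \<alpha> \<beta> where ab: "\<And>n. g (T + n) = \<alpha> n *\<^sub>R mat 1 + \<beta> n *\<^sub>R G" by metis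
  define t where "t = G$1$1 + G$2$2"
  define w where "w = wedge x (G *v x)"
  have "w = 0"
  proof (rule ccontr)
    assume w: "w \<noteq> 0"
    \<comment> \<open>The wedge of a vector with its image only sees g - 1, and the contracted x has
      length 2^-(T + n); hence \<beta> n w is tiny although \<open>g (T + n)\<close> itself is close
      to 1 only after conjugation.\<close>
    have \<beta>_bound: "\<bar>\<beta> n\<bar> \<le> (1/2) ^ n * (1 / \<bar>w\<bar>)" for n
    proof -
      let ?a = "a (T + n)" and ?g = "g (T + n)"
      have "\<beta> n * w = wedge x (?g *v x)"
        unfolding ab w_def by (simp add: matrix_vector_mult_add_rdistrib flip: scaleR_matrix_vector_assoc)
      also have "\<dots> = wedge (?a *v x) (?a *v (?g *v x))" using aSL[of "T + n"] by (simp add: wedge_matrix SL2_iff)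
      also have "\<dots> = wedge (?a *v x) (conjm ?a ?g *v (?a *v x))" using aSL by (simp add: conjm_vec)
      also have "\<dots> = wedge (?a *v x) ((conjm ?a ?g - mat 1) *v (?a *v x))"
        by (simp add: matrix_vector_mult_diff_rdistrib)
      also have "\<bar>\<dots>\<bar> \<le> norm (?a *v x) * (norm (conjm ?a ?g - mat 1) * norm (?a *v x))"
        by (meson abs_wedge_le mult_left_mono norm_ge_zero norm_matrix_vector_mult_le order_trans)
      also have "\<dots> \<le> 1 * (1 * (1/2) ^ (T + n))"
      proof (intro mult_mono)
        show "norm (conjm ?a ?g - mat 1) \<le> 1" using g(3)[of "T + n"] by (simp add: \<eta>_def)
      qed (use x0 in \<open>auto simp: a_def flow_vec power_one_over\<close>)
      also have "\<dots> \<le> (1/2) ^ n" by (simp add: power_decreasing)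
      finally have "\<bar>\<beta> n * w\<bar> \<le> (1/2) ^ n" .
      then show ?thesis using w by (simp add: abs_mult field_simps)
    qed
    have "(\<lambda>n. (1/2) ^ n * (1 / \<bar>w\<bar>)) \<longlonglongrightarrow> 0 * (1 / \<bar>w\<bar>)"
      by (intro tendsto_mult LIMSEQ_realpow_zero tendsto_const) auto
    then have \<beta>: "\<beta> \<longlonglongrightarrow> 0"
      using Lim_null_comparison[of \<beta> "\<lambda>n. (1/2) ^ n * (1 / \<bar>w\<bar>)" sequentially] \<beta>_bound by simp
    \<comment> \<open>Completing the square in the determinant condition leaves a sign; it is
      positive because the trace, a conjugation invariant, is nonnegative for a matrix near
      1.\<close>
    have tr: "\<alpha> n + \<beta> n * t / 2 = sqrt (1 - (\<beta> n)\<^sup>2 + (\<beta> n)\<^sup>2 * t\<^sup>2 / 4)" for n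
    proof -
      let ?a = "a (T + n)" and ?g = "g (T + n)"
      have "det ?g = 1" "det G = 1" using g(1)[of "T + n"] g(1)[of T] SL by (auto simp: G_def SL2_iff)
      then have "(\<alpha> n)\<^sup>2 + \<alpha> n * \<beta> n * t + (\<beta> n)\<^sup>2 = 1" using det_pencil ab[of n] unfolding t_def by metis
      then have sq: "(\<alpha> n + \<beta> n * t / 2)\<^sup>2 = 1 - (\<beta> n)\<^sup>2 + (\<beta> n)\<^sup>2 * t\<^sup>2 / 4"
        by (simp add: power2_sum power_mult_distrib power_divide algebra_simps)
      have "\<bar>conjm ?a ?g $ 1 $ 1 - 1\<bar> \<le> 1" "\<bar>conjm ?a ?g $ 2 $ 2 - 1\<bar> \<le> 1"
        using abs_entry_le_norm[of "conjm ?a ?g - mat 1" 1 1] abs_entry_le_norm[of "conjm ?a ?g - mat 1" 2 2]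
          g(3)[of "T + n"] by (simp_all add: mat_1_nth \<eta>_def)
      moreover have "?g$1$1 + ?g$2$2 = 2 * \<alpha> n + \<beta> n * t" unfolding ab t_def by (simp add: mat_1_nth algebra_simps)
      ultimately have "\<alpha> n + \<beta> n * t / 2 \<ge> 0" using trace_conjm[OF aSL[of "T + n"], of ?g] by linarith
      then show ?thesis using sq by (metis real_sqrt_unique)
    qed
    have "(\<lambda>n. sqrt (1 - (\<beta> n)\<^sup>2 + (\<beta> n)\<^sup>2 * t\<^sup>2 / 4) - \<beta> n * t / 2) \<longlonglongrightarrow> sqrt (1 - 0\<^sup>2 + 0\<^sup>2 * t\<^sup>2 / 4) - 0 * t / 2"
      by (intro tendsto_intros \<beta>) auto
    then have \<alpha>: "\<alpha> \<longlonglongrightarrow> 1" by (simp flip: tr)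
    \<comment> \<open>Nontrivial elements of \<Gamma> now tend to 1 without any conjugation, against
      discreteness.\<close>
    have "(\<lambda>n. g (T + n)) \<longlonglongrightarrow> 1 *\<^sub>R mat 1 + 0 *\<^sub>R G"
      unfolding ab by (intro tendsto_intros \<alpha> \<beta>)
    then have lim: "(\<lambda>n. g (T + n)) \<longlonglongrightarrow> mat 1" by simp
    obtain \<epsilon> where \<epsilon>: "\<epsilon> > 0" "\<And>\<gamma>. \<gamma> \<in> \<Gamma> \<Longrightarrow> norm (\<gamma> - mat 1) < \<epsilon> \<Longrightarrow> \<gamma> = mat 1" using isolated by blast
    then obtain n where "norm (g (T + n) - mat 1) < \<epsilon>" using LIMSEQ_D[OF lim \<epsilon>(1)] by blast
    then show False using \<epsilon>(2) g(1,2)[of "T + n"] by simp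
  qed
  then obtain c where c: "G *v x = c *\<^sub>R x" using wedge_eq_0_iff[OF x0] unfolding w_def by blast
  have G: "G \<in> \<Gamma>" "G \<noteq> mat 1" using g by (auto simp: G_def)
  have "\<bar>c\<bar> = 1" using eigenvalue_abs[OF G(1) x c] .
  \<comment> \<open>The conjugate of G at time T is close to 1 and has the contracted x as
    eigenvector, so the eigenvalue c is close to 1.\<close>
  moreover have "c > 0"
  proof -
    let ?y = "a T *v x"
    have y: "norm ?y > 0" using x0 by (simp add: a_def flow_vec)
    have "conjm (a T) G *v ?y = c *\<^sub>R ?y" using aSL c by (simp add: conjm_vec matrix_vector_mult_scaleR)
    then have "(c - 1) *\<^sub>R ?y = (conjm (a T) G - mat 1) *v ?y"
      by (simp add: matrix_vector_mult_diff_rdistrib scaleR_left_diff_distrib)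
    then have "\<bar>c - 1\<bar> * norm ?y \<le> norm (conjm (a T) G - mat 1) * norm ?y"
      using norm_matrix_vector_mult_le by (metis norm_scaleR)
    then have "\<bar>c - 1\<bar> \<le> norm (conjm (a T) G - mat 1)" using y by simp
    then show ?thesis using g(3)[of T] by (simp add: G_def \<eta>_def)
  qed
  ultimately have "G *v x = x" using c by simp
  then obtain s where s: "G = shear x s" using fixing_vector_is_shear[OF SL[OF G(1)] _ x0] by blast
  have "s \<noteq> 0" using G s by (auto simp: shear_eq_1_iff)
  moreover have "shear x (- s) \<in> \<Gamma>" using inv[OF G(1)] by (simp add: s inv2_shear)
  ultimately show ?thesis using G(1) s by (metis neg_0_less_iff_less linorder_neqE_linordered_idom)
qed

text \<open>Otherwise the iterates \<open>W (n + 1) = shear (W n) 1 v\<close> would converge to \<open>v\<close> without reaching it,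
  against discreteness, since \<open>W (n + 1) \<and> v = (W n \<and> v)\<^sup>2\<close>.\<close>

lemma shimizu:
  assumes v: "shear v 1 \<in> \<Gamma>" and w: "shear w 1 \<in> \<Gamma>" and less: "\<bar>wedge w v\<bar> < 1"
  shows "wedge w v = 0"
proof (rule ccontr)
  assume nz: "wedge w v \<noteq> 0"
  \<comment> \<open>By \<open>shear_conj\<close>, \<open>W (Suc n)\<close> is the vector of the
    transvection along v conjugated by the one along \<open>W n\<close>, so all these transvections
    stay in \<Gamma>.\<close>
  define W where "W = rec_nat w (\<lambda>_ u. shear u 1 *v v)"
  have W0: "W 0 = w" and WS: "W (Suc n) = shear (W n) 1 *v v" for n by (simp_all add: W_def)
  define c where "c n = wedge (W n) v" for n
  have WS': "W (Suc n) = v + c n *\<^sub>R W n" for n by (simp add: WS shear_mult_vec c_def)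
  have cS: "c (Suc n) = (c n)\<^sup>2" for n
    unfolding c_def[of "Suc n"] WS' by (simp add: c_def power2_eq_square)
  have Gamma: "shear (W n) 1 \<in> \<Gamma>" for n
  proof (induction n)
    case (Suc n)
    have "shear (W (Suc n)) 1 = shear (W n) 1 ** shear v 1 ** inv2 (shear (W n) 1)"
      by (simp add: WS shear_conj)
    then show ?case using Suc v by (simp add: mult inv)
  qed (simp add: W0 w)
  define q where "q = \<bar>wedge w v\<bar>"
  have q: "0 \<le> q" "q < 1" using less by (auto simp: q_def)
  have c0: "c n \<noteq> 0" for n
  proof (induction n)
    case 0 show ?case using nz by (simp add: c_def W0)
  qed (simp add: cS)
  have cb: "\<bar>c n\<bar> \<le> q ^ Suc n" for n
  proof (induction n)
    case (Suc n)
    have "\<bar>c n\<bar> \<le> q" using order_trans[OF Suc power_Suc_le_self[of q n]] q by simp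
    have "\<bar>c (Suc n)\<bar> = \<bar>c n\<bar> * \<bar>c n\<bar>" by (simp add: cS power2_eq_square)
    also have "\<dots> \<le> q * q ^ Suc n" using Suc \<open>\<bar>c n\<bar> \<le> q\<close> q by (intro mult_mono) auto
    finally show ?case by simp
  qed (simp add: c_def W0 q_def)
  have cq: "\<bar>c n\<bar> \<le> q" for n using order_trans[OF cb[of n] power_Suc_le_self[of q n]] q by simp
  \<comment> \<open>Since W (n + 1) = v + c n W n with |c n| \<le> q, the ball of radius B is
    preserved as soon as |v| + q B \<le> B.\<close>
  define B where "B = max (norm w) (norm v / (1 - q))"
  have B: "norm (W n) \<le> B" for n
  proof (induction n)
    case (Suc n)
    have "norm (W (Suc n)) \<le> norm v + \<bar>c n\<bar> * norm (W n)"
      unfolding WS' using norm_triangle_ineq[of v "c n *\<^sub>R W n"] by simp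
    also have "\<dots> \<le> norm v + q * B" using Suc cq q by (intro add_mono mult_mono) auto
    also have "norm v \<le> (1 - q) * B"
    proof -
      have "norm v / (1 - q) \<le> B" by (simp add: B_def)
      then show ?thesis using q by (simp add: pos_divide_le_eq mult.commute)
    qed
    finally show ?case by (simp add: algebra_simps)
  qed (simp add: W0 B_def)
  have "c \<longlonglongrightarrow> 0"
  proof (rule Lim_null_comparison)
    show "\<forall>\<^sub>F n in sequentially. norm (c n) \<le> q ^ Suc n" using cb by simp
    show "(\<lambda>n. q ^ Suc n) \<longlonglongrightarrow> 0" using q LIMSEQ_realpow_zero[of q] LIMSEQ_Suc by blast
  qed
  have "(\<lambda>n. c n *\<^sub>R W n) \<longlonglongrightarrow> 0"
  proof (rule Lim_null_comparison)
    show "\<forall>\<^sub>F n in sequentially. norm (c n *\<^sub>R W n) \<le> \<bar>c n\<bar> * B"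
      using B by (simp add: mult_left_mono)
    show "(\<lambda>n. \<bar>c n\<bar> * B) \<longlonglongrightarrow> 0"
      using tendsto_mult[OF tendsto_rabs[OF \<open>c \<longlonglongrightarrow> 0\<close>] tendsto_const[of B]] by simp
  qed
  then have "(\<lambda>n. v + c n *\<^sub>R W n) \<longlonglongrightarrow> v + 0" by (intro tendsto_add tendsto_const)
  then have W: "(\<lambda>n. W (Suc n)) \<longlonglongrightarrow> v" by (simp add: WS')
  obtain \<epsilon> where \<epsilon>: "\<epsilon> > 0" "\<And>\<gamma>. \<gamma> \<in> \<Gamma> \<Longrightarrow> norm (\<gamma> - mat 1) < \<epsilon> \<Longrightarrow> \<gamma> = mat 1" using isolated by blast
  have entry: "(\<lambda>n. norm (inv2 (shear v 1) ** shear (W (Suc n)) 1 - mat 1)) \<longlonglongrightarrow> 0"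
  proof (rule Lim_null_comparison)
    have Wi: "(\<lambda>n. W (Suc n) $ i) \<longlonglongrightarrow> v $ i" for i by (intro tendsto_intros W)
    have "(\<lambda>n. shear (W (Suc n)) 1 $ i $ j) \<longlonglongrightarrow> shear v 1 $ i $ j" for i j
      using exhaust_2[of i] exhaust_2[of j]
      by (elim disjE; simp add: shear_def; intro tendsto_intros Wi)
    then have "(\<lambda>n. shear (W (Suc n)) 1) \<longlonglongrightarrow> shear v 1" by (intro vec_tendstoI)
    then have L: "(\<lambda>n. shear (W (Suc n)) 1 - shear v 1) \<longlonglongrightarrow> 0" by (simp add: LIM_zero)
    show "(\<lambda>n. norm (inv2 (shear v 1)) * norm (shear (W (Suc n)) 1 - shear v 1)) \<longlonglongrightarrow> 0"
      using tendsto_mult[OF tendsto_const tendsto_norm[OF L]] by simp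
    have "inv2 (shear v 1) ** shear u 1 - mat 1 = inv2 (shear v 1) ** (shear u 1 - shear v 1)" for u
      by (simp add: matrix_mult_diff_right inv2_left)
    then show "\<forall>\<^sub>F n in sequentially. norm (norm (inv2 (shear v 1) ** shear (W (Suc n)) 1 - mat 1))
        \<le> norm (inv2 (shear v 1)) * norm (shear (W (Suc n)) 1 - shear v 1)"
      by (intro always_eventually allI) (simp only: real_norm_def abs_norm_cancel norm_matrix_mult_le)
  qed
  obtain n where "norm (inv2 (shear v 1) ** shear (W (Suc n)) 1 - mat 1) < \<epsilon>"
    using LIMSEQ_D[OF entry \<epsilon>(1)] by auto
  then have "inv2 (shear v 1) ** shear (W (Suc n)) 1 = mat 1" using \<epsilon>(2) v Gamma mult inv by blast
  then have "shear v 1 ** (inv2 (shear v 1) ** shear (W (Suc n)) 1) = shear v 1" by simp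
  \<comment> \<open>\<open>shear v 1\<close> fixes v, so equality of the transvections kills the
    displacement of v along \<open>W (Suc n)\<close>, although neither that vector nor its
    coefficient can vanish.\<close>
  then have "shear (W (Suc n)) 1 *v v = shear v 1 *v v" by simp
  then have "c (Suc n) *\<^sub>R W (Suc n) = 0" by (simp add: shear_mult_vec c_def)
  then have "W (Suc n) = 0" using c0 by simp
  then show False using c0[of "Suc n"] by (simp add: c_def)
qed

text \<open>The factor \<open>1/2\<close> stands in for choosing a generator of the unipotent stabiliser.\<close>

lemma normalized_shear:
  assumes x: "x \<in> S"
  shows "\<exists>\<kappa>>0. shear (\<kappa> *\<^sub>R x) 1 \<in> \<Gamma> \<and> (\<forall>s. shear (\<kappa> *\<^sub>R x) s \<in> \<Gamma> \<longrightarrow> \<bar>s\<bar> < 1/2 \<longrightarrow> s = 0)"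
proof -
  obtain \<epsilon> where \<epsilon>: "\<epsilon> > 0" "\<And>\<gamma>. \<gamma> \<in> \<Gamma> \<Longrightarrow> norm (\<gamma> - mat 1) < \<epsilon> \<Longrightarrow> \<gamma> = mat 1" using isolated by blast
  have x0: "x \<noteq> 0" by (rule nonzero[OF x])
  define P where "P = {s. s > 0 \<and> shear x s \<in> \<Gamma>}"
  have "P \<noteq> {}" using exists_shear[OF x] by (auto simp: P_def)
  have lower: "\<epsilon> / (norm x)\<^sup>2 \<le> s" if s: "s \<in> P" for s
  proof -
    have "shear x s \<noteq> mat 1" using s x0 by (simp add: P_def shear_eq_1_iff)
    then have "\<epsilon> \<le> norm (shear x s - mat 1)" using \<epsilon>(2)[of "shear x s"] s by (force simp: P_def)
    then show ?thesis using s x0 by (simp add: norm_shear_minus_1 P_def field_simps)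
  qed
  then have bdd: "bdd_below P" by (rule bdd_belowI)
  define k where "k = Inf P"
  have "\<epsilon> / (norm x)\<^sup>2 \<le> k" unfolding k_def using \<open>P \<noteq> {}\<close> lower by (intro cInf_greatest) auto
  then have k0: "k > 0" using \<epsilon>(1) x0 by (meson divide_pos_pos less_le_trans zero_less_power zero_less_norm_iff)
  then have "Inf P < 2 * k" by (simp add: k_def)
  then obtain s where s: "s \<in> P" "s < 2 * k" using cInf_lessD[OF \<open>P \<noteq> {}\<close>] by blast
  have s0: "s > 0" using s by (simp add: P_def)
  show ?thesis
  \<comment> \<open>Scaling the vector by \<kappa> multiplies the parameter by \<kappa>^2, so
    \<kappa> = sqrt s turns the parameter s into 1.\<close>
  proof (intro exI[of _ "sqrt s"] conjI allI impI)
    show "sqrt s > 0" using s0 by simp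
    show "shear (sqrt s *\<^sub>R x) 1 \<in> \<Gamma>" using s s0 by (simp add: shear_scaleR P_def)
    fix t assume t: "shear (sqrt s *\<^sub>R x) t \<in> \<Gamma>" "\<bar>t\<bar> < 1/2"
    then have ts: "shear x (t * s) \<in> \<Gamma>" using s0 by (simp add: shear_scaleR)
    then have ts': "shear x (- t * s) \<in> \<Gamma>" using inv[OF ts] by (simp add: inv2_shear)
    show "t = 0"
    proof (rule ccontr)
      assume "t \<noteq> 0"
      then have "\<bar>t\<bar> * s \<in> P" using ts ts' s0 by (auto simp: P_def abs_if)
      then have "k \<le> \<bar>t\<bar> * s" unfolding k_def by (rule cInf_lower[OF _ bdd])
      also have "\<dots> \<le> (1/2) * s" using t s0 by (intro mult_right_mono) auto
      finally show False using s by simp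
    qed
  qed
qed

text \<open>Each cusp is represented by a matrix \<open>g x\<close> taking the normalized vector
  \<open>V x\<close> to one common short vector. If two neighbourhoods met, \<open>V x\<close> and a
  translate of \<open>V y\<close> would have wedge less than 1, hence be parallel by Shimizu's
  lemma. The packing bound therefore limits every set of inequivalent vectors, and one of largest
  size represents all cusps.\<close>

lemma finitely_many_cusps:
  "\<exists>X. finite X \<and> X \<subseteq> S \<and> (\<forall>x\<in>S. \<exists>y\<in>X. \<exists>\<gamma>\<in>\<Gamma>. wedge x (\<gamma> *v y) = 0)"
proof -
  define R where "R x y \<longleftrightarrow> (\<exists>\<gamma>\<in>\<Gamma>. wedge x (\<gamma> *v y) = 0)" for x y
  have R_sym: "R y x" if "R x y" for x y
  proof -
    obtain \<gamma> where \<gamma>: "\<gamma> \<in> \<Gamma>" "wedge x (\<gamma> *v y) = 0" using \<open>R x y\<close> unfolding R_def by blast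
    have "wedge (inv2 \<gamma> *v x) (inv2 \<gamma> *v (\<gamma> *v y)) = 0"
      using \<gamma> SL[OF \<gamma>(1)] by (simp only: wedge_matrix)
    then have "wedge y (inv2 \<gamma> *v x) = 0" using SL[OF \<gamma>(1)] by (simp add: wedge_eq mult.commute)
    then show ?thesis unfolding R_def using inv[OF \<gamma>(1)] by blast
  qed
  have R_refl: "R x x" for x unfolding R_def using one by (intro bexI[of _ "mat 1"]) auto
  have "\<exists>\<kappa>. x \<in> S \<longrightarrow> \<kappa> > 0 \<and> shear (\<kappa> *\<^sub>R x) 1 \<in> \<Gamma> \<and> (\<forall>s. shear (\<kappa> *\<^sub>R x) s \<in> \<Gamma> \<longrightarrow> \<bar>s\<bar> < 1/2 \<longrightarrow> s = 0)" for x
    using normalized_shear[of x] by blast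
  then obtain \<kappa> where \<kappa>: "\<And>x. x \<in> S \<longrightarrow> \<kappa> x > 0 \<and> shear (\<kappa> x *\<^sub>R x) 1 \<in> \<Gamma> \<and> (\<forall>s. shear (\<kappa> x *\<^sub>R x) s \<in> \<Gamma> \<longrightarrow> \<bar>s\<bar> < 1/2 \<longrightarrow> s = 0)"
    by metis
  define V where "V x = \<kappa> x *\<^sub>R x" for x
  have V: "V x \<noteq> 0" "shear (V x) 1 \<in> \<Gamma>" "\<And>s. shear (V x) s \<in> \<Gamma> \<Longrightarrow> \<bar>s\<bar> < 1/2 \<Longrightarrow> s = 0" if "x \<in> S" for x
    using \<kappa>[of x] nonzero[of x] that by (auto simp: V_def)
  define g where "g x = flow (V x) (1/4)" for x
  \<comment> \<open>Length 1/4 suffices since u and u' have norm at most 3: the wedge is at most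
    (3/4)^2 < 1.\<close>
  define e :: "real^2" where "e = vector [1/4, 0]"
  have e: "norm e = 1/4" by (simp add: e_def)
  have g: "g x \<in> SL2_set" "g x *v V x = e" if "x \<in> S" for x
    using V(1)[OF that] by (simp_all add: g_def e_def flow_SL2 flow_vec)
  \<comment> \<open>The overlap below yields |s|/16 \<le> 6\<epsilon> for a transvection in \<Gamma>
    along \<open>V x\<close>; this must force |s| < 1/2, where the normalization leaves only s =
    0.\<close>
  define \<epsilon> :: real where "\<epsilon> = 1/1000"
  have pk: "packed \<Gamma> \<epsilon> X g" if X: "X \<subseteq> S" "\<And>x y. x \<in> X \<Longrightarrow> y \<in> X \<Longrightarrow> R x y \<Longrightarrow> x = y" for X
  proof (rule packedI)
    show "g x \<in> SL2_set" if "x \<in> X" for x using g X that by blast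
    fix x y u u' \<gamma> assume xy: "x \<in> X" "y \<in> X" and u: "u \<in> SL2_set" "u' \<in> SL2_set" and \<gamma>: "\<gamma> \<in> \<Gamma>"
      and near: "norm (u - mat 1) < \<epsilon>" "norm (u' - mat 1) < \<epsilon>" and eq: "u ** g x ** \<gamma> = u' ** g y"
    have S: "x \<in> S" "y \<in> S" using X xy by auto
    have eq': "u *v (g x *v (\<gamma> *v z)) = u' *v (g y *v z)" for z
      by (simp add: matrix_vector_mul_assoc matrix_mul_assoc eq)
    have u3: "norm u \<le> 3" "norm u' \<le> 3" using near by (auto intro!: norm_le_3 simp: \<epsilon>_def)
    let ?w = "\<gamma> *v V y"
    have "wedge (V x) ?w = wedge (u *v (g x *v V x)) (u *v (g x *v ?w))"
      using u g(1)[OF S(1)] by (simp add: wedge_matrix SL2_iff)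
    also have "\<dots> = wedge (u *v e) (u' *v e)" unfolding eq' using g S by simp
    also have "\<bar>\<dots>\<bar> \<le> norm (u *v e) * norm (u' *v e)" by (rule abs_wedge_le)
    also have "\<dots> \<le> (norm u * norm e) * (norm u' * norm e)" by (intro mult_mono norm_matrix_vector_mult_le) auto
    also have "\<dots> \<le> (3 * (1/4)) * (3 * (1/4))" unfolding e using u3 by (intro mult_mono) auto
    also have "\<dots> < 1" by simp
    finally have "\<bar>wedge (V x) ?w\<bar> < 1" .
    moreover have "shear ?w 1 \<in> \<Gamma>"
      using shear_conj[OF SL[OF \<gamma>], of "V y" 1] mult[OF mult[OF \<gamma> V(2)[OF S(2)]] inv[OF \<gamma>]] by simp
    ultimately have w0: "wedge (V x) ?w = 0" using shimizu V(2)[OF S(1)] by blast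
    have "wedge x (\<gamma> *v y) = 0" 
      using w0 \<kappa>[of x] \<kappa>[of y] S by (simp add: V_def matrix_vector_mult_scaleR)
    then have "x = y" using X(2) xy \<gamma> unfolding R_def by blast
    obtain c where c: "\<gamma> *v V x = c *\<^sub>R V x" using w0 wedge_eq_0_iff[OF V(1)[OF S(1)]] \<open>x = y\<close> by auto
    have "\<kappa> x *\<^sub>R (\<gamma> *v x) = \<gamma> *v V x" by (simp add: V_def matrix_vector_mult_scaleR)
    also have "\<dots> = \<kappa> x *\<^sub>R (c *\<^sub>R x)" unfolding c by (simp add: V_def mult.commute)
    finally have "\<kappa> x *\<^sub>R (\<gamma> *v x) = \<kappa> x *\<^sub>R (c *\<^sub>R x)" .
    moreover have "\<kappa> x \<noteq> 0" using V(1)[OF S(1)] by (auto simp: V_def)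
    ultimately have "\<gamma> *v x = c *\<^sub>R x" by (rule scaleR_left_imp_eq[rotated])
    then have "\<bar>c\<bar> = 1" by (rule eigenvalue_abs[OF \<gamma> S(1)])
    \<comment> \<open>The group may contain -1, so the sign is excluded by position: u e and -u' e
      cannot agree when u and u' are near 1.\<close>
    moreover have "c \<noteq> -1"
    proof
      assume "c = -1"
      have "u *v (g x *v (\<gamma> *v V x)) = u' *v (g x *v V x)" using eq'[of "V x"] \<open>x = y\<close> by simp
      moreover have "g x *v (\<gamma> *v V x) = (- 1) *\<^sub>R e"
        unfolding c \<open>c = -1\<close> matrix_vector_mult_scaleR g(2)[OF S(1)] ..
      ultimately have "(- 1) *\<^sub>R (u *v e) = u' *v e"
        unfolding g(2)[OF S(1)] by (simp only: matrix_vector_mult_scaleR)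
      then have "u *v e + u' *v e = 0" by (metis scaleR_minus1_left add.right_inverse)
      moreover have "2 *\<^sub>R e + ((u - mat 1) *v e + (u' - mat 1) *v e) = u *v e + u' *v e"
        by (simp add: matrix_vector_mult_diff_rdistrib scaleR_2)
      ultimately have "2 *\<^sub>R e = - ((u - mat 1) *v e + (u' - mat 1) *v e)" by (simp only: eq_neg_iff_add_eq_0)
      then have "norm (2 *\<^sub>R e) = norm ((u - mat 1) *v e + (u' - mat 1) *v e)" by (metis norm_minus_cancel)
      also have "\<dots> \<le> norm (u - mat 1) * norm e + norm (u' - mat 1) * norm e"
        by (intro order_trans[OF norm_triangle_ineq] add_mono norm_matrix_vector_mult_le)
      finally show False using near e by (simp add: \<epsilon>_def)
    qed
    ultimately have "c = 1" by (auto simp: abs_if split: if_splits)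
    then have "\<gamma> *v V x = V x" using c by simp
    then obtain s where s: "\<gamma> = shear (V x) s" using fixing_vector_is_shear[OF SL[OF \<gamma>] _ V(1)[OF S(1)]] by blast
    have "u ** (g x ** \<gamma>) = u' ** g x" using eq \<open>x = y\<close> by (simp add: matrix_mul_assoc)
    then have "inv2 u ** (u ** (g x ** \<gamma>)) = inv2 u ** (u' ** g x)" by simp
    then have "g x ** \<gamma> = inv2 u ** u' ** g x" using u(1) by (simp add: matrix_mul_assoc inv2_left)
    then have "g x ** \<gamma> ** inv2 (g x) = inv2 u ** u'" using g S by simp
    then have "shear e s = inv2 u ** u'" using shear_conj[of "g x" "V x" s] g S by (simp add: s)
    then have "norm (shear e s - mat 1) \<le> 6 * \<epsilon>"
      using norm_inv2_mult_minus_1[of u \<epsilon> u'] u near by (simp add: \<epsilon>_def)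
    then have "\<bar>s\<bar> < 1/2" by (simp add: norm_shear_minus_1 e \<epsilon>_def power2_eq_square)
    then have "s = 0" using V(3)[OF S(1)] \<gamma> s by blast
    then show "x = y \<and> \<gamma> = mat 1" using \<open>x = y\<close> s by (simp add: shear_eq_1_iff)
  qed
  have "\<epsilon> > 0" by (simp add: \<epsilon>_def)
  then obtain m where m: "\<And>X. finite X \<Longrightarrow> packed \<Gamma> \<epsilon> X g \<Longrightarrow> card X \<le> m"
    using packing_indexed[where ?'i = "real^2"] by metis
  \<comment> \<open>\<open>Q n\<close> asserts that n pairwise inequivalent vectors exist; the
    packing bound m makes a greatest such n available.\<close>
  define Q where "Q n \<longleftrightarrow> (\<exists>X. finite X \<and> X \<subseteq> S \<and> (\<forall>x\<in>X. \<forall>y\<in>X. R x y \<longrightarrow> x = y) \<and> card X = n)" for n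
  have Qm: "n \<le> m" if "Q n" for n
  proof -
    obtain X where "finite X" "X \<subseteq> S" "\<forall>x\<in>X. \<forall>y\<in>X. R x y \<longrightarrow> x = y" "card X = n" using \<open>Q n\<close> unfolding Q_def by blast
    then show ?thesis using m[OF _ pk, of X] by blast
  qed
  have "Q 0" unfolding Q_def by (intro exI[of _ "{}"]) auto
  then obtain n where n: "Q n" "\<And>k. Q k \<Longrightarrow> k \<le> n" using Nat.ex_has_greatest_nat[of Q 0 m] Qm by blast
  obtain X where X: "finite X" "X \<subseteq> S" "\<forall>x\<in>X. \<forall>y\<in>X. R x y \<longrightarrow> x = y" "card X = n" using n(1) unfolding Q_def by blast
  have "\<exists>y\<in>X. R x y" if x: "x \<in> S" for x
  proof (rule ccontr)
    assume neg: "\<not> ?thesis"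
    then have "x \<notin> X" "\<forall>y\<in>X. \<not> R x y \<and> \<not> R y x" using R_refl R_sym by blast+
    then have "Q (Suc n)" unfolding Q_def using X x by (intro exI[of _ "insert x X"]) auto
    then show False using n(2) by force
  qed
  then show ?thesis using X unfolding R_def by blast
qed

text \<open>Each x in S is \<tau> w with \<open>shear w 1\<close> in \<Gamma>, and Shimizu's lemma
  bounds |w \<and> w'| below by 1 unless it vanishes; so \<epsilon> = k^2 works once |\<tau>| \<ge>
  k throughout. Both k and N are extrema over the finitely many cusp representatives, to whose lines
  every line through S is moved by \<Gamma>.\<close>

lemma no_small_triangles:
  assumes lines: "\<And>x. x \<in> S \<Longrightarrow> finite {y\<in>S. wedge x y = 0}"
  shows "\<exists>\<epsilon>>0. \<exists>N. (\<forall>x\<in>S. \<forall>y\<in>S. wedge x y = 0 \<or> \<epsilon> \<le> \<bar>wedge x y\<bar>) \<and>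
    (\<forall>x\<in>S. card {y\<in>S. wedge x y = 0} \<le> N)"
proof -
  obtain X where X: "finite X" "X \<subseteq> S" "\<And>x. x \<in> S \<Longrightarrow> \<exists>y\<in>X. \<exists>\<gamma>\<in>\<Gamma>. wedge x (\<gamma> *v y) = 0"
    using finitely_many_cusps by blast
  obtain r where r: "r > 0" "\<And>x. x \<in> S \<Longrightarrow> r \<le> norm x" using short by blast
  have "\<exists>\<kappa>. x \<in> S \<longrightarrow> \<kappa> > 0 \<and> shear (\<kappa> *\<^sub>R x) 1 \<in> \<Gamma>" for x
    using normalized_shear[of x] by blast
  then obtain \<kappa> where \<kappa>: "\<And>x. x \<in> S \<longrightarrow> \<kappa> x > 0 \<and> shear (\<kappa> x *\<^sub>R x) 1 \<in> \<Gamma>" by metis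
  \<comment> \<open>If x = t \<gamma> y with y in X, then t y lies in S, so |t| |y| \<ge> r.
    Relative to the normalized vector \<open>\<kappa> y *\<^sub>R y\<close> the scalar is t /
    \<kappa> y, of size at least the listed quotient.\<close>
  define k where "k = Min (insert 1 ((\<lambda>y. r / (norm y * \<kappa> y)) ` X))"
  have k: "k > 0" using X r \<kappa> nonzero by (auto simp: k_def subset_iff)
  have kX: "k \<le> r / (norm y * \<kappa> y)" if "y \<in> X" for y using X(1) that by (auto simp: k_def intro!: Min_le)
  have cusp: "\<exists>y\<in>X. \<exists>\<gamma>\<in>\<Gamma>. \<exists>t. x = t *\<^sub>R (\<gamma> *v y) \<and> \<bar>t\<bar> * norm y \<ge> r" if x: "x \<in> S" for x
  proof -
    obtain y \<gamma> where y: "y \<in> X" "\<gamma> \<in> \<Gamma>" "wedge x (\<gamma> *v y) = 0" using X(3)[OF x] by blast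
    have "y \<in> S" using y X by blast
    then have gy: "\<gamma> *v y \<noteq> 0" using act[OF y(2)] nonzero by blast
    have "wedge (\<gamma> *v y) x = 0" using y(3) by (simp add: wedge_eq mult.commute)
    then obtain t where t: "x = t *\<^sub>R (\<gamma> *v y)" using wedge_eq_0_iff[OF gy] by blast
    have "inv2 \<gamma> *v x = t *\<^sub>R y" using t SL[OF y(2)] by (simp add: matrix_vector_mult_scaleR)
    then have "t *\<^sub>R y \<in> S" using act[OF inv[OF y(2)] x] by simp
    then have "r \<le> \<bar>t\<bar> * norm y" using r(2)[of "t *\<^sub>R y"] by simp
    then show ?thesis using y t by blast
  qed
  have norml: "\<exists>\<tau> w. x = \<tau> *\<^sub>R w \<and> shear w 1 \<in> \<Gamma> \<and> k \<le> \<bar>\<tau>\<bar>" if x: "x \<in> S" for x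
  proof -
    obtain y \<gamma> t where y: "y \<in> X" "\<gamma> \<in> \<Gamma>" "x = t *\<^sub>R (\<gamma> *v y)" "\<bar>t\<bar> * norm y \<ge> r" using cusp[OF x] by blast
    have yS: "y \<in> S" using y X by blast
    have ky: "\<kappa> y > 0" "shear (\<kappa> y *\<^sub>R y) 1 \<in> \<Gamma>" using \<kappa> yS by auto
    have ny: "norm y > 0" using nonzero[OF yS] by simp
    show ?thesis
    proof (intro exI conjI)
      show "x = (t / \<kappa> y) *\<^sub>R (\<gamma> *v (\<kappa> y *\<^sub>R y))" using y ky by (simp add: matrix_vector_mult_scaleR)
      show "shear (\<gamma> *v (\<kappa> y *\<^sub>R y)) 1 \<in> \<Gamma>"
        using shear_conj[OF SL[OF y(2)], of "\<kappa> y *\<^sub>R y" 1] mult[OF mult[OF y(2) ky(2)] inv[OF y(2)]] by simp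
      have "k \<le> r / (norm y * \<kappa> y)" by (rule kX[OF y(1)])
      also have "\<dots> \<le> (\<bar>t\<bar> * norm y) / (norm y * \<kappa> y)" using y(4) ky ny by (intro divide_right_mono) auto
      also have "\<dots> = \<bar>t / \<kappa> y\<bar>" using ky ny by simp
      finally show "k \<le> \<bar>t / \<kappa> y\<bar>" .
    qed
  qed
  have sep: "wedge x x' = 0 \<or> k * k \<le> \<bar>wedge x x'\<bar>" if S: "x \<in> S" "x' \<in> S" for x x'
  proof -
    obtain \<tau> w where 1: "x = \<tau> *\<^sub>R w" "shear w 1 \<in> \<Gamma>" "k \<le> \<bar>\<tau>\<bar>" using norml[OF S(1)] by blast
    obtain \<tau>' w' where 2: "x' = \<tau>' *\<^sub>R w'" "shear w' 1 \<in> \<Gamma>" "k \<le> \<bar>\<tau>'\<bar>" using norml[OF S(2)] by blast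
    show ?thesis
    proof (cases "\<bar>wedge w w'\<bar> < 1")
      case True
      then show ?thesis using shimizu[OF 2(2) 1(2)] 1(1) 2(1) by simp
    next
      case False
      then have "k * k * 1 \<le> \<bar>\<tau>\<bar> * \<bar>\<tau>'\<bar> * \<bar>wedge w w'\<bar>" using 1(3) 2(3) k by (intro mult_mono) auto
      then show ?thesis using 1(1) 2(1) by (simp add: abs_mult mult_ac)
    qed
  qed
  define N where "N = Max (insert 0 ((\<lambda>y. card {z\<in>S. wedge y z = 0}) ` X))"
  have "card {z\<in>S. wedge x z = 0} \<le> N" if x: "x \<in> S" for x
  proof -
    obtain y \<gamma> t where y: "y \<in> X" "\<gamma> \<in> \<Gamma>" "x = t *\<^sub>R (\<gamma> *v y)" "\<bar>t\<bar> * norm y \<ge> r" using cusp[OF x] by blast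
    have t: "t \<noteq> 0" using y r by auto
    have yS: "y \<in> S" using y X by blast
    have SLg: "\<gamma> \<in> SL2_set" using SL y by blast
    have "card {z\<in>S. wedge x z = 0} \<le> card {z\<in>S. wedge y z = 0}"
    proof (rule card_inj_on_le)
      show "inj_on ((*v) (inv2 \<gamma>)) {z\<in>S. wedge x z = 0}"
        by (rule inj_on_inverseI[of _ "(*v) \<gamma>"]) (use SLg in simp)
      show "(*v) (inv2 \<gamma>) ` {z\<in>S. wedge x z = 0} \<subseteq> {z\<in>S. wedge y z = 0}"
      proof clarify
        fix z assume z: "z \<in> S" "wedge x z = 0"
        then have "wedge (\<gamma> *v y) (\<gamma> *v (inv2 \<gamma> *v z)) = 0" using y(3) t SLg by simp
        then have "wedge y (inv2 \<gamma> *v z) = 0" using SLg by (simp only: wedge_matrix SL2_iff)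
        then show "inv2 \<gamma> *v z \<in> S \<and> wedge y (inv2 \<gamma> *v z) = 0" using act[OF inv[OF y(2)] z(1)] by simp
      qed
    qed (rule lines[OF yS])
    also have "\<dots> \<le> N" using X(1) y(1) by (auto simp: N_def intro!: Max_ge)
    finally show ?thesis .
  qed
  then show ?thesis using sep k by (intro exI[of _ "k * k"] conjI exI[of _ N]) auto
qed

end

section \<open>Lebesgue measure on 2 by 2 matrices\<close>

lemma prod_Basis_matrix_2:
  fixes f :: "real^2^2 \<Rightarrow> 'b::comm_monoid_mult"
  shows "(\<Prod>b\<in>Basis. f b) = f (axis 1 (axis 1 1)) * f (axis 1 (axis 2 1)) * f (axis 2 (axis 1 1)) * f (axis 2 (axis 2 1))"
proof -
  have B: "(Basis :: (real^2^2) set) = {axis 1 (axis 1 1), axis 1 (axis 2 1), axis 2 (axis 1 1), axis 2 (axis 2 1)}"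
    unfolding Basis_vec_def UNIV_2 by auto
  show ?thesis unfolding B by (subst prod.insert; simp add: axis_eq_axis mult.assoc)+
qed

lemma ball_Basis_matrix_2: "(\<forall>b\<in>Basis. P (b :: real^2^2)) \<longleftrightarrow>
  P (axis 1 (axis 1 1)) \<and> P (axis 1 (axis 2 1)) \<and> P (axis 2 (axis 1 1)) \<and> P (axis 2 (axis 2 1))"
  unfolding Basis_vec_def UNIV_2 by auto

lemma prod_Basis_vec_2:
  fixes f :: "real^2 \<Rightarrow> 'b::comm_monoid_mult"
  shows "(\<Prod>b\<in>Basis. f b) = f (axis 1 1) * f (axis 2 1)"
proof -
  have B: "(Basis :: (real^2) set) = {axis 1 1, axis 2 1}"
    unfolding Basis_vec_def UNIV_2 by auto
  show ?thesis unfolding B by (subst prod.insert; simp add: axis_eq_axis mult.assoc)+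
qed

lemma ball_Basis_vec_2: "(\<forall>b\<in>Basis. P (b :: real^2)) \<longleftrightarrow> P (axis 1 1) \<and> P (axis 2 1)"
  unfolding Basis_vec_def UNIV_2 by auto

lemma continuous_on_mult_right: "continuous_on X (\<lambda>A :: real^2^2. A ** g)"
  and continuous_on_mult_left: "continuous_on X (\<lambda>A :: real^2^2. g ** A)"
  and continuous_on_transpose: "continuous_on X (\<lambda>A :: real^2^2. Finite_Cartesian_Product.transpose A)"
  and continuous_on_det: "continuous_on X (\<lambda>A :: real^2^2. det A)"
  unfolding matrix_matrix_mult_def transpose_def det_2 by (intro continuous_intros)+

lemma measurable_mult_right [measurable]: "(\<lambda>A :: real^2^2. A ** g) \<in> borel_measurable borel"
  and measurable_mult_left [measurable]: "(\<lambda>A :: real^2^2. g ** A) \<in> borel_measurable borel"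
  and measurable_transpose [measurable]: "(\<lambda>A :: real^2^2. Finite_Cartesian_Product.transpose A) \<in> borel_measurable borel"
  and measurable_det [measurable]: "(\<lambda>A :: real^2^2. det A) \<in> borel_measurable borel"
  by (intro borel_measurable_continuous_onI continuous_on_mult_right continuous_on_mult_left
      continuous_on_transpose continuous_on_det)+

lemma lborel_distr_transpose: "distr lborel borel (\<lambda>A :: real^2^2. Finite_Cartesian_Product.transpose A) = lborel"
proof (rule lborel_eqI[symmetric])
  fix l u :: "real^2^2" assume lu: "\<And>b. b \<in> Basis \<Longrightarrow> l \<bullet> b \<le> u \<bullet> b"
  let ?t = "Finite_Cartesian_Product.transpose :: real^2^2 \<Rightarrow> real^2^2"
  have "?t -` box l u = box (?t l) (?t u)"
    by (auto simp: box_def ball_Basis_matrix_2 inner_axis transpose_def)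
  moreover have "\<forall>b\<in>Basis. l \<bullet> b \<le> u \<bullet> b" using lu by blast
  then have "\<forall>b\<in>Basis. ?t l \<bullet> b \<le> ?t u \<bullet> b"
    by (simp add: ball_Basis_matrix_2 inner_axis transpose_def)
  ultimately show "emeasure (distr lborel borel ?t) (box l u) = (\<Prod>b\<in>Basis. (u - l) \<bullet> b)"
    by (simp add: emeasure_distr prod_Basis_matrix_2 inner_axis transpose_def mult_ac)
qed simp

lemma lborel_distr_SL2_vec:
  assumes "g \<in> SL2_set" shows "distr lborel borel (\<lambda>x :: real^2. g *v x) = lborel"
proof (rule lborel_eqI[symmetric])
  fix l u :: "real^2" assume lu: "\<And>b. b \<in> Basis \<Longrightarrow> l \<bullet> b \<le> u \<bullet> b"
  have [measurable]: "(\<lambda>x :: real^2. g *v x) \<in> borel_measurable borel"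
    by (intro borel_measurable_continuous_onI matrix_vector_mult_linear_continuous_on)
  let ?B = "(*v) (inv2 g) ` box l u"
  have eq: "(\<lambda>x. g *v x) -` box l u = ?B"
    using assms by (auto simp: image_iff intro: exI) (metis inv2_cancel(3))
  have lin: "linear ((*v) (inv2 g))" by (rule matrix_vector_mul_linear)
  have meas: "(\<lambda>x. g *v x) -` box l u \<in> sets borel"
    using measurable_sets[of "\<lambda>x :: real^2. g *v x" borel borel "box l u"] by simp
  have "emeasure (distr lborel borel (\<lambda>x. g *v x)) (box l u) = emeasure lebesgue ?B"
    using meas by (simp add: emeasure_distr eq)
  also have "\<dots> = ennreal (measure lebesgue ?B)"
    using measurable_linear_image[OF lin lmeasurable_box] by (simp add: emeasure_eq_measure2)
  also have "measure lebesgue ?B = \<bar>det (inv2 g)\<bar> * measure lebesgue (box l u)"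
    by (subst measure_linear_image[OF lin]) (auto simp: )
  also have "\<dots> = measure lborel (box l u)" using assms by (simp add: SL2_iff)
  also have "ennreal \<dots> = (\<Prod>b\<in>Basis. (u - l) \<bullet> b)"
    using lu by (simp add: measure_lborel_box)
  finally show "emeasure (distr lborel borel (\<lambda>x. g *v x)) (box l u) = (\<Prod>b\<in>Basis. (u - l) \<bullet> b)" .
qed simp

text \<open>Right multiplication by g acts on each row by the transpose of g; reading matrices as
  pairs of rows thus reduces right invariance of the measure on matrices to invariance in the
  plane.\<close>

definition of_rows :: "(real^2) \<times> (real^2) \<Rightarrow> real^2^2" where
  "of_rows p = vector [fst p, snd p]"

lemma of_rows_nth [simp]: "of_rows p $ 1 = fst p" "of_rows p $ 2 = snd p"
  by (simp_all add: of_rows_def)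

lemma measurable_of_rows [measurable]: "of_rows \<in> borel_measurable borel"
proof (rule borel_measurable_continuous_onI)
  have eq: "of_rows = (\<lambda>p. \<chi> i. if i = 1 then fst p else snd p)"
    by (auto simp: fun_eq_iff vec_eq_iff forall_2)
  have "continuous_on UNIV (\<lambda>p :: (real^2) \<times> (real^2). if i = 1 then fst p else snd p)" for i :: 2
    by (cases "i = 1") (auto intro!: continuous_intros)
  then show "continuous_on UNIV of_rows" unfolding eq by (rule continuous_on_vec_lambda)
qed

lemma distr_of_rows: "distr (lborel \<Otimes>\<^sub>M lborel) borel of_rows = lborel"
proof (rule lborel_eqI[symmetric])
  fix l u :: "real^2^2" assume lu: "\<And>b. b \<in> Basis \<Longrightarrow> l \<bullet> b \<le> u \<bullet> b"
  have pre: "of_rows -` box l u = box (l$1) (u$1) \<times> box (l$2) (u$2)"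
    by (auto simp: box_def ball_Basis_matrix_2 ball_Basis_vec_2 inner_axis)
  have "\<forall>b\<in>Basis. l \<bullet> b \<le> u \<bullet> b" using lu by blast
  then have b: "\<forall>b\<in>Basis. l$1 \<bullet> b \<le> u$1 \<bullet> b" "\<forall>b\<in>Basis. l$2 \<bullet> b \<le> u$2 \<bullet> b"
    by (simp_all add: ball_Basis_matrix_2 ball_Basis_vec_2 inner_axis)
  then have nn: "0 \<le> (\<Prod>b\<in>Basis. (u$1 - l$1) \<bullet> b)" "0 \<le> (\<Prod>b\<in>Basis. (u$2 - l$2) \<bullet> b)"
    by (auto intro!: prod_nonneg simp: inner_diff_left)
  have [measurable]: "of_rows \<in> measurable (lborel \<Otimes>\<^sub>M lborel) borel"
    by (simp add: lborel_prod)
  have "emeasure (distr (lborel \<Otimes>\<^sub>M lborel) borel of_rows) (box l u) =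
      emeasure (lborel \<Otimes>\<^sub>M lborel) (box (l$1) (u$1) \<times> box (l$2) (u$2))"
    by (simp add: emeasure_distr pre space_pair_measure)
  also have "\<dots> = emeasure lborel (box (l$1) (u$1)) * emeasure lborel (box (l$2) (u$2))"
    by (intro lborel.emeasure_pair_measure_Times) auto
  also have "\<dots> = ennreal ((\<Prod>b\<in>Basis. (u$1 - l$1) \<bullet> b) * (\<Prod>b\<in>Basis. (u$2 - l$2) \<bullet> b))"
    using b nn by (simp add: emeasure_lborel_box_eq ennreal_mult)
  also have "(\<Prod>b\<in>Basis. (u$1 - l$1) \<bullet> b) * (\<Prod>b\<in>Basis. (u$2 - l$2) \<bullet> b) = (\<Prod>b\<in>Basis. (u - l) \<bullet> b)"
    by (simp add: prod_Basis_matrix_2 prod_Basis_vec_2 inner_axis mult_ac)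
  finally show "emeasure (distr (lborel \<Otimes>\<^sub>M lborel) borel of_rows) (box l u) = (\<Prod>b\<in>Basis. (u - l) \<bullet> b)" .
qed simp

lemma lborel_distr_SL2_right:
  assumes "g \<in> SL2_set" shows "distr lborel borel (\<lambda>A :: real^2^2. A ** g) = lborel"
proof -
  let ?h = "Finite_Cartesian_Product.transpose g"
  have h: "?h \<in> SL2_set" using assms by (simp add: SL2_iff)
  have [measurable]: "(\<lambda>x :: real^2. ?h *v x) \<in> borel_measurable borel"
    by (intro borel_measurable_continuous_onI matrix_vector_mult_linear_continuous_on)
  have [measurable]: "of_rows \<in> measurable (lborel \<Otimes>\<^sub>M lborel) borel" "of_rows \<in> measurable (borel \<Otimes>\<^sub>M borel) borel"
    by (simp_all add: lborel_prod borel_prod)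
  have [measurable]: "(\<lambda>(x, y). (?h *v x, ?h *v y)) \<in> measurable (lborel \<Otimes>\<^sub>M lborel) (borel \<Otimes>\<^sub>M borel)"
    by measurable
  have row: "of_rows p ** g = of_rows (?h *v fst p, ?h *v snd p)" for p
    by (simp add: matrix_eq_2 matrix_mult_2 matrix_vector_mult_2 transpose_def mult.commute)
  have sf: "sigma_finite_measure (distr lborel borel (\<lambda>x :: real^2. ?h *v x))"
    unfolding lborel_distr_SL2_vec[OF h] by (rule sigma_finite_lborel)
  have "distr lborel borel (\<lambda>A :: real^2^2. A ** g) = distr (distr (lborel \<Otimes>\<^sub>M lborel) borel of_rows) borel (\<lambda>A. A ** g)"
    by (simp add: distr_of_rows)
  also have "\<dots> = distr (lborel \<Otimes>\<^sub>M lborel) borel (of_rows \<circ> (\<lambda>(x, y). (?h *v x, ?h *v y)))"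
    by (subst distr_distr) (simp_all add: comp_def row case_prod_beta del: transpose_matrix_vector)
  also have "\<dots> = distr (distr (lborel \<Otimes>\<^sub>M lborel) (borel \<Otimes>\<^sub>M borel) (\<lambda>(x, y). (?h *v x, ?h *v y))) borel of_rows"
    by (subst distr_distr) (simp_all del: transpose_matrix_vector)
  also have "distr (lborel \<Otimes>\<^sub>M lborel) (borel \<Otimes>\<^sub>M borel) (\<lambda>(x, y). (?h *v x, ?h *v y)) =
      distr lborel borel (\<lambda>x. ?h *v x) \<Otimes>\<^sub>M distr lborel borel (\<lambda>x. ?h *v x)"
    by (rule pair_measure_distr[symmetric, OF _ _ sf]) (simp_all del: transpose_matrix_vector)
  also have "\<dots> = lborel \<Otimes>\<^sub>M lborel" by (simp only: lborel_distr_SL2_vec[OF h])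
  finally show ?thesis by (simp add: distr_of_rows)
qed

text \<open>Transposition exchanges left and right multiplication and merely permutes the
  coordinates.\<close>

lemma lborel_distr_SL2_left:
  assumes "g \<in> SL2_set" shows "distr lborel borel (\<lambda>A :: real^2^2. g ** A) = lborel"
proof -
  let ?t = "Finite_Cartesian_Product.transpose :: real^2^2 \<Rightarrow> real^2^2"
  have h: "?t g \<in> SL2_set" using assms by (simp add: SL2_iff)
  have "(\<lambda>A :: real^2^2. g ** A) = ?t \<circ> (\<lambda>A. A ** ?t g) \<circ> ?t"
    by (simp add: fun_eq_iff matrix_transpose_mul)
  then have "distr lborel borel (\<lambda>A :: real^2^2. g ** A) = distr (distr (distr lborel borel ?t) borel (\<lambda>A. A ** ?t g)) borel ?t"
    by (simp add: distr_distr comp_def)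
  then show ?thesis by (simp add: lborel_distr_transpose lborel_distr_SL2_right[OF h])
qed

section \<open>Haar measure and packing\<close>

definition normalize_det :: "real^2^2 \<Rightarrow> real^2^2" where
  "normalize_det A = (1 / sqrt (det A)) *\<^sub>R A"

definition det_slab :: "(real^2^2) set" where
  "det_slab = {A. 0 < det A \<and> det A \<le> 1}"

text \<open>The Haar measure of \<open>X\<close> is the Lebesgue measure of the cone
  \<open>{t g | 0 < t \<le> 1, g \<in> X}\<close>.\<close>

definition haar :: "(real^2^2) measure" where
  "haar = distr (restrict_space lborel det_slab) (restrict_space borel SL2_set) normalize_det"

lemma det_scaleR_2: "det (c *\<^sub>R A) = c\<^sup>2 * det A" for A :: "real^2^2"
  by (simp add: det_2 power2_eq_square algebra_simps)

lemma normalize_det_SL2: "0 < det A \<Longrightarrow> normalize_det A \<in> SL2_set"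
  by (simp add: normalize_det_def SL2_iff det_scaleR_2 power_divide)

lemma SL2_borel [measurable]: "SL2_set \<in> sets borel"
proof -
  have "SL2_set = (\<lambda>A :: real^2^2. det A) -` {1} \<inter> space borel" by (auto simp: SL2_set_def)
  then show ?thesis using measurable_sets[OF measurable_det, of "{1}"] by simp
qed

lemma det_slab_borel [measurable]: "det_slab \<in> sets borel"
proof -
  have "det_slab = (\<lambda>A :: real^2^2. det A) -` {0<..1} \<inter> space borel" by (auto simp: det_slab_def)
  then show ?thesis using measurable_sets[OF measurable_det, of "{0<..1}"] by simp
qed

lemma measurable_normalize_det [measurable]: "normalize_det \<in> borel_measurable borel"
  unfolding normalize_det_def by measurable

lemma sets_haar: "sets haar = sets (restrict_space borel SL2_set)" and space_haar: "space haar = SL2_set"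
  by (simp_all add: haar_def space_restrict_space)

lemma sets_haar_iff: "X \<in> sets haar \<longleftrightarrow> X \<subseteq> SL2_set \<and> X \<in> sets borel"
  unfolding sets_haar by (simp add: sets_restrict_space_iff)

definition det_cone :: "(real^2^2) set \<Rightarrow> (real^2^2) set" where
  "det_cone X = {A \<in> det_slab. normalize_det A \<in> X}"

lemma det_cone_borel: "X \<in> sets haar \<Longrightarrow> det_cone X \<in> sets borel"
proof -
  assume "X \<in> sets haar"
  then have [measurable]: "X \<in> sets borel" by (simp add: sets_haar_iff)
  have "det_cone X = det_slab \<inter> (normalize_det -` X \<inter> space borel)" by (auto simp: det_cone_def)
  also have "\<dots> \<in> sets borel" by measurable
  finally show ?thesis .
qed

lemma emeasure_haar:
  assumes "X \<in> sets haar" shows "emeasure haar X = emeasure lborel (det_cone X)"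
proof -
  have m: "normalize_det \<in> measurable (restrict_space lborel det_slab) (restrict_space borel SL2_set)"
    by (rule measurable_restrict_space2)
       (auto simp: space_restrict_space det_slab_def intro!: normalize_det_SL2 measurable_restrict_space1)
  have "emeasure haar X = emeasure (restrict_space lborel det_slab) (normalize_det -` X \<inter> det_slab)"
    unfolding haar_def using assms by (subst emeasure_distr[OF m]) (simp_all add: sets_haar space_restrict_space)
  also have "\<dots> = emeasure lborel (normalize_det -` X \<inter> det_slab)"
    by (rule emeasure_restrict_space) auto
  also have "normalize_det -` X \<inter> det_slab = det_cone X" by (auto simp: det_cone_def)
  finally show ?thesis .
qed

lemma normalize_det_mult:
  assumes "g \<in> SL2_set"
  shows "normalize_det (g ** A) = g ** normalize_det A" "normalize_det (A ** g) = normalize_det A ** g"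
  using assms by (simp_all add: normalize_det_def SL2_iff det_mul matrix_eq_2 matrix_mult_2 algebra_simps)

text \<open>Since f' preserves determinants and commutes with the normalization, the cone over f X
  is the preimage under f' of the cone over X. Working with f', the inverse of f, turns images into
  preimages, whose measurability is immediate. Left and right multiplication are both
  instances.\<close>

lemma haar_image:
  fixes f f' :: "real^2^2 \<Rightarrow> real^2^2"
  assumes inv: "\<And>A. f' (f A) = A" "\<And>A. f (f' A) = A" and meas: "f' \<in> borel_measurable borel"
    and SL2: "\<And>A. A \<in> SL2_set \<Longrightarrow> f A \<in> SL2_set" and det: "\<And>A. det (f' A) = det A"
    and norm: "\<And>A. normalize_det (f' A) = f' (normalize_det A)"
    and lborel: "distr lborel borel f' = lborel" and X: "X \<in> sets haar"
  shows "f ` X \<in> sets haar" "emeasure haar (f ` X) = emeasure haar X"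
proof -
  have XS: "X \<subseteq> SL2_set" "X \<in> sets borel" using X by (auto simp: sets_haar_iff)
  have eq: "f ` X = f' -` X"
  proof (intro equalityI subsetI)
    fix A assume "A \<in> f' -` X"
    then show "A \<in> f ` X" by (intro image_eqI[of _ _ "f' A"]) (simp_all add: inv)
  qed (auto simp: inv)
  have "f' -` X \<in> sets borel" using measurable_sets[OF meas XS(2)] by simp
  then show fX: "f ` X \<in> sets haar" using XS SL2 by (auto simp: sets_haar_iff eq[symmetric])
  have "det_cone (f ` X) = f' -` det_cone X"
    unfolding eq by (auto simp: det_cone_def det_slab_def norm det)
  then have "emeasure haar (f ` X) = emeasure (distr lborel borel f') (det_cone X)"
    using det_cone_borel[OF X] meas by (simp add: emeasure_haar[OF fX] emeasure_distr)
  then show "emeasure haar (f ` X) = emeasure haar X" using X by (simp add: lborel emeasure_haar)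
qed

text \<open>Right invariance is unimodularity of SL2; it goes beyond the defining property
  \<open>haar_measure_SL2\<close>, and it allows pieces to be moved by elements of \<Gamma>, which
  act on the right.\<close>

lemma
  assumes g: "g \<in> SL2_set" and X: "X \<in> sets haar"
  shows haar_left: "(**) g ` X \<in> sets haar" "emeasure haar ((**) g ` X) = emeasure haar X"
    and haar_right: "(\<lambda>A. A ** g) ` X \<in> sets haar" "emeasure haar ((\<lambda>A. A ** g) ` X) = emeasure haar X"
proof -
  have g': "inv2 g \<in> SL2_set" "det (inv2 g) = 1" using g by (simp_all add: SL2_iff)
  show "(**) g ` X \<in> sets haar" "emeasure haar ((**) g ` X) = emeasure haar X"
    by (rule haar_image[of "(**) (inv2 g)", OF _ _ _ _ _ _ _ X];
        use g g' in \<open>simp add: det_mul normalize_det_mult lborel_distr_SL2_left\<close>)+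
  show "(\<lambda>A. A ** g) ` X \<in> sets haar" "emeasure haar ((\<lambda>A. A ** g) ` X) = emeasure haar X"
    by (rule haar_image[of "\<lambda>A. A ** inv2 g", OF _ _ _ _ _ _ _ X];
        use g g' in \<open>simp add: det_mul normalize_det_mult lborel_distr_SL2_right\<close>)+
qed

definition nbhd :: "real \<Rightarrow> (real^2^2) set" where
  "nbhd \<epsilon> = {u \<in> SL2_set. norm (u - mat 1) < \<epsilon>}"

lemma nbhd_sets: "nbhd \<epsilon> \<in> sets haar"
proof -
  have "nbhd \<epsilon> = SL2_set \<inter> ball (mat 1) \<epsilon>" by (auto simp: nbhd_def dist_norm norm_minus_commute)
  then show ?thesis by (auto simp: sets_haar_iff)
qed

lemma emeasure_nbhd_pos:
  assumes "\<epsilon> > 0" shows "emeasure haar (nbhd \<epsilon>) > 0"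
proof -
  let ?P = "{A :: real^2^2. 0 < det A}"
  have oP: "open ?P" using open_Collect_less[OF continuous_on_const continuous_on_det, of 0] by simp
  have c: "continuous_on ?P (\<lambda>A. (normalize_det A, det A))"
    unfolding normalize_det_def by (intro continuous_intros continuous_on_det) auto
  define O' where "O' = ?P \<inter> (\<lambda>A. (normalize_det A, det A)) -` (ball (mat 1) \<epsilon> \<times> {0<..<1})"
  have "open O'" unfolding O'_def using c oP
    by (intro continuous_open_preimage) (auto simp: open_Times)
  \<comment> \<open>Half the identity normalizes to 1 and has determinant 1/4, inside the open
    interval; the identity itself sits on the boundary of the slab.\<close>
  moreover have "(1/2) *\<^sub>R mat 1 \<in> O'"
    using assms by (simp add: O'_def normalize_det_def det_scaleR_2 power_divide real_sqrt_divide)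
  ultimately have "\<not> negligible O'" using open_not_negligible by blast
  moreover have "O' \<in> sets lborel" using \<open>open O'\<close> by simp
  ultimately have "emeasure lborel O' \<noteq> 0"
    by (auto simp: negligible_iff_emeasure0)
  moreover have "O' \<subseteq> det_cone (nbhd \<epsilon>)"
    by (auto simp: O'_def det_cone_def det_slab_def nbhd_def normalize_det_SL2 dist_norm norm_minus_commute)
  then have "emeasure lborel O' \<le> emeasure lborel (det_cone (nbhd \<epsilon>))"
    using det_cone_borel[OF nbhd_sets] by (intro emeasure_mono) auto
  ultimately have "0 < emeasure lborel (det_cone (nbhd \<epsilon>))"
    by (metis le_zero_eq zero_less_iff_neq_zero)
  then show ?thesis by (simp add: emeasure_haar[OF nbhd_sets])
qed

text \<open>\<open>lattice_SL2\<close> promises a covering set of finite measure for every Haar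
  measure; exhibiting one Haar measure makes the promise usable.\<close>

lemma haar_measure_SL2_haar: "haar_measure_SL2 haar"
  unfolding haar_measure_SL2_def
proof (intro conjI allI impI ballI)
  show "space haar = SL2_set" by (rule space_haar)
  show "sets haar = sets (restrict_space borel SL2_set)" by (rule sets_haar)
  have "emeasure haar (nbhd 1) \<le> emeasure haar (space haar)" by (rule emeasure_space)
  then show "emeasure haar SL2_set \<noteq> 0" using emeasure_nbhd_pos[of 1] by (auto simp: space_haar)
  fix K :: "(real^2^2) set" assume K: "compact K \<and> K \<subseteq> SL2_set"
  then have KS: "K \<in> sets haar" by (auto simp: sets_haar_iff intro: borel_compact)
  obtain B where B: "\<And>A. A \<in> K \<Longrightarrow> norm A \<le> B" using K compact_imp_bounded bounded_iff by metis
  \<comment> \<open>Every element of the cone is a point of K scaled by a factor in (0, 1], so a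
    bound for K serves for the cone.\<close>
  have "bounded (det_cone K)"
  proof (rule boundedI)
    fix A assume A: "A \<in> det_cone K"
    then have d: "0 < det A" "det A \<le> 1" "normalize_det A \<in> K" by (auto simp: det_cone_def det_slab_def)
    have s: "sqrt (det A) \<le> 1" using d by simp
    have "norm A = sqrt (det A) * norm (normalize_det A)" using d by (simp add: normalize_det_def)
    also have "\<dots> \<le> 1 * norm (normalize_det A)" by (rule mult_right_mono[OF s]) simp
    also have "\<dots> \<le> B" using B[OF d(3)] by simp
    finally show "norm A \<le> B" .
  qed
  then show "emeasure haar K < \<infinity>" unfolding emeasure_haar[OF KS] by (rule emeasure_bounded_finite)
qed (rule haar_left)

section \<open>Volume comparison in the quotient by a discrete group\<close>

lemma discrete_imp_countable:
  fixes X :: "'a :: second_countable_topology set"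
  assumes "discrete X" shows "countable X"
proof -
  obtain \<B> :: "'a set set" where B: "countable \<B>" "\<And>C. C \<in> \<B> \<Longrightarrow> open C"
    "\<And>S. open S \<Longrightarrow> \<exists>U. U \<subseteq> \<B> \<and> S = \<Union>U" using univ_second_countable by blast
  have "\<exists>U\<in>\<B>. U \<inter> X = {x}" if x: "x \<in> X" for x
  proof -
    obtain T where T: "open T" "T \<inter> X = {x}"
      using assms x by (auto simp: discrete_def isolated_in_def)
    obtain \<U> where U: "\<U> \<subseteq> \<B>" "T = \<Union>\<U>" using B(3)[OF T(1)] by blast
    then obtain U where "U \<in> \<U>" "x \<in> U" using T by blast
    then have "U \<inter> X = {x}" "U \<in> \<B>" using U T x by blast+
    then show ?thesis by blast
  qed
  then obtain f where f: "\<And>x. x \<in> X \<Longrightarrow> f x \<in> \<B> \<and> f x \<inter> X = {x}" by metis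
  have "inj_on f X" by (rule inj_onI) (use f in blast)
  moreover have "f ` X \<subseteq> \<B>" using f by blast
  ultimately show ?thesis using countable_subset[OF _ B(1)] by (auto intro: countable_image_inj_on)
qed

text \<open>A measurable set that injects into the quotient by \<open>\<Gamma>\<close> is no larger than any set
  covering the quotient: move its pieces into \<open>F\<close>.\<close>

lemma emeasure_injective_le:
  assumes \<Gamma>: "countable \<Gamma>" "\<Gamma> \<subseteq> SL2_set" "mat 1 \<in> \<Gamma>" "\<And>A B. A \<in> \<Gamma> \<Longrightarrow> B \<in> \<Gamma> \<Longrightarrow> A ** B \<in> \<Gamma>"
      "\<And>A. A \<in> \<Gamma> \<Longrightarrow> inv2 A \<in> \<Gamma>"
    and F: "F \<in> sets haar" "SL2_set \<subseteq> {f ** \<gamma> |f \<gamma>. f \<in> F \<and> \<gamma> \<in> \<Gamma>}"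
    and W: "W \<in> sets haar" "\<And>w w' \<gamma>. w \<in> W \<Longrightarrow> w' \<in> W \<Longrightarrow> \<gamma> \<in> \<Gamma> \<Longrightarrow> w ** \<gamma> = w' \<Longrightarrow> \<gamma> = mat 1"
  shows "emeasure haar W \<le> emeasure haar F"
proof -
  \<comment> \<open>The enumeration may repeat elements, for instance when \<Gamma> is finite;
    \<open>disjointed\<close> empties the repeated pieces.\<close>
  define \<gamma> where "\<gamma> = from_nat_into \<Gamma>"
  have g: "\<gamma> n \<in> \<Gamma>" for n unfolding \<gamma>_def using \<Gamma>(3) by (intro from_nat_into) auto
  have range: "range \<gamma> = \<Gamma>" unfolding \<gamma>_def using \<Gamma>(1,3) by (intro range_from_nat_into) auto
  have gS: "\<gamma> n \<in> SL2_set" for n using g \<Gamma> by blast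
  define E where "E n = (\<lambda>A. A ** \<gamma> n) ` F" for n
  have E: "E n \<in> sets haar" for n unfolding E_def by (rule haar_right(1)[OF gS F(1)])
  \<comment> \<open>W is cut so that \<open>P n\<close> lies in F \<gamma> n. Moved back by the
    inverse of \<open>\<gamma> n\<close>, the pieces land in F, and they stay disjoint because two
    points of W related by \<Gamma> coincide.\<close>
  define P where "P n = W \<inter> disjointed E n" for n
  have dE: "disjointed E n \<subseteq> E n" for n by (rule disjointed_subset)
  have P: "P n \<in> sets haar" for n
  proof -
    have "range (disjointed E) \<subseteq> sets haar" by (rule sets.range_disjointed_sets') (use E in auto)
    then show ?thesis unfolding P_def using W(1) by blast
  qed
  have "W \<subseteq> (\<Union>n. E n)"
  proof
    fix w assume "w \<in> W"
    then have "w \<in> SL2_set" using W(1) by (auto simp: sets_haar_iff)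
    then obtain f d where "f \<in> F" "d \<in> \<Gamma>" "w = f ** d" using F(2) by blast
    moreover then obtain n where "d = \<gamma> n" using range by blast
    ultimately show "w \<in> (\<Union>n. E n)" unfolding E_def by blast
  qed
  then have WP: "W = (\<Union>n. P n)" unfolding P_def using UN_disjointed_eq[of E] by blast
  have disj: "disjoint_family P" unfolding P_def using disjoint_family_disjointed[of E]
    by (auto simp: disjoint_family_on_def)
  define Q where "Q n = (\<lambda>A. A ** inv2 (\<gamma> n)) ` P n" for n
  have Q: "Q n \<in> sets haar" "emeasure haar (Q n) = emeasure haar (P n)" for n
    unfolding Q_def using haar_right[OF _ P, of "inv2 (\<gamma> n)"] gS by auto
  have "disjoint_family Q" unfolding disjoint_family_on_def
  proof (intro ballI impI equals0I)
    fix m n A assume mn: "m \<noteq> n" and A: "A \<in> Q m \<inter> Q n"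
    then obtain a b where ab: "a \<in> P m" "A = a ** inv2 (\<gamma> m)" "b \<in> P n" "A = b ** inv2 (\<gamma> n)"
      unfolding Q_def by blast
    have "a ** (inv2 (\<gamma> m) ** \<gamma> n) = a ** inv2 (\<gamma> m) ** \<gamma> n" by (simp add: matrix_mul_assoc)
    also have "a ** inv2 (\<gamma> m) = b ** inv2 (\<gamma> n)" using ab by simp
    also have "b ** inv2 (\<gamma> n) ** \<gamma> n = b" using gS by simp
    finally have e: "a ** (inv2 (\<gamma> m) ** \<gamma> n) = b" .
    have "inv2 (\<gamma> m) ** \<gamma> n = mat 1"
      by (rule W(2)[OF _ _ _ e]) (use ab g \<Gamma> in \<open>auto simp: P_def\<close>)
    then have "a = b" using e by simp
    then show False using ab mn disj unfolding disjoint_family_on_def by blast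
  qed
  have QF: "(\<Union>n. Q n) \<subseteq> F"
  proof clarify
    fix n A assume "A \<in> Q n"
    then obtain a where "a \<in> P n" "A = a ** inv2 (\<gamma> n)" unfolding Q_def by blast
    moreover then obtain f where "f \<in> F" "a = f ** \<gamma> n" using dE unfolding P_def E_def by blast
    ultimately show "A \<in> F" using gS by simp
  qed
  have "emeasure haar W = (\<Sum>n. emeasure haar (P n))"
    unfolding WP using P disj by (intro suminf_emeasure[symmetric]) auto
  also have "\<dots> = (\<Sum>n. emeasure haar (Q n))" by (simp add: Q)
  also have "\<dots> = emeasure haar (\<Union>n. Q n)"
    using Q \<open>disjoint_family Q\<close> by (intro suminf_emeasure) auto
  also have "\<dots> \<le> emeasure haar F" using QF F(1) by (rule emeasure_mono)
  finally show ?thesis .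
qed

text \<open>The sets U g for g in G are disjoint, have the measure of U by right invariance, and
  their union injects into the quotient. So card G times the measure of U is at most the measure of
  F, and m is any integer whose multiple of the measure of U exceeds it.\<close>

lemma lattice_packing:
  assumes L: "lattice_SL2 \<Gamma>" and "\<epsilon> > 0"
    and \<Gamma>: "\<Gamma> \<subseteq> SL2_set" "mat 1 \<in> \<Gamma>" "\<And>A B. A \<in> \<Gamma> \<Longrightarrow> B \<in> \<Gamma> \<Longrightarrow> A ** B \<in> \<Gamma>" "\<And>A. A \<in> \<Gamma> \<Longrightarrow> inv2 A \<in> \<Gamma>"
  shows "\<exists>m::nat. \<forall>G. finite G \<longrightarrow> packed \<Gamma> \<epsilon> G id \<longrightarrow> card G \<le> m"
proof -
  obtain F where F: "F \<in> sets haar" "emeasure haar F < \<infinity>" "{f ** \<gamma> |f \<gamma>. f \<in> F \<and> \<gamma> \<in> \<Gamma>} = SL2_set"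
    using L haar_measure_SL2_haar unfolding lattice_SL2_def by blast
  have cnt: "countable \<Gamma>" using L unfolding lattice_SL2_def by (blast intro: discrete_imp_countable)
  let ?U = "emeasure haar (nbhd \<epsilon>)"
  have U: "?U > 0" by (rule emeasure_nbhd_pos[OF \<open>\<epsilon> > 0\<close>])
  have "\<exists>m. emeasure haar F < of_nat m * ?U"
  proof (rule ccontr)
    assume "\<not> ?thesis"
    then have le: "of_nat m * ?U \<le> emeasure haar F" for m by (simp add: not_less)
    have "?U \<le> emeasure haar F" using le[of 1] by simp
    then have fin: "?U < \<infinity>" using F(2) by (rule le_less_trans)
    obtain u where u: "?U = ennreal u" "u \<ge> 0" using fin by (cases ?U) auto
    obtain f where f: "emeasure haar F = ennreal f" "f \<ge> 0" using F(2) by (cases "emeasure haar F") auto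
    have "u > 0" using U u by simp
    then obtain m :: nat where "f < of_nat m * u" using ex_less_of_nat_mult by blast
    moreover have "ennreal (of_nat m * u) \<le> ennreal f"
      using le[of m] u f by (simp add: ennreal_mult ennreal_of_nat_eq_real_of_nat)
    ultimately show False using f by simp
  qed
  then obtain m where m: "emeasure haar F < of_nat m * ?U" by blast
  have "card G \<le> m" if G: "finite G" "packed \<Gamma> \<epsilon> G id" for G
  proof -
    define W where "W g = (\<lambda>u. u ** g) ` nbhd \<epsilon>" for g :: "real^2^2"
    have GS: "G \<subseteq> SL2_set" using G(2) by (simp add: packed_def)
    have W: "W g \<in> sets haar" "emeasure haar (W g) = ?U" if "g \<in> G" for g
      unfolding W_def using haar_right[OF _ nbhd_sets] GS that by auto
    have disj: "disjoint_family_on W G" unfolding disjoint_family_on_def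
    proof (intro ballI impI equals0I)
      fix g h A assume gh: "g \<in> G" "h \<in> G" "g \<noteq> h" and "A \<in> W g \<inter> W h"
      then obtain u u' where u: "u \<in> nbhd \<epsilon>" "u' \<in> nbhd \<epsilon>" "u ** g ** mat 1 = u' ** h" unfolding W_def by auto
      then show False using packedD(1)[OF G(2) gh(1,2), of u u' "mat 1"] gh \<Gamma>(2) by (simp add: nbhd_def)
    qed
    have "of_nat (card G) * ?U = (\<Sum>g\<in>G. emeasure haar (W g))" using W by simp
    also have "\<dots> = emeasure haar (\<Union>g\<in>G. W g)" using W G disj by (intro sum_emeasure) auto
    also have "\<dots> \<le> emeasure haar F"
    proof (rule emeasure_injective_le[OF cnt \<Gamma> F(1)])
      show "SL2_set \<subseteq> {f ** \<gamma> |f \<gamma>. f \<in> F \<and> \<gamma> \<in> \<Gamma>}" using F(3) by simp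
      show "(\<Union>g\<in>G. W g) \<in> sets haar" using W G by (intro sets.finite_UN) auto
      fix w w' \<gamma> assume "w \<in> (\<Union>g\<in>G. W g)" "w' \<in> (\<Union>g\<in>G. W g)" and \<gamma>: "\<gamma> \<in> \<Gamma>" "w ** \<gamma> = w'"
      then obtain g u h u' where "g \<in> G" "h \<in> G" "u \<in> nbhd \<epsilon>" "u' \<in> nbhd \<epsilon>" "w = u ** g" "w' = u' ** h"
        unfolding W_def by blast
      then show "\<gamma> = mat 1" using packedD(2)[OF G(2), of g h u u' \<gamma>] \<gamma> by (simp add: nbhd_def)
    qed
    finally have le: "of_nat (card G) * ?U \<le> emeasure haar F" .
    show "card G \<le> m"
    proof (rule ccontr)
      assume "\<not> ?thesis"
      then have "of_nat m * ?U \<le> of_nat (card G) * ?U" by (intro mult_right_mono) simp_all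
      then show False using le m by simp
    qed
  qed
  then show ?thesis by blast
qed

section \<open>Geodesics on translation surfaces\<close>

lemma
  assumes "is_chart X (U, \<phi>)"
  shows chart_open: "openin X U" "open (\<phi> ` U)"
    and chart_inj: "inj_on \<phi> U"
    and chart_continuous: "continuous_map (subtopology X U) euclidean \<phi>"
    and chart_open_image: "\<And>W. openin X W \<Longrightarrow> W \<subseteq> U \<Longrightarrow> open (\<phi> ` W)"
    and chart_open_preimage: "\<And>B. open B \<Longrightarrow> openin X {p \<in> U. \<phi> p \<in> B}"
    and chart_inv_continuous: "continuous_map (top_of_set (\<phi> ` U)) X (inv_into U \<phi>)"
proof -
  have U: "openin X U" "open (\<phi> ` U)" and hom: "homeomorphic_map (subtopology X U) (top_of_set (\<phi> ` U)) \<phi>"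
    using assms by (auto simp: is_chart_def)
  then show "openin X U" "open (\<phi> ` U)" by auto
  have UX: "U \<subseteq> topspace X" using U(1) openin_subset by blast
  have ts: "topspace (subtopology X U) = U" using UX by (auto)
  show inj: "inj_on \<phi> U" using homeomorphic_imp_injective_map[OF hom] ts by simp
  show cont: "continuous_map (subtopology X U) euclidean \<phi>"
    using homeomorphic_imp_continuous_map[OF hom] by (simp add: continuous_map_in_subtopology)
  show op: "open (\<phi> ` W)" if W: "openin X W" "W \<subseteq> U" for W
  proof -
    have "openin (subtopology X U) W" using W by (metis openin_subset_topspace_eq openin_open_subtopology U(1))
    then have "openin (top_of_set (\<phi> ` U)) (\<phi> ` W)"
      using homeomorphic_imp_open_map[OF hom] by (simp add: open_map_def)
    then show ?thesis using U(2) openin_open_eq by blast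
  qed
  show "openin X {p \<in> U. \<phi> p \<in> B}" if B: "open B" for B
  proof -
    have "openin (subtopology X U) {p \<in> topspace (subtopology X U). \<phi> p \<in> B}"
      using openin_continuous_map_preimage[OF cont] B by simp
    then show ?thesis using U(1) openin_trans_full ts by metis
  qed
  have "openin (top_of_set (\<phi> ` U)) {z \<in> \<phi> ` U. inv_into U \<phi> z \<in> W}" if W: "openin X W" for W
  proof -
    have "{z \<in> \<phi> ` U. inv_into U \<phi> z \<in> W} = \<phi> ` (U \<inter> W)"
      using inj by (auto simp: inv_into_f_f)
    moreover have "open (\<phi> ` (U \<inter> W))" using op[of "U \<inter> W"] W U(1) by auto
    ultimately show ?thesis using U(2) by (simp add: openin_open_eq image_mono)
  qed
  moreover have "inv_into U \<phi> z \<in> topspace X" if "z \<in> \<phi> ` U" for z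
    using inv_into_into[OF that] UX by blast
  ultimately show "continuous_map (top_of_set (\<phi> ` U)) X (inv_into U \<phi>)"
    by (simp add: continuous_map_def Pi_iff)
qed

lemma chart_inv_f [simp]: "is_chart X (U, \<phi>) \<Longrightarrow> p \<in> U \<Longrightarrow> inv_into U \<phi> (\<phi> p) = p"
  by (rule inv_into_f_f[OF chart_inj])

lemma chart_path_continuous:
  assumes "is_chart X (U, \<phi>)" "continuous_map (top_of_set T) X \<gamma>" "\<And>t. t \<in> T \<Longrightarrow> \<gamma> t \<in> U"
  shows "continuous_on T (\<lambda>t. \<phi> (\<gamma> t))"
proof -
  have "continuous_map (top_of_set T) (subtopology X U) \<gamma>"
    using assms by (auto simp: continuous_map_in_subtopology)
  then have "continuous_map (top_of_set T) euclidean (\<phi> \<circ> \<gamma>)"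
    using chart_continuous[OF assms(1)] continuous_map_compose by blast
  then show ?thesis by (simp add: comp_def)
qed

text \<open>The value of the form on the tangent vector, required in every atlas chart around the
  point. It is weaker than \<open>flat_line\<close> on a translation surface, survives rescaling of
  time, and suffices to integrate the form along a path.\<close>

definition has_velocity :: "'a surface \<Rightarrow> (real \<Rightarrow> 'a) \<Rightarrow> real \<Rightarrow> complex \<Rightarrow> bool" where
  "has_velocity M \<gamma> t v \<longleftrightarrow> (\<forall>V \<phi>. (V, \<phi>) \<in> atlas M \<longrightarrow> \<gamma> t \<in> V \<longrightarrow>
     (\<exists>d. ((\<lambda>s. \<phi> (\<gamma> s)) has_vector_derivative d) (at t) \<and> oneform M (V, \<phi>) (\<phi> (\<gamma> t)) * d = v))"

text \<open>The local condition of \<open>saddle_connection\<close> with its velocity made explicit,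
  the value 0 allowed.\<close>

definition flat_line :: "'a surface \<Rightarrow> (real \<Rightarrow> 'a) \<Rightarrow> real \<Rightarrow> complex \<Rightarrow> bool" where
  "flat_line M \<gamma> t v \<longleftrightarrow> (\<exists>U \<zeta> \<epsilon>. flat_coordinate M (U, \<zeta>) \<and> \<epsilon> > 0 \<and>
     (\<forall>s. \<bar>s - t\<bar> < \<epsilon> \<longrightarrow> \<gamma> s \<in> U \<and> \<zeta> (\<gamma> s) = \<zeta> (\<gamma> t) + of_real (s - t) * v))"

lemma flat_line_nearby:
  assumes "flat_line M \<gamma> t v"
  shows "\<exists>\<delta>>0. \<forall>s. \<bar>s - t\<bar> < \<delta> \<longrightarrow> flat_line M \<gamma> s v"
proof -
  obtain U \<zeta> \<epsilon> where H: "flat_coordinate M (U, \<zeta>)" "\<epsilon> > 0"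
     "\<And>s. \<bar>s - t\<bar> < \<epsilon> \<Longrightarrow> \<gamma> s \<in> U \<and> \<zeta> (\<gamma> s) = \<zeta> (\<gamma> t) + of_real (s - t) * v"
    using assms unfolding flat_line_def by blast
  have "flat_line M \<gamma> s v" if s: "\<bar>s - t\<bar> < \<epsilon>" for s
    unfolding flat_line_def
  proof (intro exI conjI allI impI)
    show "flat_coordinate M (U, \<zeta>)" "\<epsilon> - \<bar>s - t\<bar> > 0" using H s by auto
    fix r assume "\<bar>r - s\<bar> < \<epsilon> - \<bar>s - t\<bar>"
    then have r: "\<bar>r - t\<bar> < \<epsilon>" by linarith
    show "\<gamma> r \<in> U" using H(3)[OF r] by simp
    show "\<zeta> (\<gamma> r) = \<zeta> (\<gamma> s) + of_real (r - s) * v"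
      by (simp only: conjunct2[OF H(3)[OF r]] conjunct2[OF H(3)[OF s]]) (simp add: algebra_simps)
  qed
  then show ?thesis using H(2) by blast
qed

locale tsurface =
  fixes M :: "'a surface"
  assumes M: "translation_surface M"
begin

abbreviation X where "X \<equiv> surf M"
abbreviation Sing where "Sing \<equiv> singularities M"

lemma
  shows compact: "compact_space X" and connected: "connected_space X" and Hausdorff: "Hausdorff_space X"
    and charts: "c \<in> atlas M \<Longrightarrow> is_chart X c"
    and cover: "p \<in> topspace X \<Longrightarrow> \<exists>V \<phi>. (V, \<phi>) \<in> atlas M \<and> p \<in> V"
    and holo: "(V, \<phi>) \<in> atlas M \<Longrightarrow> oneform M (V, \<phi>) holomorphic_on \<phi> ` V"
    and transform: "(V, \<phi>) \<in> atlas M \<Longrightarrow> (W, \<psi>) \<in> atlas M \<Longrightarrow> p \<in> V \<inter> W \<Longrightarrow>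
      oneform M (V, \<phi>) (\<phi> p) = oneform M (W, \<psi>) (\<psi> p) * deriv (\<psi> \<circ> inv_into V \<phi>) (\<phi> p)"
    and zeros_proper: "oneform_zeros M \<noteq> topspace X"
    and marked: "finite (marked M)" "marked M \<subseteq> topspace X"
proof -
  have H: "compact_space X \<and> connected_space X \<and> Hausdorff_space X"
    "\<And>c. c \<in> atlas M \<Longrightarrow> is_chart X c" "(\<Union>(fst ` atlas M)) = topspace X"
    using M unfolding translation_surface_def closed_riemann_surface_def by blast+
  show "compact_space X" "connected_space X" "Hausdorff_space X" using H(1) by auto
  show "c \<in> atlas M \<Longrightarrow> is_chart X c" by (rule H(2))
  show "p \<in> topspace X \<Longrightarrow> \<exists>V \<phi>. (V, \<phi>) \<in> atlas M \<and> p \<in> V"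
  proof -
    assume "p \<in> topspace X"
    then obtain c where "c \<in> atlas M" "p \<in> fst c" using H(3) by blast
    then show ?thesis by (cases c) auto
  qed
  have O: "holomorphic_oneform (atlas M) (oneform M)" using M unfolding translation_surface_def by blast
  show "(V, \<phi>) \<in> atlas M \<Longrightarrow> oneform M (V, \<phi>) holomorphic_on \<phi> ` V"
    using O unfolding holomorphic_oneform_def by blast
  show "(V, \<phi>) \<in> atlas M \<Longrightarrow> (W, \<psi>) \<in> atlas M \<Longrightarrow> p \<in> V \<inter> W \<Longrightarrow>
      oneform M (V, \<phi>) (\<phi> p) = oneform M (W, \<psi>) (\<psi> p) * deriv (\<psi> \<circ> inv_into V \<phi>) (\<phi> p)"
    using O unfolding holomorphic_oneform_def by blast
  show "oneform_zeros M \<noteq> topspace X" "finite (marked M)" "marked M \<subseteq> topspace X"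
    using M unfolding translation_surface_def by auto
qed

lemma atlas_subset: "(V, \<phi>) \<in> atlas M \<Longrightarrow> V \<subseteq> topspace X"
  using chart_open(1)[OF charts] openin_subset by blast

text \<open>\<open>oneform_zeros\<close> asks for vanishing in some chart; the transformation rule
  carries it to every other.\<close>

lemma zero_iff:
  assumes "(V, \<phi>) \<in> atlas M" "p \<in> V"
  shows "p \<in> oneform_zeros M \<longleftrightarrow> oneform M (V, \<phi>) (\<phi> p) = 0"
proof
  assume "p \<in> oneform_zeros M"
  then obtain W \<psi> where W: "(W, \<psi>) \<in> atlas M" "p \<in> W" "oneform M (W, \<psi>) (\<psi> p) = 0"
    unfolding oneform_zeros_def by blast
  then show "oneform M (V, \<phi>) (\<phi> p) = 0" using transform[OF assms(1) W(1), of p] assms(2) by simp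
qed (use assms in \<open>auto simp: oneform_zeros_def\<close>)

lemma oneform_nonzero: "(V, \<phi>) \<in> atlas M \<Longrightarrow> p \<in> V \<Longrightarrow> p \<notin> Sing \<Longrightarrow> oneform M (V, \<phi>) (\<phi> p) \<noteq> 0"
  using zero_iff by (auto simp: singularities_def)

lemma Sing_subset: "Sing \<subseteq> topspace X"
  using marked atlas_subset by (fastforce simp: singularities_def oneform_zeros_def)

text \<open>The flat coordinate has derivative w \<noteq> 0 with respect to the chart, w being the
  value of the form, so the chart has derivative 1/w with respect to the flat coordinate. The path
  moves with velocity v/w in the chart, on which the form takes the value v.\<close>

lemma flat_line_imp_velocity:
  assumes "flat_line M \<gamma> t v"
  shows "has_velocity M \<gamma> t v"
  unfolding has_velocity_def
proof (intro allI impI)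
  fix V \<phi> assume V: "(V, \<phi>) \<in> atlas M" "\<gamma> t \<in> V"
  obtain U \<zeta> \<epsilon> where flat: "flat_coordinate M (U, \<zeta>)" and \<epsilon>: "\<epsilon> > 0"
    and line: "\<And>s. \<bar>s - t\<bar> < \<epsilon> \<Longrightarrow> \<gamma> s \<in> U \<and> \<zeta> (\<gamma> s) = \<zeta> (\<gamma> t) + of_real (s - t) * v"
    using assms unfolding flat_line_def by blast
  have cU: "is_chart X (U, \<zeta>)" and US: "U \<inter> Sing = {}"
    and der: "\<And>p. p \<in> U \<inter> V \<Longrightarrow> ((\<zeta> \<circ> inv_into V \<phi>) has_field_derivative oneform M (V, \<phi>) (\<phi> p)) (at (\<phi> p))"
    using flat V(1) unfolding flat_coordinate_def by auto
  have cV: "is_chart X (V, \<phi>)" by (rule charts[OF V(1)])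
  let ?p = "\<gamma> t"
  have p: "?p \<in> U" using line[of t] \<epsilon> by simp
  let ?w = "oneform M (V, \<phi>) (\<phi> ?p)"
  have w: "?w \<noteq> 0" using oneform_nonzero[OF V] p US by blast
  define B where "B = \<zeta> ` (U \<inter> V)"
  have B: "open B" unfolding B_def
    by (rule chart_open_image[OF cU]) (use chart_open(1)[OF cU] chart_open(1)[OF cV] in auto)
  have pB: "\<zeta> ?p \<in> B" using p V by (auto simp: B_def)
  define f where "f = (\<lambda>z. \<phi> (inv_into U \<zeta> z))"
  have "continuous_map (top_of_set B) X (inv_into U \<zeta>)"
    using chart_inv_continuous[OF cU] by (rule continuous_map_from_subtopology_mono) (auto simp: B_def)
  then have "continuous_on B f" unfolding f_def
    by (rule chart_path_continuous[OF cV]) (use cU in \<open>auto simp: B_def\<close>)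
  then have fc: "continuous (at (\<zeta> ?p)) f" using B pB continuous_on_eq_continuous_at by blast
  have fp: "f (\<zeta> ?p) = \<phi> ?p" using cU p by (simp add: f_def)
  have "DERIV f (\<zeta> ?p) :> inverse ?w"
  proof (rule has_field_derivative_inverse_basic[OF _ w fc B pB])
    show "((\<zeta> \<circ> inv_into V \<phi>) has_field_derivative ?w) (at (f (\<zeta> ?p)))"
      unfolding fp by (rule der) (use p V in blast)
    show "(\<zeta> \<circ> inv_into V \<phi>) (f z) = z" if "z \<in> B" for z
      using that cU cV by (auto simp: B_def f_def)
  qed
  define lin where "lin = (\<lambda>s. \<zeta> ?p + of_real (s - t) * v)"
  have lin: "(lin has_vector_derivative v) (at t)"
    unfolding lin_def by (auto intro!: derivative_eq_intros)
  have lint: "lin t = \<zeta> ?p" by (simp add: lin_def)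
  have "((f \<circ> lin) has_vector_derivative v * inverse ?w) (at t)"
    by (rule field_vector_diff_chain_at[OF lin]) (simp add: lint \<open>DERIV f (\<zeta> ?p) :> inverse ?w\<close>)
  then have "((\<lambda>s. \<phi> (\<gamma> s)) has_vector_derivative v * inverse ?w) (at t)"
  proof (rule has_vector_derivative_transform_within_open[of _ _ _ "ball t \<epsilon>"])
    fix s assume "s \<in> ball t \<epsilon>"
    then have s: "\<bar>s - t\<bar> < \<epsilon>" by (simp add: dist_real_def)
    have "lin s = \<zeta> (\<gamma> s)" "\<gamma> s \<in> U" using line[OF s] by (auto simp: lin_def)
    then show "(f \<circ> lin) s = \<phi> (\<gamma> s)" using cU by (simp add: f_def)
  qed (use \<epsilon> in auto)
  then show "\<exists>d. ((\<lambda>s. \<phi> (\<gamma> s)) has_vector_derivative d) (at t) \<and> ?w * d = v"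
    using w by (intro exI[of _ "v * inverse ?w"]) simp
qed

lemma oneform_velocity_eq:
  assumes "has_velocity M \<gamma> t v" "\<gamma> t \<in> topspace X"
  shows "oneform_velocity M \<gamma> t = v"
proof -
  define c where "c = (SOME c. c \<in> atlas M \<and> \<gamma> t \<in> fst c)"
  have "\<exists>c. c \<in> atlas M \<and> \<gamma> t \<in> fst c" using cover[OF assms(2)] by force
  then have "c \<in> atlas M \<and> \<gamma> t \<in> fst c" unfolding c_def by (rule someI_ex)
  moreover obtain V \<phi> where c: "c = (V, \<phi>)" by (cases c)
  ultimately obtain d where d: "((\<lambda>s. \<phi> (\<gamma> s)) has_vector_derivative d) (at t)" "oneform M (V, \<phi>) (\<phi> (\<gamma> t)) * d = v"
    using assms(1) unfolding has_velocity_def by force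
  have "vector_derivative (snd c \<circ> \<gamma>) (at t) = d"
    using vector_derivative_at[OF d(1)] by (simp add: c comp_def)
  then show ?thesis using d(2) unfolding oneform_velocity_def c_def[symmetric] by (simp add: c)
qed

lemma flat_line_in_topspace: "flat_line M \<gamma> t v \<Longrightarrow> \<gamma> t \<in> topspace X"
proof -
  assume "flat_line M \<gamma> t v"
  then obtain U \<zeta> \<epsilon> where H: "flat_coordinate M (U, \<zeta>)" "\<epsilon> > 0"
     "\<And>s. \<bar>s - t\<bar> < \<epsilon> \<Longrightarrow> \<gamma> s \<in> U \<and> \<zeta> (\<gamma> s) = \<zeta> (\<gamma> t) + of_real (s - t) * v"
    unfolding flat_line_def by blast
  have "\<gamma> t \<in> U" using H(3)[of t] H(2) by simp
  moreover have "is_chart X (U, \<zeta>)" using H(1) by (simp add: flat_coordinate_def)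
  then have "U \<subseteq> topspace X" by (rule chart_open(1)[THEN openin_subset])
  ultimately show ?thesis by blast
qed

lemma flat_line_unique: "flat_line M \<gamma> t v \<Longrightarrow> oneform_velocity M \<gamma> t = v"
  by (intro oneform_velocity_eq flat_line_imp_velocity flat_line_in_topspace)

text \<open>The hypothesis lets the velocity depend on t, but it is locally constant, hence constant
  on the connected open interval, and the integral over [0, 1] is its value.\<close>

lemma holonomy_eq:
  assumes "\<And>t. t \<in> {0<..<1} \<Longrightarrow> \<exists>v. flat_line M \<gamma> t v"
    and t0: "t0 \<in> {0<..<1}" "flat_line M \<gamma> t0 v"
  shows "holonomy M \<gamma> = v" "\<And>t. t \<in> {0<..<1} \<Longrightarrow> flat_line M \<gamma> t v"
proof -
  let ?o = "oneform_velocity M \<gamma>"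
  have fl: "flat_line M \<gamma> t (?o t)" if "t \<in> {0<..<1}" for t
    using assms(1)[OF that] flat_line_unique by metis
  have const: "?o t = v" if t: "t \<in> {0<..<1}" for t
  proof -
    have "?o t = ?o t0"
    proof (rule connected_local_const[of "{0<..<1::real}"])
      show "\<forall>a\<in>{0<..<1}. \<forall>\<^sub>F b in at a within {0<..<1}. ?o a = ?o b"
      proof
        fix a :: real assume a: "a \<in> {0<..<1}"
        obtain \<delta> where \<delta>: "\<delta> > 0" "\<And>s. \<bar>s - a\<bar> < \<delta> \<Longrightarrow> flat_line M \<gamma> s (?o a)"
          using flat_line_nearby[OF fl[OF a]] by blast
        have "?o a = ?o s" if "\<bar>s - a\<bar> < \<delta>" for s using flat_line_unique[OF \<delta>(2)[OF that]] ..
        then show "\<forall>\<^sub>F b in at a within {0<..<1}. ?o a = ?o b"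
          unfolding eventually_at dist_real_def using \<delta>(1) by blast
      qed
    qed (use t t0 in auto)
    then show ?thesis using flat_line_unique[OF t0(2)] by simp
  qed
  then show "\<And>t. t \<in> {0<..<1} \<Longrightarrow> flat_line M \<gamma> t v" using fl by metis
  have "((\<lambda>_. v) has_integral v) {0..1::real}" using has_integral_const_real[of v 0 1] by simp
  then have "(?o has_integral v) {0..1}"
    \<comment> \<open>At the endpoints, singularities in the case of interest, the velocity is not
      controlled; two points do not affect the integral.\<close>
    by (rule has_integral_spike_finite[where S = "{0, 1}", rotated 2]) (use const in auto)
  then show "holonomy M \<gamma> = v" unfolding holonomy_def by (rule integral_unique)
qed

lemma saddle_data:
  assumes "saddle_connection M \<gamma>"
  shows "holonomy M \<gamma> \<noteq> 0" "\<And>t. t \<in> {0<..<1} \<Longrightarrow> flat_line M \<gamma> t (holonomy M \<gamma>)"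
    "\<And>t. t \<in> {0<..<1} \<Longrightarrow> has_velocity M \<gamma> t (holonomy M \<gamma>)"
proof -
  have ex: "\<exists>v. flat_line M \<gamma> t v \<and> v \<noteq> 0" if "t \<in> {0<..<1}" for t
    using assms that unfolding saddle_connection_def flat_line_def by blast
  obtain v where v: "flat_line M \<gamma> (1/2) v" "v \<noteq> 0" using ex[of "1/2"] by auto
  have hv: "holonomy M \<gamma> = v" "\<And>t. t \<in> {0<..<1} \<Longrightarrow> flat_line M \<gamma> t v"
    by (rule holonomy_eq[of \<gamma> "1/2" v]; use ex v in auto)+
  then show "holonomy M \<gamma> \<noteq> 0" "\<And>t. t \<in> {0<..<1} \<Longrightarrow> flat_line M \<gamma> t (holonomy M \<gamma>)"
    using v by auto
  then show "\<And>t. t \<in> {0<..<1} \<Longrightarrow> has_velocity M \<gamma> t (holonomy M \<gamma>)"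
    using flat_line_imp_velocity by blast
qed

text \<open>By the chain rule the composite of h with the path has derivative v. The velocity is
  required only on the open interval and continuity extends the formula, so the path may start or
  end at a singularity.\<close>

lemma primitive_along_path:
  assumes V: "(V, \<phi>) \<in> atlas M" and "a \<le> b" and cont: "continuous_map (top_of_set {a..b}) X \<gamma>"
    and inV: "\<And>t. t \<in> {a..b} \<Longrightarrow> \<gamma> t \<in> V"
    and vel: "\<And>t. t \<in> {a<..<b} \<Longrightarrow> has_velocity M \<gamma> t v"
    and h: "\<And>t. t \<in> {a..b} \<Longrightarrow> (h has_field_derivative oneform M (V, \<phi>) (\<phi> (\<gamma> t))) (at (\<phi> (\<gamma> t)))"
  shows "h (\<phi> (\<gamma> b)) = h (\<phi> (\<gamma> a)) + of_real (b - a) * v"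
proof -
  let ?f = "\<lambda>t. h (\<phi> (\<gamma> t)) - of_real (t - a) * v"
  have cont1: "continuous_on {a..b} (\<lambda>t. \<phi> (\<gamma> t))"
    by (rule chart_path_continuous[OF charts[OF V] cont inV])
  have "continuous_on {a..b} (\<lambda>t. h (\<phi> (\<gamma> t)))"
  proof (rule continuous_on_compose2[OF _ cont1])
    show "continuous_on ((\<lambda>t. \<phi> (\<gamma> t)) ` {a..b}) h"
      by (rule DERIV_continuous_on[where D = "oneform M (V, \<phi>)"]) (use h has_field_derivative_at_within in blast)
  qed auto
  then have "continuous_on {a..b} ?f" by (intro continuous_intros)
  moreover have "(?f has_derivative (\<lambda>h. 0)) (at t within {a..b})" if t: "t \<in> {a..b} - {a, b}" for t
  proof -
    have t': "t \<in> {a<..<b}" using t by auto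
    obtain d where d: "((\<lambda>s. \<phi> (\<gamma> s)) has_vector_derivative d) (at t)" "oneform M (V, \<phi>) (\<phi> (\<gamma> t)) * d = v"
      using vel[OF t'] V inV[of t] t unfolding has_velocity_def by blast
    have "((h \<circ> (\<lambda>s. \<phi> (\<gamma> s))) has_vector_derivative d * oneform M (V, \<phi>) (\<phi> (\<gamma> t))) (at t)"
      by (rule field_vector_diff_chain_at[OF d(1)]) (use h t in auto)
    then have "((\<lambda>s. h (\<phi> (\<gamma> s))) has_vector_derivative v) (at t)"
      using d(2) by (simp add: comp_def mult.commute)
    then have "(?f has_vector_derivative v - v) (at t)"
      by (rule has_vector_derivative_diff) (auto intro!: derivative_eq_intros)
    then show ?thesis unfolding has_vector_derivative_def using has_derivative_at_withinI by fastforce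
  qed
  ultimately have "?f b = ?f a"
    using has_derivative_zero_unique_strong_interval[of "{a, b}" a b ?f "?f a" b] \<open>a \<le> b\<close> by simp
  then show ?thesis by (simp add: algebra_simps)
qed

section \<open>Unique continuation and finiteness of the singularities\<close>

lemma path_nbhd:
  fixes a b s :: real
  assumes "continuous_map (top_of_set {a..b}) X \<gamma>" "openin X W" "s \<in> {a<..<b}" "\<gamma> s \<in> W"
  shows "\<exists>\<delta>>0. \<forall>t. \<bar>t - s\<bar> < \<delta> \<longrightarrow> t \<in> {a<..<b} \<and> \<gamma> t \<in> W"
proof -
  have "openin (top_of_set {a..b}) {t \<in> {a..b}. \<gamma> t \<in> W}"
    using openin_continuous_map_preimage[OF assms(1,2)] by simp
  then obtain T where T: "open T" "{t \<in> {a..b}. \<gamma> t \<in> W} = {a..b} \<inter> T" unfolding openin_open by blast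
  have "s \<in> {t \<in> {a..b}. \<gamma> t \<in> W}" using assms(3,4) by auto
  then have "s \<in> T" unfolding T(2) by blast
  moreover have "open (T \<inter> {a<..<b})" using T(1) by (simp add: open_Int)
  ultimately obtain \<delta> where \<delta>: "\<delta> > 0" "ball s \<delta> \<subseteq> T \<inter> {a<..<b}"
    using assms(3) open_contains_ball by blast
  show ?thesis
  proof (intro exI conjI allI impI)
    fix t assume "\<bar>t - s\<bar> < \<delta>"
    then have "t \<in> T \<inter> {a<..<b}" using \<delta>(2) by (auto simp: dist_real_def abs_minus_commute)
    then have "t \<in> {a<..<b}" "t \<in> {t \<in> {a..b}. \<gamma> t \<in> W}" unfolding T(2) by auto
    then show "t \<in> {a<..<b}" "\<gamma> t \<in> W" by auto
  qed (rule \<delta>(1))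
qed

lemma local_primitive:
  assumes V: "(V, \<phi>) \<in> atlas M" and "p \<in> V" and W: "openin X W" "p \<in> W"
  shows "\<exists>r h. r > 0 \<and> ball (\<phi> p) r \<subseteq> \<phi> ` (V \<inter> W) \<and>
    (\<forall>z\<in>ball (\<phi> p) r. (h has_field_derivative oneform M (V, \<phi>) z) (at z))"
proof -
  have "open (\<phi> ` (V \<inter> W))"
    using chart_open_image[OF charts[OF V], of "V \<inter> W"] W chart_open(1)[OF charts[OF V]] by blast
  then obtain r where r: "r > 0" "ball (\<phi> p) r \<subseteq> \<phi> ` (V \<inter> W)"
    using open_contains_ball assms(2) W(2) by blast
  have "oneform M (V, \<phi>) holomorphic_on ball (\<phi> p) r"
    using holo[OF V] r(2) by (rule holomorphic_on_subset[OF _ order_trans]) blast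
  then obtain h where "\<And>z. z \<in> ball (\<phi> p) r \<Longrightarrow> (h has_field_derivative oneform M (V, \<phi>) z) (at z within ball (\<phi> p) r)"
    using holomorphic_convex_primitive'[OF convex_ball open_ball] by blast
  then have "\<forall>z\<in>ball (\<phi> p) r. (h has_field_derivative oneform M (V, \<phi>) z) (at z)"
    by (simp add: at_within_open[OF _ open_ball])
  then show ?thesis using r by blast
qed

text \<open>At a nonsingular point a primitive h of the form is locally injective, and h takes the
  same affine values along both paths.\<close>

lemma local_uniqueness:
  assumes \<alpha>: "continuous_map (top_of_set {a..b}) X \<alpha>" "\<And>t. t \<in> {a<..<b} \<Longrightarrow> has_velocity M \<alpha> t v"
    and \<beta>: "continuous_map (top_of_set {a..b}) X \<beta>" "\<And>t. t \<in> {a<..<b} \<Longrightarrow> has_velocity M \<beta> t v"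
    and s: "s \<in> {a<..<b}" "\<alpha> s = \<beta> s" "\<alpha> s \<notin> Sing"
  shows "\<exists>\<delta>>0. \<forall>t. \<bar>t - s\<bar> < \<delta> \<longrightarrow> \<alpha> t = \<beta> t"
proof -
  have "\<alpha> s \<in> topspace X" using \<alpha>(1) s(1) by (auto simp: continuous_map_def)
  then obtain V \<phi> where V: "(V, \<phi>) \<in> atlas M" "\<alpha> s \<in> V" using cover by blast
  have cV: "is_chart X (V, \<phi>)" by (rule charts[OF V(1)])
  obtain r h where r: "r > 0" "ball (\<phi> (\<alpha> s)) r \<subseteq> \<phi> ` (V \<inter> V)"
    and h: "\<And>z. z \<in> ball (\<phi> (\<alpha> s)) r \<Longrightarrow> (h has_field_derivative oneform M (V, \<phi>) z) (at z)"
    using local_primitive[OF V chart_open(1)[OF cV] V(2)] by blast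
  have h_holo: "h holomorphic_on ball (\<phi> (\<alpha> s)) r"
    unfolding holomorphic_on_open[OF open_ball] using h by blast
  have "deriv h (\<phi> (\<alpha> s)) \<noteq> 0"
    using DERIV_imp_deriv[OF h[of "\<phi> (\<alpha> s)"]] r(1) oneform_nonzero[OF V s(3)] by simp
  then obtain r' where r': "r' > 0" "ball (\<phi> (\<alpha> s)) r' \<subseteq> ball (\<phi> (\<alpha> s)) r" "inj_on h (ball (\<phi> (\<alpha> s)) r')"
    using has_complex_derivative_locally_injective[OF h_holo _ open_ball] r(1) by (metis centre_in_ball)
  define W where "W = {p \<in> V. \<phi> p \<in> ball (\<phi> (\<alpha> s)) r'}"
  have W: "openin X W" unfolding W_def by (rule chart_open_preimage[OF cV open_ball])
  have sW: "\<alpha> s \<in> W" using V(2) r'(1) by (simp add: W_def)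
  obtain \<delta>1 where \<delta>1: "\<delta>1 > 0" "\<And>t. \<bar>t - s\<bar> < \<delta>1 \<Longrightarrow> t \<in> {a<..<b} \<and> \<alpha> t \<in> W"
    using path_nbhd[OF \<alpha>(1) W s(1) sW] by blast
  obtain \<delta>2 where \<delta>2: "\<delta>2 > 0" "\<And>t. \<bar>t - s\<bar> < \<delta>2 \<Longrightarrow> t \<in> {a<..<b} \<and> \<beta> t \<in> W"
    using path_nbhd[OF \<beta>(1) W s(1)] sW s(2) by auto
  have along: "h (\<phi> (\<gamma> t)) = h (\<phi> (\<alpha> s)) + of_real (t - s) * v"
    if g: "continuous_map (top_of_set {a..b}) X \<gamma>" "\<And>t. t \<in> {a<..<b} \<Longrightarrow> has_velocity M \<gamma> t v" "\<gamma> s = \<alpha> s"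
      and near: "\<And>t. \<bar>t - s\<bar> < \<delta> \<Longrightarrow> t \<in> {a<..<b} \<and> \<gamma> t \<in> W" and t: "\<bar>t - s\<bar> < \<delta>" for \<gamma> \<delta> t
  proof -
    have seg: "h (\<phi> (\<gamma> y)) = h (\<phi> (\<gamma> x)) + of_real (y - x) * v"
      if xy: "x \<le> y" "\<And>u. u \<in> {x..y} \<Longrightarrow> \<bar>u - s\<bar> < \<delta>" for x y
    proof (rule primitive_along_path[OF V(1) xy(1)])
      have u: "u \<in> {a<..<b}" "\<gamma> u \<in> W" if "u \<in> {x..y}" for u using near xy(2) that by blast+
      then have "{x..y} \<subseteq> {a..b}" by fastforce
      then show "continuous_map (top_of_set {x..y}) X \<gamma>" by (rule continuous_map_from_subtopology_mono[OF g(1)])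
      show "\<gamma> u \<in> V" if "u \<in> {x..y}" for u using u(2)[OF that] by (simp add: W_def)
      show "has_velocity M \<gamma> u v" if "u \<in> {x<..<y}" for u using that by (intro g(2) u) simp
      show "(h has_field_derivative oneform M (V, \<phi>) (\<phi> (\<gamma> u))) (at (\<phi> (\<gamma> u)))" if "u \<in> {x..y}" for u
        using u(2)[OF that] r'(2) by (intro h) (auto simp: W_def)
    qed
    show ?thesis
    proof (cases "s \<le> t")
      case True
      have "\<bar>u - s\<bar> < \<delta>" if "u \<in> {s..t}" for u using that t by auto
      from seg[OF True this] show ?thesis by (simp add: g(3))
    next
      case False
      then have "t \<le> s" by simp
      have "\<bar>u - s\<bar> < \<delta>" if "u \<in> {t..s}" for u using that t by auto
      from seg[OF \<open>t \<le> s\<close> this] show ?thesis by (simp add: g(3) algebra_simps)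
    qed
  qed
  have "\<alpha> t = \<beta> t" if t: "\<bar>t - s\<bar> < min \<delta>1 \<delta>2" for t
  proof -
    have t12: "\<bar>t - s\<bar> < \<delta>1" "\<bar>t - s\<bar> < \<delta>2" using t by auto
    have "h (\<phi> (\<alpha> t)) = h (\<phi> (\<beta> t))"
      using along[OF \<alpha> refl \<delta>1(2) t12(1)] along[OF \<beta> s(2)[symmetric] \<delta>2(2) t12(2)] by simp
    then have "\<phi> (\<alpha> t) = \<phi> (\<beta> t)"
      using r'(3) \<delta>1(2)[OF t12(1)] \<delta>2(2)[OF t12(2)] by (auto simp: W_def dest: inj_onD)
    then show ?thesis
      using chart_inj[OF cV] \<delta>1(2)[OF t12(1)] \<delta>2(2)[OF t12(2)] by (auto simp: W_def dest: inj_onD)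
  qed
  then show ?thesis using \<delta>1(1) \<delta>2(1) by (intro exI[of _ "min \<delta>1 \<delta>2"]) auto
qed

text \<open>On the open interval the coincidence set is open by \<open>local_uniqueness\<close> and
  closed by the Hausdorff property; the endpoint follows by closure. Avoidance of singularities is
  asked of \<alpha> alone, since it is applied only where the paths agree.\<close>

lemma unique_continuation:
  assumes \<alpha>: "continuous_map (top_of_set {0..1}) X \<alpha>" "\<And>t. t \<in> {0<..<1} \<Longrightarrow> has_velocity M \<alpha> t v"
    "\<And>t. t \<in> {0<..<1} \<Longrightarrow> \<alpha> t \<notin> Sing"
    and \<beta>: "continuous_map (top_of_set {0..1}) X \<beta>" "\<And>t. t \<in> {0<..<1} \<Longrightarrow> has_velocity M \<beta> t v"
    and s: "s \<in> {0<..<1}" "\<alpha> s = \<beta> s"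
  shows "\<alpha> 1 = \<beta> 1"
proof -
  let ?E = "{t \<in> {0..1::real}. \<alpha> t = \<beta> t}"
  have "closedin (top_of_set {0..1}) {t \<in> topspace (top_of_set {0..1}). \<alpha> t = \<beta> t}"
    by (rule closedin_continuous_maps_eq[OF Hausdorff \<alpha>(1) \<beta>(1)])
  then have E: "closed ?E" using closedin_closed_trans[of "{0..1::real}" ?E] by simp
  let ?f = "\<lambda>t. \<alpha> t = \<beta> t"
  have "?f t = ?f s" if t: "t \<in> {0<..<1}" for t
  proof (rule connected_local_const[of "{0<..<1::real}"])
    show "\<forall>a\<in>{0<..<1}. \<forall>\<^sub>F b in at a within {0<..<1}. ?f a = ?f b"
    proof
      fix a :: real assume a: "a \<in> {0<..<1}"
      have "\<exists>\<delta>>0. \<forall>t. t \<in> {0<..<1} \<longrightarrow> \<bar>t - a\<bar> < \<delta> \<longrightarrow> ?f a = ?f t"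
      proof (cases "?f a")
        case True
        then obtain \<delta> where "\<delta> > 0" "\<forall>t. \<bar>t - a\<bar> < \<delta> \<longrightarrow> \<alpha> t = \<beta> t"
          using local_uniqueness[OF \<alpha>(1,2) \<beta>(1,2) a True \<alpha>(3)[OF a]] by blast
        then show ?thesis using True by blast
      next
        case False
        then have "a \<in> - ?E" "open (- ?E)" using E by auto
        then obtain \<delta> where \<delta>: "\<delta> > 0" "ball a \<delta> \<subseteq> - ?E" using open_contains_ball by blast
        have "\<not> ?f t" if "t \<in> {0<..<1}" "\<bar>t - a\<bar> < \<delta>" for t
        proof -
          have "t \<in> ball a \<delta>" using that(2) by (simp add: dist_real_def abs_minus_commute)
          then have "t \<notin> ?E" using \<delta>(2) by blast
          then show ?thesis using that(1) by simp
        qed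
        then show ?thesis using False \<delta>(1) by blast
      qed
      then show "\<forall>\<^sub>F b in at a within {0<..<1}. ?f a = ?f b"
        unfolding eventually_at dist_real_def by blast
    qed
  qed (use t s in auto)
  then have "{0<..<1} \<subseteq> ?E" using s(2) by auto
  then have "closure {0<..<1::real} \<subseteq> ?E" using E by (rule closure_minimal)
  moreover have "1 \<in> closure {0<..<1::real}" by simp
  ultimately show ?thesis by blast
qed

text \<open>The identity theorem for the holomorphic local expression of the form, on a disk around
  the point.\<close>

lemma oneform_zeros_isolated_or_locally_all:
  assumes V: "(V, \<phi>) \<in> atlas M" "p \<in> V"
  shows "\<exists>W. openin X W \<and> p \<in> W \<and> (W \<subseteq> oneform_zeros M \<or> W \<inter> oneform_zeros M \<subseteq> {p})"
proof -
  have cV: "is_chart X (V, \<phi>)" by (rule charts[OF V(1)])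
  let ?w = "oneform M (V, \<phi>)"
  obtain r where r: "r > 0" "ball (\<phi> p) r \<subseteq> \<phi> ` V"
    using chart_open(2)[OF cV] V(2) open_contains_ball by blast
  have w: "?w holomorphic_on ball (\<phi> p) r" using holo[OF V(1)] r(2) by (rule holomorphic_on_subset)
  have "\<exists>r'>0. (\<forall>z\<in>ball (\<phi> p) r'. ?w z = 0) \<or> (\<forall>z\<in>ball (\<phi> p) r' - {\<phi> p}. ?w z \<noteq> 0)"
  proof (cases "\<forall>z\<in>ball (\<phi> p) r. ?w z = 0")
    case True
    then show ?thesis using r(1) by blast
  next
    case False
    then obtain \<beta> where \<beta>: "\<beta> \<in> ball (\<phi> p) r" "?w \<beta> \<noteq> 0" by blast
    have c: "\<phi> p \<in> ball (\<phi> p) r" using r(1) by simp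
    show ?thesis
    proof (cases "?w (\<phi> p) = 0")
      case True
      obtain r' where "0 < r'" "ball (\<phi> p) r' \<subseteq> ball (\<phi> p) r" "\<And>z. z \<in> ball (\<phi> p) r' - {\<phi> p} \<Longrightarrow> ?w z \<noteq> 0"
        using isolated_zeros[OF w open_ball connected_ball c True \<beta>] by blast
      then show ?thesis by blast
    next
      case False
      have "continuous (at (\<phi> p)) ?w"
        using holomorphic_on_imp_continuous_on[OF w] c continuous_on_eq_continuous_at[OF open_ball] by blast
      then obtain e where "e > 0" "\<And>z. dist (\<phi> p) z < e \<Longrightarrow> ?w z \<noteq> 0"
        using continuous_at_avoid[of "\<phi> p" ?w 0] False by blast
      then show ?thesis by (intro exI[of _ e]) auto
    qed
  qed
  then obtain r' where r': "r' > 0" "(\<forall>z\<in>ball (\<phi> p) r'. ?w z = 0) \<or> (\<forall>z\<in>ball (\<phi> p) r' - {\<phi> p}. ?w z \<noteq> 0)" by blast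
  define W where "W = {q \<in> V. \<phi> q \<in> ball (\<phi> p) r'}"
  have "openin X W" unfolding W_def by (rule chart_open_preimage[OF cV open_ball])
  moreover have "p \<in> W" using V(2) r'(1) by (simp add: W_def)
  moreover have "W \<subseteq> oneform_zeros M \<or> W \<inter> oneform_zeros M \<subseteq> {p}"
    using r'(2)
  proof
    assume z: "\<forall>z\<in>ball (\<phi> p) r'. ?w z = 0"
    have "q \<in> oneform_zeros M" if "q \<in> W" for q
      using zero_iff[OF V(1), of q] z that by (simp add: W_def)
    then show ?thesis by blast
  next
    assume z: "\<forall>z\<in>ball (\<phi> p) r' - {\<phi> p}. ?w z \<noteq> 0"
    have "q = p" if q: "q \<in> W" "q \<in> oneform_zeros M" for q
    proof (rule ccontr)
      assume "q \<noteq> p"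
      have qV: "q \<in> V" "\<phi> q \<in> ball (\<phi> p) r'" using q(1) by (auto simp: W_def)
      have "\<phi> q \<noteq> \<phi> p" using chart_inj[OF cV] qV(1) V(2) \<open>q \<noteq> p\<close> by (auto dest: inj_onD)
      then show False using z qV zero_iff[OF V(1) qV(1)] q(2) by blast
    qed
    then show ?thesis by blast
  qed
  ultimately show ?thesis by blast
qed

lemma no_open_points: "\<not> openin X {p}"
proof
  assume p: "openin X {p}"
  then have "p \<in> topspace X" using openin_subset by blast
  then obtain V \<phi> where V: "(V, \<phi>) \<in> atlas M" "p \<in> V" using cover by blast
  have "open (\<phi> ` {p})" by (rule chart_open_image[OF charts[OF V(1)] p]) (use V in simp)
  then show False using not_open_singleton[of "\<phi> p"] by simp
qed

text \<open>Points near which the form vanishes identically (A) and points near which it has no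
  other zero (B) partition the surface into two open sets. Connectedness and the nonvanishing of the
  form leave only B, and compactness then leaves finitely many zeros.\<close>

lemma finite_Sing: "finite Sing"
proof -
  let ?Z = "oneform_zeros M"
  define A where "A = {p \<in> topspace X. \<exists>W. openin X W \<and> p \<in> W \<and> W \<subseteq> ?Z}"
  define B where "B = {p \<in> topspace X. \<exists>W. openin X W \<and> p \<in> W \<and> W \<inter> ?Z \<subseteq> {p}}"
  have "openin X A"
  proof (subst openin_subopen, intro ballI)
    fix p assume "p \<in> A"
    then obtain W where W: "openin X W" "p \<in> W" "W \<subseteq> ?Z" by (auto simp: A_def)
    then have "W \<subseteq> A" using openin_subset[OF W(1)] by (auto simp: A_def)
    then show "\<exists>T. openin X T \<and> p \<in> T \<and> T \<subseteq> A" using W by blast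
  qed
  moreover have "openin X B"
  proof (subst openin_subopen, intro ballI)
    fix p assume "p \<in> B"
    then obtain W where W: "openin X W" "p \<in> W" "W \<inter> ?Z \<subseteq> {p}" "p \<in> topspace X" by (auto simp: B_def)
    have "closedin X {p}" using closedin_Hausdorff_singleton Hausdorff W(4) by (simp add: closedin_Hausdorff_sing_eq)
    then have W': "openin X (W - {p})" using W(1) by (rule openin_diff[rotated])
    have "q \<in> B" if "q \<in> W" for q
    proof (cases "q = p")
      case False
      then have "q \<in> W - {p}" "(W - {p}) \<inter> ?Z \<subseteq> {q}" using that W(3) by auto
      then show ?thesis using W' openin_subset[OF W(1)] that unfolding B_def by blast
    qed (simp add: \<open>p \<in> B\<close>)
    then show "\<exists>T. openin X T \<and> p \<in> T \<and> T \<subseteq> B" using W by blast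
  qed
  moreover have cov: "topspace X \<subseteq> A \<union> B"
  proof
    fix p assume p: "p \<in> topspace X"
    then obtain V \<phi> where "(V, \<phi>) \<in> atlas M" "p \<in> V" using cover by blast
    from oneform_zeros_isolated_or_locally_all[OF this] show "p \<in> A \<union> B"
      using p unfolding A_def B_def by blast
  qed
  \<comment> \<open>At a common point the two neighbourhoods would intersect in that point alone,
    but a surface has no open points.\<close>
  moreover have "A \<inter> B = {}"
  proof (rule ccontr)
    assume "A \<inter> B \<noteq> {}"
    then obtain p W W' where H: "openin X W" "p \<in> W" "W \<subseteq> ?Z" "openin X W'" "p \<in> W'" "W' \<inter> ?Z \<subseteq> {p}"
      unfolding A_def B_def by blast
    then have "W \<inter> W' = {p}" by blast
    then show False using no_open_points[of p] H openin_Int by metis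
  qed
  ultimately have "A = {} \<or> B = {}"
    using connected unfolding connected_space_def by blast
  moreover have "B \<noteq> {}"
  proof
    assume "B = {}"
    then have "topspace X \<subseteq> ?Z" using cov by (auto simp: A_def)
    moreover have "?Z \<subseteq> topspace X" using Sing_subset by (auto simp: singularities_def)
    ultimately show False using zeros_proper by blast
  qed
  ultimately have "topspace X \<subseteq> B" using cov by blast
  then have "\<exists>W. p \<in> topspace X \<longrightarrow> openin X W \<and> p \<in> W \<and> W \<inter> ?Z \<subseteq> {p}" for p unfolding B_def by blast
  then obtain W where W: "\<And>p. p \<in> topspace X \<longrightarrow> openin X (W p) \<and> p \<in> W p \<and> W p \<inter> ?Z \<subseteq> {p}" by metis
  have "compactin X (topspace X)" using compact by (simp add: compact_space_def)
  then have "\<exists>\<F>. finite \<F> \<and> \<F> \<subseteq> W ` topspace X \<and> topspace X \<subseteq> \<Union>\<F>"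
  proof (rule compactinD)
    show "openin X U" if "U \<in> W ` topspace X" for U using W that by blast
    show "topspace X \<subseteq> \<Union>(W ` topspace X)" using W by blast
  qed
  then obtain \<F> where F: "finite \<F>" "\<F> \<subseteq> W ` topspace X" "topspace X \<subseteq> \<Union>\<F>" by blast
  obtain P where P: "finite P" "P \<subseteq> topspace X" "\<F> = W ` P" using finite_subset_image[OF F(1,2)] by blast
  have "?Z \<subseteq> P"
  proof
    fix q assume q: "q \<in> ?Z"
    then have "q \<in> topspace X" using Sing_subset by (auto simp: singularities_def)
    then obtain p where "p \<in> P" "q \<in> W p" using F(3) P(3) by blast
    then show "q \<in> P" using W P(2) q by blast
  qed
  then show ?thesis using P(1) marked(1) finite_subset by (auto simp: singularities_def)
qed

lemma isolating_nbhd: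
  assumes "p \<in> topspace X"
  shows "\<exists>W. openin X W \<and> p \<in> W \<and> W \<inter> Sing \<subseteq> {p}"
proof (intro exI conjI)
  have "closedin X (Sing - {p})"
    using finite_Sing Sing_subset Hausdorff_imp_t1_space[OF Hausdorff] t1_space_closedin_finite by blast
  then show "openin X (topspace X - (Sing - {p}))" by blast
qed (use assms in auto)

end

section \<open>Saddle connections in a fixed direction\<close>

lemma complex_to_vec_nth [simp]: "complex_to_vec z $ 1 = Re z" "complex_to_vec z $ 2 = Im z"
  by (simp_all add: complex_to_vec_def)

lemma vec_to_complex_inverse [simp]: "vec_to_complex (complex_to_vec z) = z" "complex_to_vec (vec_to_complex x) = x"
  by (simp_all add: vec_to_complex_def vec_eq_2)

lemma norm_complex_to_vec [simp]: "norm (complex_to_vec z) = cmod z"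
  by (rule power2_eq_imp_eq) (simp_all add: norm_vec_2 cmod_power2)

context tsurface begin

lemma saddle_path:
  assumes "saddle_connection M \<gamma>"
  shows "continuous_map (top_of_set {0..1}) X \<gamma>" "\<gamma> 0 \<in> Sing" "\<gamma> 1 \<in> Sing" "\<And>t. t \<in> {0<..<1} \<Longrightarrow> \<gamma> t \<notin> Sing"
  using assms by (auto simp: saddle_connection_def pathin_def)

text \<open>The primitive \<open>h\<close> of \<open>\<omega>\<close> grows linearly along a saddle connection, so a saddle connection
  starting at \<open>p\<close> leaves the disk, and is determined near \<open>p\<close> by the finitely many points
  where \<open>h\<close> takes a prescribed value.\<close>

lemma saddle_departure:
  assumes p: "p \<in> Sing"
  shows "\<exists>m>0. \<exists>Q. (\<forall>e. finite (Q e)) \<and> (\<forall>\<gamma>. saddle_connection M \<gamma> \<longrightarrow> \<gamma> 0 = p \<longrightarrow>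
    m \<le> cmod (holonomy M \<gamma>) \<and> \<gamma> (m / 2 / cmod (holonomy M \<gamma>)) \<in> Q (sgn (holonomy M \<gamma>)))"
proof -
  have pX: "p \<in> topspace X" using p Sing_subset by blast
  obtain W where W: "openin X W" "p \<in> W" "W \<inter> Sing \<subseteq> {p}" using isolating_nbhd[OF pX] by blast
  obtain V \<phi> where V: "(V, \<phi>) \<in> atlas M" "p \<in> V" using cover[OF pX] by blast
  have cV: "is_chart X (V, \<phi>)" by (rule charts[OF V(1)])
  define z0 where "z0 = \<phi> p"
  let ?w = "oneform M (V, \<phi>)"
  obtain R h where R: "R > 0" "ball z0 R \<subseteq> \<phi> ` (V \<inter> W)"
    and h: "\<And>z. z \<in> ball z0 R \<Longrightarrow> (h has_field_derivative ?w z) (at z)"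
    using local_primitive[OF V W(1,2)] unfolding z0_def by blast
  have ball_W: "q \<in> W" if "q \<in> V" "\<phi> q \<in> ball z0 R" for q
  proof -
    obtain q' where "q' \<in> V \<inter> W" "\<phi> q = \<phi> q'" using R(2) \<open>\<phi> q \<in> ball z0 R\<close> by blast
    then show ?thesis using inj_onD[OF chart_inj[OF cV], of q q'] \<open>q \<in> V\<close> by simp
  qed
  have h_holo: "h holomorphic_on ball z0 R" unfolding holomorphic_on_open[OF open_ball] using h by blast
  have z0R: "z0 \<in> ball z0 R" using R(1) by simp
  \<comment> \<open>A constant h would make the form vanish at points of the disk other than p,
    which are not singular.\<close>
  have "\<exists>\<beta>\<in>ball z0 R. h \<beta> \<noteq> h z0"
  proof (rule ccontr)
    assume "\<not> ?thesis"
    then have const: "\<And>z. z \<in> ball z0 R \<Longrightarrow> h z = h z0" by blast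
    define z1 where "z1 = z0 + of_real (R / 2)"
    have z1: "z1 \<in> ball z0 R" "z1 \<noteq> z0" using R(1) by (simp_all add: z1_def dist_norm)
    have "((\<lambda>_. h z0) has_field_derivative ?w z1) (at z1)"
      by (rule has_field_derivative_transform_within_open[OF h[OF z1(1)] open_ball z1(1) const])
    then have "?w z1 = 0" using DERIV_unique DERIV_const by blast
    moreover obtain q where q: "q \<in> V" "q \<in> W" "z1 = \<phi> q" using z1(1) R(2) by blast
    moreover have "q \<notin> Sing" using W(3) q z1(2) by (auto simp: z0_def)
    ultimately show False using oneform_nonzero[OF V(1), of q] by simp
  qed
  then obtain \<beta> where \<beta>: "\<beta> \<in> ball z0 R" "h \<beta> - h z0 \<noteq> 0" by auto
  have hol: "(\<lambda>z. h z - h z0) holomorphic_on ball z0 R" by (intro holomorphic_intros h_holo)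
  \<comment> \<open>If p is a zero of the form, h is not injective near p; what remains is that the
    value h z0 is taken in isolation.\<close>
  obtain r0 where r0: "0 < r0" "ball z0 r0 \<subseteq> ball z0 R" "\<And>z. z \<in> ball z0 r0 - {z0} \<Longrightarrow> h z - h z0 \<noteq> 0"
    by (rule isolated_zeros[of "\<lambda>z. h z - h z0" "ball z0 R" z0 \<beta>]) (use hol z0R \<beta> in auto)
  define r where "r = r0 / 2"
  have r: "r > 0" "cball z0 r \<subseteq> ball z0 r0" using r0(1) by (auto simp: r_def)
  then have rR: "cball z0 r \<subseteq> ball z0 R" using r0(2) by blast
  have "continuous_on (sphere z0 r) (\<lambda>z. cmod (h z - h z0))"
  proof (intro continuous_intros)
    have "sphere z0 r \<subseteq> ball z0 R" using rR by auto
    then show "continuous_on (sphere z0 r) h"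
      using continuous_on_subset[OF holomorphic_on_imp_continuous_on[OF h_holo]] by blast
  qed
  moreover have "sphere z0 r \<noteq> {}" using r(1) by simp
  ultimately obtain z1 where z1: "z1 \<in> sphere z0 r" "\<And>z. z \<in> sphere z0 r \<Longrightarrow> cmod (h z1 - h z0) \<le> cmod (h z - h z0)"
    using continuous_attains_inf[OF compact_sphere] by blast
  \<comment> \<open>The least change of h needed to reach the circle of radius r, hence a lower
    bound for the length of a path from p out of the disk with constant velocity.\<close>
  define m where "m = cmod (h z1 - h z0)"
  have "z1 \<in> ball z0 r0 - {z0}" using z1(1) r by auto
  then have m: "m > 0" using r0(3) by (simp add: m_def)
  \<comment> \<open>The possible positions after length m/2 in direction e: by then h has grown by
    (m/2) e, and the path is still inside the disk.\<close>
  define Q where "Q e = inv_into V \<phi> ` {z \<in> cball z0 r. h z - (h z0 + of_real (m / 2) * e) = 0}" for e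
  have "finite (Q e)" for e
  proof -
    have "\<not> (\<lambda>z. h z - (h z0 + of_real (m / 2) * e)) constant_on ball z0 R"
      using \<beta> z0R unfolding constant_on_def by (metis diff_add_cancel diff_self)
    then have "finite {z \<in> cball z0 r. h z - (h z0 + of_real (m / 2) * e) = 0}"
      by (intro holomorphic_compact_finite_zeros[OF _ open_ball connected_ball compact_cball rR] holomorphic_intros h_holo)
    then show ?thesis unfolding Q_def by (rule finite_imageI)
  qed
  moreover have "m \<le> cmod (holonomy M \<gamma>) \<and> \<gamma> (m / 2 / cmod (holonomy M \<gamma>)) \<in> Q (sgn (holonomy M \<gamma>))"
    if \<gamma>: "saddle_connection M \<gamma>" "\<gamma> 0 = p" for \<gamma>
  proof -
    define v where "v = holonomy M \<gamma>"
    have v0: "v \<noteq> 0" using saddle_data(1)[OF \<gamma>(1)] by (simp add: v_def)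
    note path = saddle_path[OF \<gamma>(1)]
    have vel: "\<And>t. t \<in> {0<..<1} \<Longrightarrow> has_velocity M \<gamma> t v" using saddle_data(3)[OF \<gamma>(1)] by (simp add: v_def)
    define O' where "O' = {q \<in> V. \<phi> q \<in> ball z0 r}"
    define C where "C = {q \<in> V. \<phi> q \<in> cball z0 r}"
    have O: "openin X O'" unfolding O'_def by (rule chart_open_preimage[OF cV open_ball])
    have C: "closedin X C"
    proof -
      have sub: "cball z0 r \<subseteq> \<phi> ` V" using rR R(2) by blast
      have "C = inv_into V \<phi> ` cball z0 r"
      proof (intro equalityI subsetI)
        fix q assume "q \<in> C"
        then have "q \<in> V" "\<phi> q \<in> cball z0 r" by (auto simp: C_def)
        then show "q \<in> inv_into V \<phi> ` cball z0 r" using chart_inv_f[OF cV] by (intro image_eqI[of _ _ "\<phi> q"]) simp_all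
      next
        fix q assume "q \<in> inv_into V \<phi> ` cball z0 r"
        then obtain z where z: "z \<in> cball z0 r" "q = inv_into V \<phi> z" by blast
        then have "z \<in> \<phi> ` V" using sub by blast
        then show "q \<in> C" using z by (simp add: C_def inv_into_into f_inv_into_f)
      qed
      moreover have "compactin X (inv_into V \<phi> ` cball z0 r)"
        by (rule image_compactin[OF _ chart_inv_continuous[OF cV]]) (use sub in \<open>simp add: compactin_subtopology\<close>)
      ultimately show ?thesis using compactin_imp_closedin[OF Hausdorff] by simp
    qed
    have sub01: "continuous_map (top_of_set {0..t}) X \<gamma>" if "t \<le> 1" for t
      by (rule continuous_map_from_subtopology_mono[OF path(1)]) (use that in auto)
    have grow: "h (\<phi> (\<gamma> t)) = h z0 + of_real t * v"
      if t: "0 \<le> t" "t \<le> 1" "\<And>s. s \<in> {0..t} \<Longrightarrow> \<gamma> s \<in> C" for t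
    proof -
      have inC: "\<gamma> s \<in> V" "\<phi> (\<gamma> s) \<in> ball z0 R" if "s \<in> {0..t}" for s
        using t(3)[OF that] rR by (auto simp: C_def)
      have "h (\<phi> (\<gamma> t)) = h (\<phi> (\<gamma> 0)) + of_real (t - 0) * v"
      proof (rule primitive_along_path[OF V(1) t(1) sub01[OF t(2)] inC(1)])
        show "has_velocity M \<gamma> s v" if "s \<in> {0<..<t}" for s using that t(2) by (intro vel) auto
        show "(h has_field_derivative ?w (\<phi> (\<gamma> s))) (at (\<phi> (\<gamma> s)))" if "s \<in> {0..t}" for s
          by (rule h[OF inC(2)[OF that]])
      qed
      then show ?thesis by (simp add: \<gamma>(2) z0_def)
    qed
    have OC: "O' \<subseteq> C" by (auto simp: O'_def C_def)
    \<comment> \<open>At the first exit time s the path lies on the circle, where h differs from h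
      z0 by at least m; but the difference has modulus s |v|.\<close>
    have stay: "\<gamma> t \<in> O'" if t1: "0 \<le> t1" "t1 \<le> 1" "t1 * cmod v < m" and t: "t \<in> {0..t1}" for t t1
    proof (rule ccontr)
      assume "\<gamma> t \<notin> O'"
      define D where "D = {s \<in> {0..t1}. \<gamma> s \<notin> O'}"
      have "D \<noteq> {}" using t \<open>\<gamma> t \<notin> O'\<close> by (auto simp: D_def)
      have "closed D"
      proof -
        have "openin (top_of_set {0..t1}) {s \<in> {0..t1}. \<gamma> s \<in> O'}"
          using openin_continuous_map_preimage[OF sub01[OF t1(2)] O] by simp
        moreover have "D = {0..t1} - {s \<in> {0..t1}. \<gamma> s \<in> O'}" by (auto simp: D_def)
        ultimately have "closedin (top_of_set {0..t1}) D" by (metis closedin_diff closedin_topspace topspace_euclidean_subtopology)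
        then show ?thesis by (rule closedin_closed_trans) simp
      qed
      have bdd: "bdd_below D" by (rule bdd_belowI[of _ 0]) (simp add: D_def)
      define s where "s = Inf D"
      have sD: "s \<in> D" unfolding s_def by (rule closed_contains_Inf[OF \<open>D \<noteq> {}\<close> bdd \<open>closed D\<close>])
      then have s: "0 \<le> s" "s \<le> t1" "\<gamma> s \<notin> O'" by (auto simp: D_def)
      have before: "\<gamma> u \<in> O'" if "u \<in> {0..<s}" for u
      proof (rule ccontr)
        assume "\<gamma> u \<notin> O'"
        then have "u \<in> D" using that s by (auto simp: D_def)
        then have "s \<le> u" unfolding s_def by (rule cInf_lower[OF _ bdd])
        then show False using that by simp
      qed
      have "\<gamma> 0 \<in> O'" using \<gamma>(2) V(2) r(1) by (simp add: O'_def z0_def)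
      then have "s \<noteq> 0" using s(3) by metis
      then have "s > 0" using s(1) by simp
      have "{u \<in> {0..s}. \<gamma> u \<in> C} = {0..s}"
      proof -
        have "closedin (top_of_set {0..s}) {u \<in> topspace (top_of_set {0..s}). \<gamma> u \<in> C}"
          using closedin_continuous_map_preimage[OF sub01 C] s t1 by simp
        then have cl: "closed {u \<in> {0..s}. \<gamma> u \<in> C}" using closedin_closed_trans[of "{0..s}"] by simp
        have "{0<..<s} \<subseteq> {u \<in> {0..s}. \<gamma> u \<in> C}" using before OC by auto
        then have "closure {0<..<s} \<subseteq> {u \<in> {0..s}. \<gamma> u \<in> C}" using cl by (rule closure_minimal)
        then show ?thesis using \<open>s > 0\<close> by auto
      qed
      then have inC: "\<gamma> u \<in> C" if "u \<in> {0..s}" for u using that by blast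
      have "h (\<phi> (\<gamma> s)) = h z0 + of_real s * v" by (rule grow[OF s(1) _ inC]) (use s t1 in auto)
      then have "cmod (h (\<phi> (\<gamma> s)) - h z0) = s * cmod v" using s(1) by (simp add: norm_mult)
      moreover have "\<phi> (\<gamma> s) \<in> sphere z0 r" using inC[of s] s by (auto simp: C_def O'_def)
      ultimately have "m \<le> s * cmod v" using z1(2) unfolding m_def by metis
      also have "\<dots> \<le> t1 * cmod v" by (intro mult_right_mono s) simp
      finally show False using t1 by simp
    qed
    \<comment> \<open>A shorter saddle connection would stay in the disk and end at its only
      singularity p, where h would have to differ from h z0 by v \<noteq> 0.\<close>
    have mv: "m \<le> cmod v"
    proof (rule ccontr)
      assume "\<not> ?thesis"
      then have in1: "\<And>t. t \<in> {0..1} \<Longrightarrow> \<gamma> t \<in> O'" using stay[of 1] by simp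
      have "\<gamma> 1 \<in> V" "\<phi> (\<gamma> 1) \<in> ball z0 R"
        using in1[of 1] rR ball_subset_cball[of z0 r] unfolding O'_def by force+
      then have "\<gamma> 1 \<in> W" by (rule ball_W)
      then have "\<gamma> 1 = p" using W(3) path(3) by blast
      moreover have "h (\<phi> (\<gamma> 1)) = h z0 + of_real 1 * v" by (rule grow) (use in1 OC in auto)
      ultimately show False using v0 by (simp add: z0_def)
    qed
    define t1 where "t1 = m / 2 / cmod v"
    have t1: "0 \<le> t1" "t1 \<le> 1" "t1 * cmod v < m" using m mv v0 by (simp_all add: t1_def)
    have inO: "\<And>t. t \<in> {0..t1} \<Longrightarrow> \<gamma> t \<in> O'" using stay[OF t1] by blast
    have "h (\<phi> (\<gamma> t1)) = h z0 + of_real t1 * v" by (rule grow[OF t1(1,2)]) (use inO OC in blast)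
    also have "of_real t1 * v = of_real (m / 2) * sgn v" by (simp add: t1_def sgn_eq)
    finally have "h (\<phi> (\<gamma> t1)) - (h z0 + of_real (m / 2) * sgn v) = 0" by simp
    moreover have "\<gamma> t1 \<in> C" using inO[of t1] OC t1 by auto
    ultimately have "\<gamma> t1 \<in> Q (sgn v)" unfolding Q_def
      using chart_inv_f[OF cV, of "\<gamma> t1"] by (intro image_eqI[of _ _ "\<phi> (\<gamma> t1)"]) (auto simp: C_def)
    then show ?thesis using mv by (simp add: v_def t1_def)
  qed
  ultimately show ?thesis using m by blast
qed

section \<open>Finiteness in each direction and the shortest saddle connection\<close>

lemma has_velocity_rescale:
  assumes "has_velocity M \<gamma> (c * t) v"
  shows "has_velocity M (\<lambda>s. \<gamma> (c * s)) t (of_real c * v)"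
  unfolding has_velocity_def
proof (intro allI impI)
  fix V \<phi> assume V: "(V, \<phi>) \<in> atlas M" "\<gamma> (c * t) \<in> V"
  then obtain d where d: "((\<lambda>s. \<phi> (\<gamma> s)) has_vector_derivative d) (at (c * t))" "oneform M (V, \<phi>) (\<phi> (\<gamma> (c * t))) * d = v"
    using assms unfolding has_velocity_def by blast
  have "((\<lambda>s. c * s) has_real_derivative c) (at t)" by (auto intro!: derivative_eq_intros)
  then have "(((\<lambda>s. \<phi> (\<gamma> s)) \<circ> (\<lambda>s. c * s)) has_vector_derivative c *\<^sub>R d) (at t)"
    by (intro vector_diff_chain_at) (use d(1) in \<open>auto simp: has_real_derivative_iff_has_vector_derivative\<close>)
  then have "((\<lambda>s. \<phi> (\<gamma> (c * s))) has_vector_derivative of_real c * d) (at t)"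
    by (simp add: comp_def scaleR_conv_of_real)
  moreover have "oneform M (V, \<phi>) (\<phi> (\<gamma> (c * t))) * (of_real c * d) = of_real c * v"
    using d(2) by (simp add: mult.left_commute)
  ultimately show "\<exists>d. ((\<lambda>s. \<phi> (\<gamma> (c * s))) has_vector_derivative d) (at t) \<and>
      oneform M (V, \<phi>) (\<phi> (\<gamma> (c * t))) * d = of_real c * v" by blast
qed

text \<open>Slowed down to the velocity of \<alpha>, the longer \<beta> agrees with \<alpha> from
  the common point at length \<rho> onwards, so \<beta> is singular where \<alpha> ends. As the
  interior of \<beta> contains no singularity, both have the same length.\<close>

lemma saddles_coincide:
  assumes \<alpha>: "saddle_connection M \<alpha>" and \<beta>: "saddle_connection M \<beta>"
    and dir: "sgn (holonomy M \<alpha>) = sgn (holonomy M \<beta>)" and le: "cmod (holonomy M \<alpha>) \<le> cmod (holonomy M \<beta>)"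
    and \<rho>: "0 < \<rho>" "\<rho> < cmod (holonomy M \<alpha>)"
    and eq: "\<alpha> (\<rho> / cmod (holonomy M \<alpha>)) = \<beta> (\<rho> / cmod (holonomy M \<beta>))"
  shows "holonomy M \<alpha> = holonomy M \<beta>"
proof -
  define v w where vw: "v = holonomy M \<alpha>" "w = holonomy M \<beta>"
  have n: "cmod v > 0" "cmod w > 0" using saddle_data(1)[OF \<alpha>] saddle_data(1)[OF \<beta>] by (simp_all add: vw)
  define c where "c = cmod v / cmod w"
  have c: "0 < c" "c \<le> 1" using n le by (simp_all add: c_def vw)
  have "v = of_real (cmod v) * sgn v" using n by (simp add: sgn_eq)
  also have "sgn v = w / of_real (cmod w)" using dir by (simp add: vw sgn_eq)
  finally have v: "v = of_real c * w" by (simp add: c_def)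
  let ?\<beta> = "\<lambda>s. \<beta> (c * s)"
  have ct: "c * t \<in> {0<..<1}" if "t \<in> {0<..<1}" for t
    using that c mult_strict_mono'[of c 1 t 1] mult_left_le[of t c] by (auto simp: mult_le_one less_le_trans intro: le_less_trans[of "c * t" t])
  have "\<alpha> 1 = ?\<beta> 1"
  proof (rule unique_continuation[of \<alpha> v ?\<beta> "\<rho> / cmod v"])
    show "continuous_map (top_of_set {0..1}) X \<alpha>" by (rule saddle_path(1)[OF \<alpha>])
    show "has_velocity M \<alpha> t v" if "t \<in> {0<..<1}" for t using saddle_data(3)[OF \<alpha> that] by (simp add: vw)
    show "\<alpha> t \<notin> Sing" if "t \<in> {0<..<1}" for t by (rule saddle_path(4)[OF \<alpha> that])
    have "continuous_map (top_of_set {0..1}) (top_of_set {0..1}) (\<lambda>s. c * s)"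
      using c by (auto simp: continuous_map_in_subtopology mult_le_one intro!: continuous_intros)
    from continuous_map_compose[OF this saddle_path(1)[OF \<beta>]]
    show "continuous_map (top_of_set {0..1}) X ?\<beta>" by (simp add: comp_def)
    show "has_velocity M ?\<beta> t v" if "t \<in> {0<..<1}" for t
      unfolding v by (rule has_velocity_rescale) (use saddle_data(3)[OF \<beta> ct[OF that]] in \<open>simp add: vw\<close>)
    show "\<rho> / cmod v \<in> {0<..<1}" using \<rho> n by (simp add: vw)
    have "c * (\<rho> / cmod v) = \<rho> / cmod w" using n by (simp add: c_def)
    then show "\<alpha> (\<rho> / cmod v) = \<beta> (c * (\<rho> / cmod v))" using eq by (simp add: vw)
  qed
  then have "\<beta> c \<in> Sing" using saddle_path(3)[OF \<alpha>] by simp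
  have "\<not> c < 1"
  proof
    assume "c < 1"
    then have "c \<in> {0<..<1}" using c by simp
    then show False using saddle_path(4)[OF \<beta>] \<open>\<beta> c \<in> Sing\<close> by blast
  qed
  then have "c = 1" using c(2) by linarith
  then show ?thesis using v by (simp add: vw)
qed

lemma saddles_bounded_below: "\<exists>r>0. \<forall>\<gamma>. saddle_connection M \<gamma> \<longrightarrow> r \<le> cmod (holonomy M \<gamma>)"
proof -
  have "\<exists>m. p \<in> Sing \<longrightarrow> m > 0 \<and> (\<forall>\<gamma>. saddle_connection M \<gamma> \<longrightarrow> \<gamma> 0 = p \<longrightarrow> m \<le> cmod (holonomy M \<gamma>))" for p
    using saddle_departure[of p] by blast
  then obtain m where m: "\<And>p. p \<in> Sing \<longrightarrow> m p > 0 \<and> (\<forall>\<gamma>. saddle_connection M \<gamma> \<longrightarrow> \<gamma> 0 = p \<longrightarrow> m p \<le> cmod (holonomy M \<gamma>))"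
    by metis
  define r where "r = Min (insert 1 (m ` Sing))"
  have "r > 0" using m finite_Sing by (simp add: r_def)
  moreover have "r \<le> cmod (holonomy M \<gamma>)" if \<gamma>: "saddle_connection M \<gamma>" for \<gamma>
  proof -
    have "\<gamma> 0 \<in> Sing" by (rule saddle_path(2)[OF \<gamma>])
    then have "r \<le> m (\<gamma> 0)" unfolding r_def using finite_Sing by (intro Min_le) auto
    also have "\<dots> \<le> cmod (holonomy M \<gamma>)" using m \<open>\<gamma> 0 \<in> Sing\<close> \<gamma> by blast
    finally show ?thesis .
  qed
  ultimately show ?thesis by blast
qed

text \<open>Among saddle connections leaving a fixed p in direction e, the position after length m/2
  determines the holonomy by \<open>saddles_coincide\<close>, and it ranges over the finite set
  \<open>Q e\<close>. Only finitely many p occur.\<close>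

lemma finite_ray: "finite {v. sgn v = e \<and> (\<exists>\<gamma>. saddle_connection M \<gamma> \<and> holonomy M \<gamma> = v)}"
proof -
  define H where "H p = {v. sgn v = e \<and> (\<exists>\<gamma>. saddle_connection M \<gamma> \<and> \<gamma> 0 = p \<and> holonomy M \<gamma> = v)}" for p
  have fin: "finite (H p)" if p: "p \<in> Sing" for p
  proof -
    obtain m Q where m: "m > 0" and Q: "\<And>e. finite (Q e)" and dep: "\<And>\<gamma>. saddle_connection M \<gamma> \<Longrightarrow> \<gamma> 0 = p \<Longrightarrow>
      m \<le> cmod (holonomy M \<gamma>) \<and> \<gamma> (m / 2 / cmod (holonomy M \<gamma>)) \<in> Q (sgn (holonomy M \<gamma>))"
      using saddle_departure[OF p] by metis
    have "\<exists>\<gamma>. v \<in> H p \<longrightarrow> saddle_connection M \<gamma> \<and> \<gamma> 0 = p \<and> holonomy M \<gamma> = v" for v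
      unfolding H_def by blast
    then obtain G where G: "\<And>v. v \<in> H p \<longrightarrow> saddle_connection M (G v) \<and> G v 0 = p \<and> holonomy M (G v) = v" by metis
    define f where "f v = G v (m / 2 / cmod v)" for v
    have f: "f v \<in> Q e" if "v \<in> H p" for v
      using dep[of "G v"] G[of v] that by (auto simp: f_def H_def)
    have key: "v = w" if vw: "v \<in> H p" "w \<in> H p" "f v = f w" "cmod v \<le> cmod w" for v w
    proof -
      have g: "saddle_connection M (G v)" "G v 0 = p" "holonomy M (G v) = v"
        "saddle_connection M (G w)" "G w 0 = p" "holonomy M (G w) = w" using G vw(1,2) by auto
      have "m \<le> cmod v" using dep[OF g(1,2)] g(3) by simp
      then have "m / 2 < cmod v" using m by simp
      have "sgn v = sgn w" using vw(1,2) by (simp add: H_def)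
      then show ?thesis
        using saddles_coincide[OF g(1,4), of "m / 2"] g(3,6) vw(3,4) m \<open>m / 2 < cmod v\<close> by (simp add: f_def)
    qed
    have "inj_on f (H p)"
    proof (rule inj_onI)
      fix v w assume "v \<in> H p" "w \<in> H p" "f v = f w"
      then show "v = w" using key[of v w] key[of w v] by (metis linear)
    qed
    moreover have "f ` H p \<subseteq> Q e" using f by blast
    ultimately show ?thesis using Q finite_imageD finite_subset by metis
  qed
  have "finite (\<Union>p\<in>Sing. H p)" using finite_Sing fin by (rule finite_UN_I)
  moreover have "{v. sgn v = e \<and> (\<exists>\<gamma>. saddle_connection M \<gamma> \<and> holonomy M \<gamma> = v)} \<subseteq> (\<Union>p\<in>Sing. H p)"
    using saddle_path(2) unfolding H_def by blast
  ultimately show ?thesis by (rule finite_subset[rotated])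
qed

end

section \<open>The Veech group action\<close>

definition real_linear :: "real^2^2 \<Rightarrow> complex \<Rightarrow> complex" where
  "real_linear g z = vec_to_complex (g *v complex_to_vec z)"

lemma complex_to_vec_real_linear: "complex_to_vec (real_linear g z) = g *v complex_to_vec z"
  by (simp add: real_linear_def)

lemma real_linear_add: "real_linear g (z + of_real s * w) = real_linear g z + of_real s * real_linear g w"
  by (simp add: real_linear_def vec_to_complex_def mat2_simps complex_eq_iff algebra_simps)

lemma real_linear_eq_0:
  assumes "g \<in> SL2_set" "real_linear g z = 0" shows "z = 0"
proof -
  have "g *v complex_to_vec z = 0"
    using assms(2) complex_to_vec_real_linear[of g z] by (simp add: vec_eq_2)
  then have "inv2 g *v (g *v complex_to_vec z) = 0" by simp
  then show ?thesis using assms(1) by (simp add: vec_eq_2 complex_eq_iff)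
qed

text \<open>By the chain rule the derivative of \<xi> composed with F is the form of N times the
  derivative of F, which the isomorphism equates with the form of M.\<close>

lemma flat_coordinate_pullback:
  assumes M: "tsurface M" and N: "tsurface N" and iso: "translation_iso M N F" and flat: "flat_coordinate N (U, \<xi>)"
  shows "flat_coordinate M ({q \<in> topspace (surf M). F q \<in> U}, \<lambda>q. \<xi> (F q))"
proof -
  interpret M: tsurface M by (rule M)
  interpret N: tsurface N by (rule N)
  have hom: "homeomorphic_map (surf M) (surf N) F" and FS: "F ` singularities M = singularities N"
    and der: "\<And>V \<phi> W \<psi> p. (V, \<phi>) \<in> atlas M \<Longrightarrow> (W, \<psi>) \<in> atlas N \<Longrightarrow> p \<in> V \<Longrightarrow> F p \<in> W \<Longrightarrow>
      \<exists>D. ((\<psi> \<circ> F \<circ> inv_into V \<phi>) has_field_derivative D) (at (\<phi> p)) \<and>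
          oneform M (V, \<phi>) (\<phi> p) = oneform N (W, \<psi>) (\<psi> (F p)) * D"
    using iso unfolding translation_iso_def by blast+
  have cU: "is_chart (surf N) (U, \<xi>)" and US: "U \<inter> singularities N = {}"
    and derN: "\<And>W \<psi> p. (W, \<psi>) \<in> atlas N \<Longrightarrow> p \<in> U \<inter> W \<Longrightarrow>
      ((\<xi> \<circ> inv_into W \<psi>) has_field_derivative oneform N (W, \<psi>) (\<psi> p)) (at (\<psi> p))"
    using flat unfolding flat_coordinate_def by auto
  let ?U = "{q \<in> topspace (surf M). F q \<in> U}"
  have contF: "continuous_map (surf M) (surf N) F" by (rule homeomorphic_imp_continuous_map[OF hom])
  have FX: "F ` topspace (surf M) = topspace (surf N)" by (rule homeomorphic_imp_surjective_map[OF hom])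
  have UN: "U \<subseteq> topspace (surf N)" using chart_open(1)[OF cU] openin_subset by blast
  have FU: "F ` ?U = U"
  proof (intro equalityI subsetI)
    fix u assume u: "u \<in> U"
    then have "u \<in> F ` topspace (surf M)" using UN FX by blast
    then show "u \<in> F ` ?U" using u by blast
  qed blast
  have "homeomorphic_map (subtopology (surf M) ?U) (subtopology (surf N) U) F"
  proof (rule homeomorphic_map_subtopologies[OF hom])
    show "F ` (topspace (surf M) \<inter> ?U) = topspace (surf N) \<inter> U" using FU UN by blast
  qed
  moreover have "homeomorphic_map (subtopology (surf N) U) (top_of_set (\<xi> ` U)) \<xi>"
    using cU by (simp add: is_chart_def)
  ultimately have "homeomorphic_map (subtopology (surf M) ?U) (top_of_set (\<xi> ` U)) (\<xi> \<circ> F)"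
    by (rule homeomorphic_map_compose)
  moreover have img: "(\<lambda>q. \<xi> (F q)) ` ?U = \<xi> ` U" by (subst (2) FU[symmetric]) (simp add: image_image)
  moreover have openU: "openin (surf M) ?U" by (rule openin_continuous_map_preimage[OF contF chart_open(1)[OF cU]])
  ultimately have chart: "is_chart (surf M) (?U, \<lambda>q. \<xi> (F q))"
    using chart_open(2)[OF cU] by (simp add: is_chart_def comp_def)
  have sing: "?U \<inter> singularities M = {}" using US FS by blast
  have "(((\<lambda>q. \<xi> (F q)) \<circ> inv_into V \<phi>) has_field_derivative oneform M (V, \<phi>) (\<phi> p)) (at (\<phi> p))"
    if V: "(V, \<phi>) \<in> atlas M" and p: "p \<in> ?U \<inter> V" for V \<phi> p
  proof -
    have cV: "is_chart (surf M) (V, \<phi>)" by (rule M.charts[OF V])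
    have "F p \<in> topspace (surf N)" using p UN by blast
    then obtain W \<psi> where W: "(W, \<psi>) \<in> atlas N" "F p \<in> W" using N.cover by blast
    have cW: "is_chart (surf N) (W, \<psi>)" by (rule N.charts[OF W(1)])
    obtain D where D: "((\<psi> \<circ> F \<circ> inv_into V \<phi>) has_field_derivative D) (at (\<phi> p))"
      "oneform M (V, \<phi>) (\<phi> p) = oneform N (W, \<psi>) (\<psi> (F p)) * D"
      using der[OF V W(1) _ W(2)] p by blast
    have at: "(\<psi> \<circ> F \<circ> inv_into V \<phi>) (\<phi> p) = \<psi> (F p)" using p cV by simp
    have "((\<xi> \<circ> inv_into W \<psi>) has_field_derivative oneform N (W, \<psi>) (\<psi> (F p))) (at ((\<psi> \<circ> F \<circ> inv_into V \<phi>) (\<phi> p)))"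
      unfolding at by (rule derN[OF W(1)]) (use p W in blast)
    from DERIV_chain[OF this D(1)]
    have "(((\<xi> \<circ> inv_into W \<psi>) \<circ> (\<psi> \<circ> F \<circ> inv_into V \<phi>)) has_field_derivative oneform M (V, \<phi>) (\<phi> p)) (at (\<phi> p))"
      unfolding D(2) .
    then show ?thesis
    proof (rule has_field_derivative_transform_within_open)
      let ?W = "{q \<in> topspace (surf M). F q \<in> W}"
      have "openin (surf M) ?W" by (rule openin_continuous_map_preimage[OF contF chart_open(1)[OF cW]])
      then have "openin (surf M) (V \<inter> ?W)" using chart_open(1)[OF cV] by blast
      then show "open (\<phi> ` (V \<inter> ?W))" by (rule chart_open_image[OF cV]) blast
      show "\<phi> p \<in> \<phi> ` (V \<inter> ?W)" using p W(2) by blast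
      fix z assume "z \<in> \<phi> ` (V \<inter> ?W)"
      then obtain q where "q \<in> V" "F q \<in> W" "z = \<phi> q" by blast
      then show "((\<xi> \<circ> inv_into W \<psi>) \<circ> (\<psi> \<circ> F \<circ> inv_into V \<phi>)) z = ((\<lambda>q. \<xi> (F q)) \<circ> inv_into V \<phi>) z"
        using cV cW by simp
    qed
  qed
  then show ?thesis unfolding flat_coordinate_def using chart sing by blast
qed

context tsurface begin

text \<open>The surface N = g M has the same points as M, and in its flat coordinates the path
  \<gamma> runs straight with velocity g v. The isomorphism F goes from M to N, so its inverse G
  carries this path to a saddle connection of M.\<close>

lemma veech_group_act:
  assumes g: "g \<in> veech_group M" and \<gamma>: "saddle_connection M \<gamma>"
  shows "\<exists>\<delta>. saddle_connection M \<delta> \<and> holonomy M \<delta> = real_linear g (holonomy M \<gamma>)"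
proof -
  obtain N F where gS: "g \<in> SL2_set" and act: "SL2_action g M N" and iso: "translation_iso M N F"
    using g unfolding veech_group_def by blast
  have N: "translation_surface N" "surf N = X" "singularities N = Sing"
    and flatN: "\<And>U \<zeta>. flat_coordinate M (U, \<zeta>) \<Longrightarrow> flat_coordinate N (U, \<lambda>p. real_linear g (\<zeta> p))"
    using act unfolding SL2_action_def real_linear_def by blast+
  have tN: "tsurface N" by (simp add: tsurface_def N)
  have hom: "homeomorphic_map X X F" and FS: "F ` Sing = Sing"
    using iso unfolding translation_iso_def N by blast+
  obtain G where G: "homeomorphic_maps X X F G" using hom homeomorphic_map_maps by blast
  have contG: "continuous_map X X G" and GF: "\<And>q. q \<in> topspace X \<Longrightarrow> G (F q) = q"
    and FG: "\<And>q. q \<in> topspace X \<Longrightarrow> F (G q) = q"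
    using G unfolding homeomorphic_maps_def by blast+
  have GX: "G q \<in> topspace X" if "q \<in> topspace X" for q using contG that by (auto simp: continuous_map_def)
  have GS: "G q \<in> Sing" if "q \<in> Sing" for q
  proof -
    obtain q' where "q' \<in> Sing" "q = F q'" using FS \<open>q \<in> Sing\<close> by blast
    then show ?thesis using GF Sing_subset by auto
  qed
  have GS': "q \<in> Sing" if "q \<in> topspace X" "G q \<in> Sing" for q
    using FS FG[OF that(1)] that(2) by (metis imageI)
  let ?\<delta> = "\<lambda>s. G (\<gamma> s)" and ?v = "holonomy M \<gamma>"
  have line: "flat_line M ?\<delta> t (real_linear g ?v)" if t: "t \<in> {0<..<1}" for t
  proof -
    obtain U \<zeta> \<epsilon> where flat: "flat_coordinate M (U, \<zeta>)" and \<epsilon>: "\<epsilon> > 0"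
      and l: "\<And>s. \<bar>s - t\<bar> < \<epsilon> \<Longrightarrow> \<gamma> s \<in> U \<and> \<zeta> (\<gamma> s) = \<zeta> (\<gamma> t) + of_real (s - t) * ?v"
      using saddle_data(2)[OF \<gamma> t] unfolding flat_line_def by blast
    have "is_chart X (U, \<zeta>)" using flat by (simp add: flat_coordinate_def)
    then have UX: "U \<subseteq> topspace X" by (rule chart_open(1)[THEN openin_subset])
    have "flat_coordinate M ({q \<in> topspace X. F q \<in> U}, \<lambda>q. real_linear g (\<zeta> (F q)))"
      by (rule flat_coordinate_pullback[OF tsurface_axioms tN iso flatN[OF flat]])
    moreover have "?\<delta> s \<in> {q \<in> topspace X. F q \<in> U} \<and>
        real_linear g (\<zeta> (F (?\<delta> s))) = real_linear g (\<zeta> (F (?\<delta> t))) + of_real (s - t) * real_linear g ?v"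
      if s: "\<bar>s - t\<bar> < \<epsilon>" for s
    proof -
      have "\<gamma> s \<in> topspace X" "\<gamma> t \<in> topspace X" using l[OF s] l[of t] \<epsilon> UX by auto
      moreover have "real_linear g (\<zeta> (\<gamma> s)) = real_linear g (\<zeta> (\<gamma> t)) + of_real (s - t) * real_linear g ?v"
        unfolding conjunct2[OF l[OF s]] by (rule real_linear_add)
      ultimately show ?thesis using GX FG l[OF s] by simp
    qed
    ultimately show ?thesis unfolding flat_line_def using \<epsilon> by blast
  qed
  have path: "pathin X \<gamma>" "\<gamma> 0 \<in> Sing" "\<gamma> 1 \<in> Sing" "\<And>t. t \<in> {0<..<1} \<Longrightarrow> \<gamma> t \<notin> Sing"
    using \<gamma> by (auto simp: saddle_connection_def)
  have nz: "real_linear g ?v \<noteq> 0" using real_linear_eq_0[OF gS] saddle_data(1)[OF \<gamma>] by blast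
  have "saddle_connection M ?\<delta>" unfolding saddle_connection_def
  proof (intro conjI ballI)
    show "pathin X ?\<delta>" using pathin_compose[OF path(1) contG] by (simp add: comp_def)
    show "?\<delta> 0 \<in> Sing" "?\<delta> 1 \<in> Sing" using path GS by auto
    fix t :: real assume t: "t \<in> {0<..<1}"
    show "?\<delta> t \<notin> Sing" using GS'[OF flat_line_in_topspace[OF saddle_data(2)[OF \<gamma> t]]] path(4)[OF t] by blast
    show "\<exists>U \<zeta> v \<epsilon>. flat_coordinate M (U, \<zeta>) \<and> v \<noteq> 0 \<and> \<epsilon> > 0 \<and>
        (\<forall>s. \<bar>s - t\<bar> < \<epsilon> \<longrightarrow> ?\<delta> s \<in> U \<and> \<zeta> (?\<delta> s) = \<zeta> (?\<delta> t) + of_real (s - t) * v)"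
      using line[OF t] nz unfolding flat_line_def by blast
  qed
  moreover have "holonomy M ?\<delta> = real_linear g ?v"
    by (rule holonomy_eq(1)[of ?\<delta> "1/2"]) (use line in \<open>auto intro: exI\<close>)
  ultimately show ?thesis by blast
qed

lemma lattice_action_veech:
  assumes L: "lattice_SL2 (veech_group M)"
  shows "lattice_action (veech_group M) (saddle_holonomies M)"
proof -
  let ?\<Gamma> = "veech_group M"
  have sg: "subgroup ?\<Gamma> SL2" and disc: "discrete ?\<Gamma>" using L unfolding lattice_SL2_def by blast+
  have sub: "?\<Gamma> \<subseteq> SL2_set" and one: "mat 1 \<in> ?\<Gamma>"
    and mult: "\<And>A B. A \<in> ?\<Gamma> \<Longrightarrow> B \<in> ?\<Gamma> \<Longrightarrow> A ** B \<in> ?\<Gamma>"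
    using subgroup.subset[OF sg] subgroup.one_closed[OF sg] subgroup.m_closed[OF sg] by (simp_all add: SL2_def)
  have inv: "inv2 A \<in> ?\<Gamma>" if A: "A \<in> ?\<Gamma>" for A
  proof -
    have AS: "A \<in> SL2_set" using A sub by blast
    have "inv\<^bsub>SL2\<^esub> A = inv2 A" unfolding m_inv_def
    proof (rule the_equality)
      show "inv2 A \<in> carrier SL2 \<and> A \<otimes>\<^bsub>SL2\<^esub> inv2 A = \<one>\<^bsub>SL2\<^esub> \<and> inv2 A \<otimes>\<^bsub>SL2\<^esub> A = \<one>\<^bsub>SL2\<^esub>"
        using AS by (simp add: SL2_def inv2_left inv2_right)
      show "y = inv2 A" if "y \<in> carrier SL2 \<and> A \<otimes>\<^bsub>SL2\<^esub> y = \<one>\<^bsub>SL2\<^esub> \<and> y \<otimes>\<^bsub>SL2\<^esub> A = \<one>\<^bsub>SL2\<^esub>" for y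
        using that by (intro inv2_unique[OF AS]) (simp add: SL2_def)
    qed
    then show ?thesis using subgroup.m_inv_closed[OF sg A] by simp
  qed
  show ?thesis
  proof (unfold_locales)
    show "?\<Gamma> \<subseteq> SL2_set" "mat 1 \<in> ?\<Gamma>" by (rule sub, rule one)
    show "\<And>A B. A \<in> ?\<Gamma> \<Longrightarrow> B \<in> ?\<Gamma> \<Longrightarrow> A ** B \<in> ?\<Gamma>" by (rule mult)
    show "\<And>A. A \<in> ?\<Gamma> \<Longrightarrow> inv2 A \<in> ?\<Gamma>" by (rule inv)
    have "mat 1 isolated_in ?\<Gamma>" using disc one by (rule discreteD)
    then obtain e where "e > 0" "\<And>A. A \<in> ?\<Gamma> \<Longrightarrow> dist (mat 1) A < e \<Longrightarrow> A = mat 1"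
      unfolding isolated_in_dist_Ex_iff by (metis dist_commute)
    then show "\<exists>\<epsilon>>0. \<forall>\<gamma>\<in>?\<Gamma>. norm (\<gamma> - mat 1) < \<epsilon> \<longrightarrow> \<gamma> = mat 1"
      by (intro exI[of _ e]) (simp add: dist_norm norm_minus_commute)
    show "\<exists>m::nat. \<forall>G. finite G \<longrightarrow> packed ?\<Gamma> \<epsilon> G id \<longrightarrow> card G \<le> m" if "\<epsilon> > 0" for \<epsilon>
      by (rule lattice_packing[OF L that sub one mult inv])
    show "A *v x \<in> saddle_holonomies M" if A: "A \<in> ?\<Gamma>" and x: "x \<in> saddle_holonomies M" for A x
    proof -
      obtain \<gamma> where \<gamma>: "saddle_connection M \<gamma>" "x = complex_to_vec (holonomy M \<gamma>)"
        using x unfolding saddle_holonomies_def by blast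
      obtain \<delta> where "saddle_connection M \<delta>" "holonomy M \<delta> = real_linear A (holonomy M \<gamma>)"
        using veech_group_act[OF A \<gamma>(1)] by blast
      moreover then have "A *v x = complex_to_vec (holonomy M \<delta>)"
        by (simp add: complex_to_vec_real_linear \<gamma>(2))
      ultimately show ?thesis unfolding saddle_holonomies_def by blast
    qed
    show "\<exists>r>0. \<forall>x\<in>saddle_holonomies M. r \<le> norm x"
      using saddles_bounded_below unfolding saddle_holonomies_def by fastforce
  qed
qed

text \<open>A line through the origin consists of two opposite rays and the origin, and no holonomy
  is 0.\<close>

lemma finite_line:
  assumes "x \<in> saddle_holonomies M"
  shows "finite {y \<in> saddle_holonomies M. wedge x y = 0}"
proof -
  let ?R = "\<lambda>e. {v. sgn v = e \<and> (\<exists>\<gamma>. saddle_connection M \<gamma> \<and> holonomy M \<gamma> = v)}"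
  obtain \<alpha> where \<alpha>: "saddle_connection M \<alpha>" "x = complex_to_vec (holonomy M \<alpha>)"
    using assms unfolding saddle_holonomies_def by blast
  define v where "v = holonomy M \<alpha>"
  have v0: "v \<noteq> 0" using saddle_data(1)[OF \<alpha>(1)] by (simp add: v_def)
  then have x0: "x \<noteq> 0" using \<alpha>(2) by (auto simp: vec_eq_2 complex_eq_iff v_def)
  have "{y \<in> saddle_holonomies M. wedge x y = 0} \<subseteq> complex_to_vec ` (?R (sgn v) \<union> ?R (- sgn v))"
  proof clarify
    fix y assume y: "y \<in> saddle_holonomies M" "wedge x y = 0"
    then obtain \<beta> where \<beta>: "saddle_connection M \<beta>" "y = complex_to_vec (holonomy M \<beta>)"
      unfolding saddle_holonomies_def by blast
    obtain c where "y = c *\<^sub>R x" using y(2) wedge_eq_0_iff[OF x0] by blast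
    then have w: "holonomy M \<beta> = c *\<^sub>R v"
      using \<beta>(2) \<alpha>(2) by (simp add: v_def vec_eq_2 complex_eq_iff)
    have "c \<noteq> 0" using w saddle_data(1)[OF \<beta>(1)] by auto
    then have "sgn (holonomy M \<beta>) = sgn v \<or> sgn (holonomy M \<beta>) = - sgn v"
      unfolding w by (cases "c > 0") (auto simp: sgn_scaleR)
    then show "y \<in> complex_to_vec ` (?R (sgn v) \<union> ?R (- sgn v))" using \<beta> by blast
  qed
  moreover have "finite (complex_to_vec ` (?R (sgn v) \<union> ?R (- sgn v)))"
    using finite_ray by (intro finite_imageI finite_UnI)
  ultimately show ?thesis by (rule finite_subset)
qed

end

theorem theorem1p6:
  fixes M :: "'a surface"
  assumes "veech_surface M"
  shows "\<exists>C c :: real. \<forall>D > 0.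
    Limsup at_top (\<lambda>R :: real. ecardinality (close_pairs M D R) / ereal (R\<^sup>2))
      \<le> ereal (C * (D + c))"
proof -
  interpret tsurface M using assms by (simp add: tsurface_def veech_surface_def)
  interpret lattice_action "veech_group M" "saddle_holonomies M"
    using assms by (intro lattice_action_veech) (simp add: veech_surface_def)
  obtain \<epsilon> N where \<epsilon>: "\<epsilon> > 0"
    and sep: "\<forall>x\<in>saddle_holonomies M. \<forall>y\<in>saddle_holonomies M. wedge x y = 0 \<or> \<epsilon> \<le> \<bar>wedge x y\<bar>"
    and card: "\<forall>x\<in>saddle_holonomies M. card {y\<in>saddle_holonomies M. wedge x y = 0} \<le> N"
    using no_small_triangles[OF finite_line] by blast
  show ?thesis
    by (rule close_pairs_limsup[of M \<epsilon> N]) (use sep card \<epsilon> finite_line nonzero in blast)+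
qed

end
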